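(* Let $(A,M,I)$ be an $A_\infty$ algebra with an $A_\infty$ module and an $A_\infty$ inner product over a commutative unital ring $R$. If $(A,M,I)$ is formal, then all its Massey inner products are trivial: for all $k,\ell\ge0$ with $k+\ell\ge1$ and all $(x_1,\dots,x_{k+\ell+2})\in A^{\times k}\times M\times A^{\times\ell}\times M$, the set $\langle x_1,\dots,x_{k+\ell+2}\rangle_I\subseteq R$ is empty or contains $0$.
   Context: Shift and $A_\infty$ algebras. For a graded $R$-module $A=\bigoplus_{k\ge0}A_k$, $\underline A$ is $A$ shifted down by one: $|\underline a|=|a|-1$; $\mathfrak s:A\to\underline A$, $a\mapsto\underline a$. An $A_\infty$ algebra has maps $\mu_k:A^{\otimes k}\to A$ ($k\ge1$) of degree $2-k$ whose shifts $\underline{\mu_k}=\mathfrak s\circ\mu_k\circ(\mathfrak s^{-1})^{\otimes k}$ (of degree $1$) satisfy, for all $n\ge1$, $\sum_{k+\ell-1=n}\sum_{i+j+1=k}\underline{\mu_k}\circ(id^{\otimes i}\otimes\underline{\mu_\ell}\otimes id^{\otimes j})=0$. All signs are given by the Koszul rule in shifted degrees; underlines denote shifted versions of maps and elements. $d=\mu_1$ and $H(A)$ is its cohomology. Elements are homogeneous. A morphism $f:(A,\mu)\to(B,\nu)$ of $A_\infty$ algebras consists of maps $f_k:A^{\otimes k}\to B$ ($k\ge1$) of degree $1-k$ whose shifts (of degree $0$) satisfy, for all $n\ge 1$, $\sum_{k+\ell-1=n}\sum_{i+j+1=k}\underline{f_k}(id^{\otimes i}\otimes\underline{\mu_\ell}\otimes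 id^{\otimes j})=\sum_{\ell_1+\dots+\ell_k=n}\underline{\nu_k}(\underline{f_{\ell_1}}\otimes\dots\otimes\underline{f_{\ell_k}})$. $A_\infty$ modules. An $A_\infty$ module $M$ over $A$ has maps $\beta_{k,\ell}:A^{\otimes k}\otimes M\otimes A^{\otimes\ell}\to M$ ($k,\ell\ge0$) of degree $1-k-\ell$ whose shifts (of degree $1$) satisfy, for all $r,s\ge0$, $\sum_{k+\ell-1=r}\sum_{i+j+1=k}\underline{\beta_{k,s}}(id^{\otimes i}\otimes\underline{\mu_\ell}\otimes id^{\otimes j}\otimes id_{\underline M}\otimes id^{\otimes s})+\sum_{k+i=r,\,\ell+j=s}\underline{\beta_{i,j}}(id^{\otimes i}\otimes\underline{\beta_{k,\ell}}\otimes id^{\otimes j})+\sum_{k+\ell-1=s}\sum_{i+j+1=k}\underline{\beta_{r,k}}(id^{\otimes r}\otimes id_{\underline M}\otimes id^{\otimes i}\otimes\underline{\mu_\ell}\otimes id^{\otimes j})=0$. The differential of $M$ is $d=\beta_{0,0}$, with cohomology $H(M)$. For a family $F$ of maps $F_{k,\ell}:A^{\otimes k}\otimes M\otimes A^{\otimes\ell}\to N$ of degree $|F|-k-\ell$, let $\underline{(F\circ\beta)_{r,s}}$ be the expression of the previous display with the outer maps $\underline{\beta_{k,s}},\underline{\beta_{i,j}},\underline{\beta_{r,k}}$ replaced by $\underline{F_{k,s}},\underline{F_{i,j}},\underline{F_{r,k}}$. If $f:A\to B$ is a morphism of $A_\infty$ algebras, $(M,\beta)$ a module over $A$, $(N,\gamma)$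 a module over $B$, then $F$ is a morphism of $A_\infty$ modules over $f$ if for all $r,s\geq 0$, $\underline{(F\circ\beta)_{r,s}}=(-1)^{|F|}\sum_{k+k_1+\dots+k_i=r}\sum_{\ell+\ell_1+\dots+\ell_j=s}\underline{\gamma_{i,j}}(\underline{f_{k_1}}\otimes\dots\otimes\underline{f_{k_i}}\otimes\underline{F_{k,\ell}}\otimes\underline{f_{\ell_1}}\otimes\dots\otimes\underline{f_{\ell_j}})$. If $M$, $N$ are both modules over $A$, define $\delta(F)$ on any family $F$ by $\underline{\delta(F)_{r,s}}=\underline{(F\circ\beta)_{r,s}}-(-1)^{|F|}\sum_{k+i=r,\,\ell+j=s}\underline{\gamma_{i,j}}(id^{\otimes i}\otimes\underline{F_{k,\ell}}\otimes id^{\otimes j})$; thus $\delta(F)=0$ iff $F$ is a morphism over $id_A$. Dual module and inner products. $M^*=Hom(M,R)$ is an $A_\infty$ module over $A$ via $\underline{\beta'_{k,\ell}}(\underline{a_1},\dots,\underline{a_k},\underline{m^*},\underline{\tilde a_1},\dots,\underline{\tilde a_\ell})(\underline{\tilde m})=-(-1)^{\varepsilon}\,\underline{m^*}(\underline{\beta_{\ell,k}}(\underline{\tilde a_1},\dots,\underline{\tilde a_\ell},\underline{\tilde m},\underline{a_1},\dots,\underline{a_k}))$, with $\varepsilon=(|\underline{a_1}|+\dots+|\underline{a_k}|)(|\underline{m^*}|+|\underline{\tilde a_1}|+\dots+|\underline{\tilde a_\ell}|+|\underline{\tilde m}|)+|\underline{m^*}|$; elements of the shift of $M^*$ are evaluated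 on $\underline M$ by $\underline{m^*}(\underline m)=m^*(m)$. An $A_\infty$ inner product on $M$ is a morphism $I:M\to M^*$ of $A_\infty$ modules over $id_A$. It is exact if $I=\delta(G)$ for some family $G=\{G_{k,\ell}:A^{\otimes k}\otimes M\otimes A^{\otimes\ell}\to M^*\}$. Pullback. For $f:A\to B$ a morphism of $A_\infty$ algebras, $F:M\to N$ a morphism of $A_\infty$ modules over $f$, and $J$ an $A_\infty$ inner product on $N$, the pulled back $A_\infty$ inner product $F^\sharp(J)$ on $M$ is $\underline{F^\sharp(J)_{k,\ell}}(\underline{a_1},\dots,\underline{a_k},\underline m,\underline{\tilde a_1},\dots,\underline{\tilde a_\ell})(\underline{\tilde m})=\sum(-1)^{\varepsilon}\big(\underline{J_{i,j}}(\underline{f_{r_1}}\otimes\dots\otimes\underline{f_{r_i}}\otimes\underline{F_{r,s}}\otimes\underline{f_{s_1}}\otimes\dots\otimes\underline{f_{s_j}})(\underline{a_{k-p+1}},\dots,\underline{a_k},\underline m,\underline{\tilde a_1},\dots,\underline{\tilde a_q})\big)\big(\underline{F_{\ell-q,k-p}}(\underline{\tilde a_{q+1}},\dots,\underline{\tilde a_\ell},\underline{\tilde m},\underline{a_1},\dots,\underline{a_{k-p}})\big)$, summed over $0\le p\le k$, $0\le q\le\ell$, $r+r_1+\dots+r_i=p$, $s+s_1+\dots+s_j=q$, with $(-1)^\varepsilon$ the Koszul sign. Morphisms, equivalence, formality. For triples $(A,M,I)$, $(B,N,J)$ of an $A_\infty$ algebra, an $A_\infty$ module over it and an $A_\infty$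 inner product on the module, a morphism $(f,F):(A,M,I)\to(B,N,J)$ consists of a morphism $f:A\to B$ of $A_\infty$ algebras and a morphism $F:M\to N$ (of degree $0$) of $A_\infty$ modules over $f$ such that $F^\sharp(J)-I$ is an exact $A_\infty$ inner product. The triples are equivalent if there are morphisms $(f,F):(A,M,I)\to(B,N,J)$ and $(g,G):(B,N,J)\to(A,M,I)$ with $(f_1)_*=(g_1)_*^{-1}:H(A)\to H(B)$ and $(F_{0,0})_*=(G_{0,0})_*^{-1}:H(M)\to H(N)$. A triple is formal if it is equivalent to a triple whose only non-vanishing algebra structure map is $\mu_2$, whose only non-vanishing module structure maps are $\beta_{1,0}$ and $\beta_{0,1}$, and whose only non-vanishing inner product component is $I_{0,0}$. Cyclic defining systems. Put $n=k+\ell+2$ and let $(x_1,\dots,x_n)\in A^{\times k}\times M\times A^{\times\ell}\times M$ (so $x_{k+1},x_n\in M$). A cyclic triangular system consists of a family $(x_{i,j})_{1\le i\le j\le n-1}$ and a family $(x'_{i,j})$ indexed by pairs $i\preceq j$ in the linear order $k+2\prec\dots\prec n\prec1\prec\dots\prec k$ (corner entries of both families included), with $x_{i,i}=x_i$, $x'_{i,i}=x_i$; $x_{i,j}\in M$ if $i\le k+1\le j$ and $x_{i,j}\in A$ otherwise; $x'_{i,j}\in M$ if $i\preceq n\preceq j$ and $x'_{i,j}\in A$ otherwise; the shifted degree $|\underline{x_{i,j}}|$ (resp. $|\underline{x'_{i,j}}|$) equals $\sum|\underline{x_m}|$ over $m$ from $i$ to $j$ in the respective order; and $x_{i,j}=x'_{i,j}$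 whenever $1\le i\le j\le k$ or $k+2\le i\le j\le k+\ell+1$. The staircase product $\mathcal S^{i,j}$ of either family is defined by letting $\underline{\mathcal S^{i,j}}$ be the sum, over all ways of cutting the interval from $i$ to $j$ (in the respective order) into $t\ge2$ consecutive nonempty subintervals $[u_1,v_1],\dots,[u_t,v_t]$, of $\underline{\mu_t}$ (if all entries are in $A$) or $\underline{\beta_{r,s}}$ with $r+s+1=t$ (if the $(r+1)$-st entry is in $M$) applied to the shifted entries with indices $(u_1,v_1),\dots,(u_t,v_t)$. The system is a cyclic defining system if $d(x_{i,j})=-\mathcal S^{i,j}(\{x_{\bullet\bullet}\})$ and $d(x'_{i,j})=-\mathcal S^{i,j}(\{x'_{\bullet\bullet}\})$ for all $(i,j)$, corners included. Massey inner product. The staircase inner product of a cyclic defining system is $\mathcal I=\sum(-1)^{\varepsilon}\,\underline{I_{r,s}}(\underline{x_{u_1,v_1}},\dots,\underline{x_{u_{r+s+1},v_{r+s+1}}})(\underline{x'_{q+1,p-1}})\in R$, summed over all $1\le p\le k+1\le q\le k+\ell+1$ and all ways of cutting $[p,q]$ into consecutive nonempty subintervals $[u_1,v_1],\dots,[u_{r+s+1},v_{r+s+1}]$, where the $(r+1)$-st is the one containing $k+1$; for $p=1$, $p-1$ means $k+\ell+2$; and $\varepsilon=(|\underline{x_1}|+\dots+|\underline{x_{p-1}}|)(|\underline{x_p}|+\dots+|\underline{x_n}|)$. For $k+\ell\ge1$ the $(k,\ell)^{th}$ Massey inner product set $\langle x_1,\dots,x_n\rangle_I\subseteq R$ is the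 set of all values $\mathcal I$ over all cyclic defining systems for $(x_1,\dots,x_n)$. *)

theory Defs
  imports Complex_Main "HOL-Library.Function_Algebras"
begin

section \<open>Graded modules and homogeneous elements\<close>

text \<open>
  A graded \<open>R\<close>-module is the internal direct sum of a \<open>\<int>\<close>-indexed independent family of submodules
  \<open>gr V k\<close> of an ambient \<open>R\<close>-module, which need not be exhausted by them. As all
  elements are taken to be homogeneous, a homogeneous element is written as a pair \<open>(k, v)\<close> with
  \<open>v \<in> gr V k\<close>; the tag records the (unshifted) degree, also when \<open>v = 0\<close>. The same pair stands for
  the shifted element, whose degree is then \<open>sdeg (k, v) = k - 1\<close>.
\<close>

record ('r, 'v) graded_module =
  smul :: "'r \<Rightarrow> 'v \<Rightarrow> 'v"
  gr :: "int \<Rightarrow> 'v set"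

definition is_graded_module ::
  "('r::comm_ring_1, 'v::ab_group_add, 'z) graded_module_scheme \<Rightarrow> bool" where
  "is_graded_module V \<longleftrightarrow>
     module (smul V) \<and>
     (\<forall>k. module.subspace (smul V) (gr V k)) \<and>
     (\<forall>S v. finite S \<longrightarrow> (\<forall>k\<in>S. v k \<in> gr V k) \<longrightarrow> (\<Sum>k\<in>S. v k) = 0 \<longrightarrow> (\<forall>k\<in>S. v k = 0))"

type_synonym 'v elem = "int \<times> 'v"

definition homog :: "('r, 'v, 'z) graded_module_scheme \<Rightarrow> 'v elem set" where
  "homog V = {(k, v). v \<in> gr V k}"

definition sdeg :: "'v elem \<Rightarrow> int" where
  "sdeg x = fst x - 1"

definition sdegs :: "'v elem list \<Rightarrow> int" where
  "sdegs xs = (\<Sum>x\<leftarrow>xs. sdeg x)"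

text \<open>\<open>ksign e v\<close> is \<open>(-1)^e v\<close>.\<close>

definition ksign :: "int \<Rightarrow> 'v::ab_group_add \<Rightarrow> 'v" where
  "ksign e v = (if even e then v else - v)"


section \<open>Families of multilinear maps\<close>

text \<open>
  A family of maps \<open>f\<^sub>k : A\<^sup>\<otimes>\<^sup>k \<rightarrow> B\<close> is one function on lists of homogeneous elements, \<open>f\<^sub>k\<close> being its
  restriction to lists of length \<open>k\<close>. Likewise \<open>F as m bs\<close> is \<open>F\<^sub>k\<^sub>,\<^sub>l\<close> with
  \<open>k = length as\<close>, \<open>l = length bs\<close>. Values on lists with non-homogeneous entries are
  irrelevant, and so is the value of an algebra family on the empty list.
\<close>

type_synonym ('a, 'b) alg_maps = "'a elem list \<Rightarrow> 'b"
type_synonym ('a, 'm, 'n) mod_maps = "'a elem list \<Rightarrow> 'm elem \<Rightarrow> 'a elem list \<Rightarrow> 'n"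

definition linear_on_degree ::
  "('r, 'v::ab_group_add, 'z) graded_module_scheme \<Rightarrow> ('r \<Rightarrow> 'w \<Rightarrow> 'w) \<Rightarrow> int
     \<Rightarrow> ('v \<Rightarrow> 'w::ab_group_add) \<Rightarrow> bool" where
  "linear_on_degree V s d h \<longleftrightarrow>
     (\<forall>x\<in>gr V d. \<forall>y\<in>gr V d. h (x + y) = h x + h y) \<and>
     (\<forall>r. \<forall>x\<in>gr V d. h (smul V r x) = s r (h x))"

text \<open>\<open>alg_family A B e f\<close>: the map \<open>f\<^sub>k\<close> is multilinear of degree \<open>e - k\<close>, for all \<open>k \<ge> 1\<close>.\<close>

definition alg_family ::
  "('r, 'a::ab_group_add, 'z) graded_module_scheme \<Rightarrow>
   ('r, 'b::ab_group_add, 'y) graded_module_scheme \<Rightarrow> int \<Rightarrow> ('a, 'b) alg_maps \<Rightarrow> bool" where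
  "alg_family A B e f \<longleftrightarrow>
     (\<forall>xs\<in>lists (homog A). xs \<noteq> [] \<longrightarrow>
        f xs \<in> gr B ((\<Sum>x\<leftarrow>xs. fst x) + e - int (length xs))) \<and>
     (\<forall>xs\<in>lists (homog A). \<forall>ys\<in>lists (homog A). \<forall>d.
        linear_on_degree A (smul B) d (\<lambda>v. f (xs @ (d, v) # ys)))"

text \<open>\<open>mod_family A M N e F\<close>: the map \<open>F\<^sub>k\<^sub>,\<^sub>l\<close> is multilinear of degree \<open>e - k - l\<close>, for all \<open>k, l\<close>;
  that is, \<open>|F| = e\<close>.\<close>

definition mod_family ::
  "('r, 'a::ab_group_add, 'z) graded_module_scheme \<Rightarrow>
   ('r, 'm::ab_group_add, 'y) graded_module_scheme \<Rightarrow>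
   ('r, 'n::ab_group_add, 'x) graded_module_scheme \<Rightarrow> int \<Rightarrow> ('a, 'm, 'n) mod_maps \<Rightarrow> bool" where
  "mod_family A M N e F \<longleftrightarrow>
     (\<forall>as\<in>lists (homog A). \<forall>m\<in>homog M. \<forall>bs\<in>lists (homog A).
        F as m bs \<in> gr N ((\<Sum>x\<leftarrow>as. fst x) + fst m + (\<Sum>x\<leftarrow>bs. fst x)
                           + e - int (length as) - int (length bs))) \<and>
     (\<forall>as\<in>lists (homog A). \<forall>bs\<in>lists (homog A). \<forall>d.
        linear_on_degree M (smul N) d (\<lambda>v. F as (d, v) bs)) \<and>
     (\<forall>as\<in>lists (homog A). \<forall>cs\<in>lists (homog A). \<forall>m\<in>homog M. \<forall>bs\<in>lists (homog A). \<forall>d.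
        linear_on_degree A (smul N) d (\<lambda>v. F (as @ (d, v) # cs) m bs) \<and>
        linear_on_degree A (smul N) d (\<lambda>v. F bs m (as @ (d, v) # cs)))"

text \<open>
  Shifted maps \<open>s \<circ> f \<circ> (s\<^sup>-\<^sup>1)\<^sup>\<otimes>\<^sup>n\<close>. The operator \<open>s\<^sup>-\<^sup>1\<close> has degree \<open>1\<close>, and the \<open>i\<close>-th argument is
  passed by the \<open>n - i\<close> copies of it that act on later arguments. Since only a sign is
  involved, \<open>sh_alg\<close> and \<open>sh_mod\<close> are their own inverses, so they also recover a family from its
  shifted version.
\<close>

definition desusp :: "int list \<Rightarrow> int" where
  "desusp ds = (\<Sum>i<length ds. (int (length ds) - 1 - int i) * ds ! i)"

definition sh_alg :: "('a, 'b::ab_group_add) alg_maps \<Rightarrow> ('a, 'b) alg_maps" where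
  "sh_alg f xs = ksign (desusp (map sdeg xs)) (f xs)"

definition sh_mod :: "('a, 'm, 'n::ab_group_add) mod_maps \<Rightarrow> ('a, 'm, 'n) mod_maps" where
  "sh_mod F as m bs = ksign (desusp (map sdeg as @ sdeg m # map sdeg bs)) (F as m bs)"

text \<open>The same, with the value tagged by its degree; \<open>e\<close> is the degree of the shifted maps, and
  the summand \<open>1\<close> turns a shifted degree into an unshifted one.\<close>

definition el_alg :: "int \<Rightarrow> ('a, 'b::ab_group_add) alg_maps \<Rightarrow> 'a elem list \<Rightarrow> 'b elem" where
  "el_alg e f xs = (sdegs xs + e + 1, sh_alg f xs)"

definition el_mod :: "int \<Rightarrow> ('a, 'm, 'n::ab_group_add) mod_maps
    \<Rightarrow> 'a elem list \<Rightarrow> 'm elem \<Rightarrow> 'a elem list \<Rightarrow> 'n elem" where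
  "el_mod e F as m bs = (sdegs as + sdeg m + sdegs bs + e + 1, sh_mod F as m bs)"


section \<open>Cutting lists into consecutive nonempty blocks\<close>

definition cuts :: "'x list \<Rightarrow> 'x list list set" where
  "cuts xs = {xss. concat xss = xs \<and> [] \<notin> set xss}"

text \<open>Cuts with a distinguished block, namely the one containing \<open>z\<close>.\<close>

definition pcuts :: "'x \<Rightarrow> 'x list \<Rightarrow> ('x list list \<times> 'x list \<times> 'x list list) set" where
  "pcuts z xs = {(ls, c, rs). ls @ c # rs \<in> cuts xs \<and> z \<in> set c}"

lemma finite_cuts: "finite (cuts xs)"
proof -
  let ?B = "{ys. set ys \<subseteq> set xs \<and> length ys \<le> length xs}"
  have *: "length xss \<le> length (concat xss)" if "[] \<notin> set xss" for xss :: "'a list list"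
    using that
  proof (induction xss)
    case (Cons ys xss)
    then show ?case by (cases ys) auto
  qed simp
  have len: "length ys \<le> length (concat xss)" if "ys \<in> set xss" for ys and xss :: "'a list list"
    using that by (induction xss) auto
  have "cuts xs \<subseteq> {xss. set xss \<subseteq> ?B \<and> length xss \<le> length xs}"
    using * len unfolding cuts_def by fastforce
  moreover have "finite {xss. set xss \<subseteq> ?B \<and> length xss \<le> length xs}"
    by (intro finite_lists_length_le) simp
  ultimately show ?thesis by (rule finite_subset)
qed

lemma finite_pcuts: "finite (pcuts z xs)"
proof -
  let ?h = "\<lambda>(xss, n). (take n xss, xss ! n, drop (Suc n) xss)"
  have "pcuts z xs \<subseteq> ?h ` (SIGMA xss : cuts xs. {..<length xss})"
  proof
    fix t assume "t \<in> pcuts z xs"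
    then obtain ls c rs where t: "t = (ls, c, rs)" "ls @ c # rs \<in> cuts xs"
      unfolding pcuts_def by auto
    then show "t \<in> ?h ` (SIGMA xss : cuts xs. {..<length xss})"
      by (intro image_eqI[where x = "(ls @ c # rs, length ls)"]) auto
  qed
  then show ?thesis
    by (rule finite_subset) (intro finite_imageI finite_SigmaI finite_cuts, simp)
qed


section \<open>\<open>A\<^sub>\<infinity>\<close> algebras and their morphisms\<close>

record ('r, 'a) ainf_algebra = "('r, 'a) graded_module" +
  mu :: "('a, 'a) alg_maps"

text \<open>\<open>\<Sum> \<phi>\<^sub>k (id\<^sup>\<otimes>\<^sup>i \<otimes> \<mu>\<^sub>l \<otimes> id\<^sup>\<otimes>\<^sup>j)\<close> for shifted maps \<open>\<phi>\<^sub>k\<close>.\<close>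

definition insert_mu ::
  "('r, 'a::ab_group_add, 'z) ainf_algebra_scheme \<Rightarrow> ('a elem list \<Rightarrow> 'v::ab_group_add)
     \<Rightarrow> 'a elem list \<Rightarrow> 'v" where
  "insert_mu A \<phi> xs =
     (\<Sum>i<length xs. \<Sum>l\<in>{1..length xs - i}.
        ksign (sdegs (take i xs))
          (\<phi> (take i xs @ el_alg 1 (mu A) (take l (drop i xs)) # drop (i + l) xs)))"

definition is_ainf_algebra ::
  "('r::comm_ring_1, 'a::ab_group_add, 'z) ainf_algebra_scheme \<Rightarrow> bool" where
  "is_ainf_algebra A \<longleftrightarrow>
     is_graded_module A \<and> (\<forall>k<0. gr A k = {0}) \<and> alg_family A A 2 (mu A) \<and>
     (\<forall>xs\<in>lists (homog A). xs \<noteq> [] \<longrightarrow> insert_mu A (sh_alg (mu A)) xs = 0)"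

definition is_alg_morphism ::
  "('r, 'a::ab_group_add, 'z) ainf_algebra_scheme \<Rightarrow> ('r, 'b::ab_group_add, 'y) ainf_algebra_scheme
     \<Rightarrow> ('a, 'b) alg_maps \<Rightarrow> bool" where
  "is_alg_morphism A B f \<longleftrightarrow>
     alg_family A B 1 f \<and>
     (\<forall>xs\<in>lists (homog A). xs \<noteq> [] \<longrightarrow>
        insert_mu A (sh_alg f) xs = (\<Sum>xss\<in>cuts xs. sh_alg (mu B) (map (el_alg 0 f) xss)))"

definition id_alg :: "('a, 'a::zero) alg_maps" where
  "id_alg xs = (case xs of [x] \<Rightarrow> snd x | _ \<Rightarrow> 0)"


section \<open>\<open>A\<^sub>\<infinity>\<close> modules and their morphisms\<close>

record ('r, 'a, 'm) ainf_module = "('r, 'm) graded_module" +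
  beta :: "('a, 'm, 'm) mod_maps"

text \<open>The shifted family of \<open>F \<circ> \<beta>\<close>.\<close>

definition comp_beta ::
  "('r, 'a::ab_group_add, 'z) ainf_algebra_scheme \<Rightarrow> ('r, 'a, 'm::ab_group_add, 'y) ainf_module_scheme
     \<Rightarrow> ('a, 'm, 'n::ab_group_add) mod_maps \<Rightarrow> ('a, 'm, 'n) mod_maps" where
  "comp_beta A M F as m bs =
     insert_mu A (\<lambda>as'. sh_mod F as' m bs) as
   + (\<Sum>i\<le>length as. \<Sum>q\<le>length bs.
        ksign (sdegs (take i as))
          (sh_mod F (take i as) (el_mod 1 (beta M) (drop i as) m (take q bs)) (drop q bs)))
   + ksign (sdegs as + sdeg m) (insert_mu A (\<lambda>bs'. sh_mod F as m bs') bs)"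

definition is_ainf_module ::
  "('r::comm_ring_1, 'a::ab_group_add, 'z) ainf_algebra_scheme
     \<Rightarrow> ('r, 'a, 'm::ab_group_add, 'y) ainf_module_scheme \<Rightarrow> bool" where
  "is_ainf_module A M \<longleftrightarrow>
     is_graded_module M \<and> mod_family A M M 1 (beta M) \<and>
     (\<forall>as\<in>lists (homog A). \<forall>m\<in>homog M. \<forall>bs\<in>lists (homog A).
        comp_beta A M (beta M) as m bs = 0)"

text \<open>
  \<open>\<Sum> \<Gamma>\<^sub>i\<^sub>,\<^sub>j (f \<otimes> \<dots> \<otimes> f \<otimes> F\<^sub>k\<^sub>,\<^sub>l \<otimes> f \<otimes> \<dots> \<otimes> f)\<close> for shifted maps, with \<open>|F| = e\<close>. The shifted \<open>f\<^sub>k\<close> have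
  degree \<open>0\<close>, so the only Koszul sign comes from moving \<open>F\<^sub>k\<^sub>,\<^sub>l\<close> past the arguments to its left.
\<close>

definition push ::
  "('a, 'b::ab_group_add) alg_maps \<Rightarrow> int \<Rightarrow> ('a, 'm, 'n::ab_group_add) mod_maps
     \<Rightarrow> ('b, 'n, 'p::ab_group_add) mod_maps \<Rightarrow> ('a, 'm, 'p) mod_maps" where
  "push f e F \<Gamma> as m bs =
     (\<Sum>i\<le>length as. \<Sum>q\<le>length bs. \<Sum>ass\<in>cuts (take i as). \<Sum>bss\<in>cuts (drop q bs).
        ksign (e * sdegs (take i as))
          (sh_mod \<Gamma> (map (el_alg 0 f) ass) (el_mod e F (drop i as) m (take q bs))
                    (map (el_alg 0 f) bss)))"

definition is_mod_morphism ::
  "('r, 'a::ab_group_add, 'z) ainf_algebra_scheme \<Rightarrow> ('r, 'a, 'm::ab_group_add, 'y) ainf_module_scheme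
     \<Rightarrow> ('r, 'b::ab_group_add, 'n::ab_group_add, 'x) ainf_module_scheme
     \<Rightarrow> ('a, 'b) alg_maps \<Rightarrow> int \<Rightarrow> ('a, 'm, 'n) mod_maps \<Rightarrow> bool" where
  "is_mod_morphism A M N f e F \<longleftrightarrow>
     mod_family A M N e F \<and>
     (\<forall>as\<in>lists (homog A). \<forall>m\<in>homog M. \<forall>bs\<in>lists (homog A).
        comp_beta A M F as m bs = ksign e (push f e F (beta N) as m bs))"

text \<open>\<open>\<delta>(F)\<close> for a family \<open>F\<close> of degree \<open>e\<close> of maps between \<open>A\<close>-modules \<open>M\<close> and \<open>N\<close>; the outer
  \<open>sh_mod\<close> undoes the shift.\<close>

definition delta ::
  "('r, 'a::ab_group_add, 'z) ainf_algebra_scheme \<Rightarrow> ('r, 'a, 'm::ab_group_add, 'y) ainf_module_scheme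
     \<Rightarrow> ('r, 'a, 'n::ab_group_add, 'x) ainf_module_scheme
     \<Rightarrow> int \<Rightarrow> ('a, 'm, 'n) mod_maps \<Rightarrow> ('a, 'm, 'n) mod_maps" where
  "delta A M N e F = sh_mod (\<lambda>as m bs.
     comp_beta A M F as m bs
     - ksign e (\<Sum>i\<le>length as. \<Sum>q\<le>length bs.
         ksign (e * sdegs (take i as))
           (sh_mod (beta N) (take i as) (el_mod e F (drop i as) m (take q bs)) (drop q bs))))"


section \<open>Dual modules and inner products\<close>

text \<open>
  The degree \<open>k\<close> part of \<open>Hom(M,R)\<close> is \<open>Hom(M\<^sub>-\<^sub>k, R)\<close>, its elements being extended by \<open>0\<close>
  outside \<open>M\<^sub>-\<^sub>k\<close>. Thus a functional may be evaluated at any homogeneous element, with value \<open>0\<close> in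
  the other degrees. In the formula for the structure maps, the argument \<open>t\<close> can only
  contribute when its degree is the negative \<open>- D\<close> of the degree of the resulting functional.
\<close>

definition sh_dual_beta ::
  "('r::comm_ring_1, 'a, 'm::ab_group_add, 'y) ainf_module_scheme \<Rightarrow> ('a, 'm \<Rightarrow> 'r, 'm \<Rightarrow> 'r) mod_maps" where
  "sh_dual_beta M as \<phi> bs = (\<lambda>t.
     let D = sdegs as + sdeg \<phi> + sdegs bs + 1 + 1;
         \<epsilon> = sdegs as * (sdeg \<phi> + sdegs bs + sdeg (- D, t)) + sdeg \<phi>
     in if t \<in> gr M (- D) then - ksign \<epsilon> (snd \<phi> (sh_mod (beta M) bs (- D, t) as)) else 0)"

definition dual ::
  "('r::comm_ring_1, 'a, 'm::ab_group_add, 'y) ainf_module_scheme \<Rightarrow> ('r, 'a, 'm \<Rightarrow> 'r) ainf_module" where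
  "dual M = \<lparr> smul = (\<lambda>r \<phi> t. r * \<phi> t),
              gr = (\<lambda>k. {\<phi>. linear_on_degree M (*) (- k) \<phi> \<and> (\<forall>t. t \<notin> gr M (- k) \<longrightarrow> \<phi> t = 0)}),
              beta = sh_mod (sh_dual_beta M) \<rparr>"

definition is_inner_product ::
  "('r::comm_ring_1, 'a::ab_group_add, 'z) ainf_algebra_scheme
     \<Rightarrow> ('r, 'a, 'm::ab_group_add, 'y) ainf_module_scheme
     \<Rightarrow> int \<Rightarrow> ('a, 'm, 'm \<Rightarrow> 'r) mod_maps \<Rightarrow> bool" where
  "is_inner_product A M e I \<longleftrightarrow> is_mod_morphism A M (dual M) id_alg e I"

definition is_exact_inner_product ::
  "('r::comm_ring_1, 'a::ab_group_add, 'z) ainf_algebra_scheme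
     \<Rightarrow> ('r, 'a, 'm::ab_group_add, 'y) ainf_module_scheme
     \<Rightarrow> ('a, 'm, 'm \<Rightarrow> 'r) mod_maps \<Rightarrow> bool" where
  "is_exact_inner_product A M I \<longleftrightarrow>
     (\<exists>e. is_inner_product A M e I \<and>
       (\<exists>G. mod_family A M (dual M) (e - 1) G \<and>
         (\<forall>as\<in>lists (homog A). \<forall>m\<in>homog M. \<forall>bs\<in>lists (homog A).
            I as m bs = delta A M (dual M) (e - 1) G as m bs)))"

text \<open>
  The pullback of an inner product \<open>J\<close> of degree \<open>e\<close> along a morphism \<open>F\<close> of degree \<open>0\<close> over \<open>f\<close>.
  As \<open>f\<close> and \<open>F\<close> have shifted degree \<open>0\<close>, the Koszul sign comes only from moving the first \<open>i = k - p\<close>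
  arguments to the end. As for the dual, \<open>- D\<close> is the only degree of \<open>t\<close> that contributes.
\<close>

definition pullback ::
  "('r::comm_ring_1, 'a::ab_group_add, 'm::ab_group_add, 'y) ainf_module_scheme
     \<Rightarrow> ('a, 'b::ab_group_add) alg_maps \<Rightarrow> ('a, 'm, 'n::ab_group_add) mod_maps
     \<Rightarrow> int \<Rightarrow> ('b, 'n, 'n \<Rightarrow> 'r) mod_maps \<Rightarrow> ('a, 'm, 'm \<Rightarrow> 'r) mod_maps" where
  "pullback M f F e J = sh_mod (\<lambda>as m bs t.
     let D = sdegs as + sdeg m + sdegs bs + e + 1; t' = (- D, t)
     in if t \<in> gr M (- D) then
          (\<Sum>i\<le>length as. \<Sum>q\<le>length bs.
             ksign (sdegs (take i as) * (sdegs (drop i as) + sdeg m + sdegs bs + sdeg t'))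
               (push f 0 F J (drop i as) m (take q bs)
                  (sh_mod F (drop q bs) t' (take i as))))
        else 0)"


section \<open>Cohomology, equivalence and formality\<close>

definition cocycles :: "('r, 'v::ab_group_add, 'z) graded_module_scheme
    \<Rightarrow> ('v elem \<Rightarrow> 'v) \<Rightarrow> int \<Rightarrow> 'v set" where
  "cocycles V D k = {v \<in> gr V k. D (k, v) = 0}"

definition cohomologous :: "('r, 'v::ab_group_add, 'z) graded_module_scheme
    \<Rightarrow> ('v elem \<Rightarrow> 'v) \<Rightarrow> int \<Rightarrow> ('v \<times> 'v) set" where
  "cohomologous V D k =
     {(v, w). v \<in> cocycles V D k \<and> w \<in> cocycles V D k \<and> (\<exists>u\<in>gr V (k - 1). v - w = D (k - 1, u))}"

definition cohomology :: "('r, 'v::ab_group_add, 'z) graded_module_scheme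
    \<Rightarrow> ('v elem \<Rightarrow> 'v) \<Rightarrow> int \<Rightarrow> 'v set set" where
  "cohomology V D k = cocycles V D k // cohomologous V D k"

text \<open>The map induced on degree \<open>k\<close> cohomology classes by a degree \<open>0\<close> map \<open>h\<close> into \<open>(W, D)\<close>.\<close>

definition induced :: "('r, 'w::ab_group_add, 'z) graded_module_scheme
    \<Rightarrow> ('w elem \<Rightarrow> 'w) \<Rightarrow> int \<Rightarrow> ('v elem \<Rightarrow> 'w) \<Rightarrow> 'v set \<Rightarrow> 'w set" where
  "induced W D k h X = cohomologous W D k `` ((\<lambda>v. h (k, v)) ` X)"

text \<open>\<open>h\<^sub>* = g\<^sub>*\<^sup>-\<^sup>1 : H(V) \<rightarrow> H(W)\<close>\<close>

definition inverse_on_cohomology ::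
  "('r, 'v::ab_group_add, 'z) graded_module_scheme \<Rightarrow> ('v elem \<Rightarrow> 'v)
     \<Rightarrow> ('r, 'w::ab_group_add, 'y) graded_module_scheme \<Rightarrow> ('w elem \<Rightarrow> 'w)
     \<Rightarrow> ('v elem \<Rightarrow> 'w) \<Rightarrow> ('w elem \<Rightarrow> 'v) \<Rightarrow> bool" where
  "inverse_on_cohomology V D W E h g \<longleftrightarrow>
     (\<forall>k. (\<forall>X\<in>cohomology V D k. induced V D k g (induced W E k h X) = X) \<and>
          (\<forall>Y\<in>cohomology W E k. induced W E k h (induced V D k g Y) = Y))"

definition d_alg :: "('r, 'a, 'z) ainf_algebra_scheme \<Rightarrow> 'a elem \<Rightarrow> 'a" where
  "d_alg A x = mu A [x]"

definition d_mod :: "('r, 'a, 'm, 'z) ainf_module_scheme \<Rightarrow> 'm elem \<Rightarrow> 'm" where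
  "d_mod M x = beta M [] x []"

text \<open>A triple \<open>(A, M, I)\<close> is given together with the degree \<open>e\<close> of \<open>I\<close>.\<close>

definition is_triple ::
  "('r::comm_ring_1, 'a::ab_group_add) ainf_algebra \<Rightarrow> ('r, 'a, 'm::ab_group_add) ainf_module
     \<Rightarrow> int \<Rightarrow> ('a, 'm, 'm \<Rightarrow> 'r) mod_maps \<Rightarrow> bool" where
  "is_triple A M e I \<longleftrightarrow> is_ainf_algebra A \<and> is_ainf_module A M \<and> is_inner_product A M e I"

definition is_triple_morphism ::
  "('r::comm_ring_1, 'a::ab_group_add) ainf_algebra \<Rightarrow> ('r, 'a, 'm::ab_group_add) ainf_module
     \<Rightarrow> ('a, 'm, 'm \<Rightarrow> 'r) mod_maps
     \<Rightarrow> ('r, 'b::ab_group_add) ainf_algebra \<Rightarrow> ('r, 'b, 'n::ab_group_add) ainf_module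
     \<Rightarrow> int \<Rightarrow> ('b, 'n, 'n \<Rightarrow> 'r) mod_maps
     \<Rightarrow> ('a, 'b) alg_maps \<Rightarrow> ('a, 'm, 'n) mod_maps \<Rightarrow> bool" where
  "is_triple_morphism A M I B N e J f F \<longleftrightarrow>
     is_alg_morphism A B f \<and> is_mod_morphism A M N f 0 F \<and>
     is_exact_inner_product A M (\<lambda>as m bs. pullback M f F e J as m bs - I as m bs)"

definition equivalent_triples ::
  "('r::comm_ring_1, 'a::ab_group_add) ainf_algebra \<Rightarrow> ('r, 'a, 'm::ab_group_add) ainf_module
     \<Rightarrow> int \<Rightarrow> ('a, 'm, 'm \<Rightarrow> 'r) mod_maps
     \<Rightarrow> ('r, 'b::ab_group_add) ainf_algebra \<Rightarrow> ('r, 'b, 'n::ab_group_add) ainf_module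
     \<Rightarrow> int \<Rightarrow> ('b, 'n, 'n \<Rightarrow> 'r) mod_maps \<Rightarrow> bool" where
  "equivalent_triples A M e I B N e' J \<longleftrightarrow>
     (\<exists>f F g G.
        is_triple_morphism A M I B N e' J f F \<and> is_triple_morphism B N J A M e I g G \<and>
        inverse_on_cohomology A (d_alg A) B (d_alg B) (\<lambda>x. f [x]) (\<lambda>x. g [x]) \<and>
        inverse_on_cohomology M (d_mod M) N (d_mod N) (\<lambda>x. F [] x []) (\<lambda>x. G [] x []))"

definition has_only_binary_structure ::
  "('r::comm_ring_1, 'a::ab_group_add) ainf_algebra \<Rightarrow> ('r, 'a, 'm::ab_group_add) ainf_module
     \<Rightarrow> ('a, 'm, 'm \<Rightarrow> 'r) mod_maps \<Rightarrow> bool" where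
  "has_only_binary_structure A M I \<longleftrightarrow>
     (\<forall>xs\<in>lists (homog A). xs \<noteq> [] \<longrightarrow> length xs \<noteq> 2 \<longrightarrow> mu A xs = 0) \<and>
     (\<forall>as\<in>lists (homog A). \<forall>m\<in>homog M. \<forall>bs\<in>lists (homog A).
        (length as + length bs \<noteq> 1 \<longrightarrow> beta M as m bs = 0) \<and>
        (length as + length bs \<noteq> 0 \<longrightarrow> I as m bs = 0))"

text \<open>
  HOL cannot quantify over types inside a formula, so the types carrying the witnessing triple are
  parameters. A theorem that assumes \<open>formal\<close> for arbitrary such types assumes
  formality with no restriction on where the witness lives.
\<close>

definition formal ::
  "'b::ab_group_add itself \<Rightarrow> 'n::ab_group_add itself
     \<Rightarrow> ('r::comm_ring_1, 'a::ab_group_add) ainf_algebra \<Rightarrow> ('r, 'a, 'm::ab_group_add) ainf_module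
     \<Rightarrow> int \<Rightarrow> ('a, 'm, 'm \<Rightarrow> 'r) mod_maps \<Rightarrow> bool" where
  "formal _ _ A M e I \<longleftrightarrow>
     (\<exists>(B :: ('r, 'b) ainf_algebra) (N :: ('r, 'b, 'n) ainf_module) e' J.
        is_triple B N e' J \<and> has_only_binary_structure B N J \<and> equivalent_triples A M e I B N e' J)"


section \<open>Cyclic defining systems and Massey inner products\<close>

text \<open>
  \<open>x\<^sub>1, \<dots>, x\<^sub>n\<close> with \<open>n = k + l + 2\<close> are given as \<open>as = [x\<^sub>1, \<dots>, x\<^sub>k]\<close>, \<open>m = x\<^sub>k\<^sub>+\<^sub>1\<close>,
  \<open>bs = [x\<^sub>k\<^sub>+\<^sub>2, \<dots>, x\<^sub>k\<^sub>+\<^sub>l\<^sub>+\<^sub>1]\<close>, \<open>m' = x\<^sub>n\<close>; \<open>xsdegs\<close> is the list of their shifted degrees and \<open>ssum\<close>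
  sums those over a list of (one-based) indices.
\<close>

definition xsdegs :: "'a elem list \<Rightarrow> 'm elem \<Rightarrow> 'a elem list \<Rightarrow> 'm elem \<Rightarrow> int list" where
  "xsdegs as m bs m' = map sdeg as @ sdeg m # map sdeg bs @ [sdeg m']"

definition ssum :: "int list \<Rightarrow> nat list \<Rightarrow> int" where
  "ssum ds c = (\<Sum>i\<leftarrow>c. ds ! (i - 1))"

text \<open>The interval from \<open>i\<close> to \<open>j\<close> in the order \<open>1 < \<dots> < n\<close> if \<open>i \<le> j\<close>, and otherwise in the order
  that continues from \<open>n\<close> with \<open>1\<close>. This covers both orders that occur.\<close>

definition seg :: "nat \<Rightarrow> nat \<Rightarrow> nat \<Rightarrow> nat list" where
  "seg n i j = (if i \<le> j then [i..<Suc j] else [i..<Suc n] @ [1..<Suc j])"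

definition pairs :: "nat \<Rightarrow> nat \<Rightarrow> (nat \<times> nat) set" where
  "pairs k l = {(i, j). 1 \<le> i \<and> i \<le> j \<and> j \<le> k + l + 1}"

text \<open>The pairs \<open>i \<preceq> j\<close> in the order \<open>k + 2 \<prec> \<dots> \<prec> n \<prec> 1 \<prec> \<dots> \<prec> k\<close>.\<close>

definition pairs' :: "nat \<Rightarrow> nat \<Rightarrow> (nat \<times> nat) set" where
  "pairs' k l = {(i, j). (k + 2 \<le> i \<and> i \<le> j \<and> j \<le> k + l + 2)
                      \<or> (1 \<le> i \<and> i \<le> j \<and> j \<le> k)
                      \<or> (k + 2 \<le> i \<and> i \<le> k + l + 2 \<and> 1 \<le> j \<and> j \<le> k)}"

text \<open>The entry belonging to a block \<open>c\<close> of consecutive indices.\<close>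

definition entry :: "int list \<Rightarrow> (nat \<Rightarrow> nat \<Rightarrow> 'v) \<Rightarrow> nat list \<Rightarrow> 'v elem" where
  "entry ds x c = (ssum ds c + 1, x (hd c) (last c))"

text \<open>
  A triangular family is split into its entries in \<open>A\<close> and its entries in \<open>M\<close>. The shifted staircase
  products over the interval \<open>c\<close> are \<open>stair_alg\<close> if \<open>c\<close> avoids the index \<open>z\<close> of the module
  element (\<open>z = k + 1\<close> for the first family, \<open>z = n\<close> for the second) and \<open>stair_mod\<close> otherwise.
\<close>

definition stair_alg :: "('r, 'a::ab_group_add, 'z) ainf_algebra_scheme \<Rightarrow> int list
    \<Rightarrow> (nat \<Rightarrow> nat \<Rightarrow> 'a) \<Rightarrow> nat list \<Rightarrow> 'a" where
  "stair_alg A ds xa c =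
     (\<Sum>cs\<in>{cs\<in>cuts c. length cs \<ge> 2}. sh_alg (mu A) (map (entry ds xa) cs))"

definition stair_mod :: "('r, 'a, 'm::ab_group_add, 'y) ainf_module_scheme \<Rightarrow> int list \<Rightarrow> nat
    \<Rightarrow> (nat \<Rightarrow> nat \<Rightarrow> 'a) \<Rightarrow> (nat \<Rightarrow> nat \<Rightarrow> 'm) \<Rightarrow> nat list \<Rightarrow> 'm" where
  "stair_mod M ds z xa xm c =
     (\<Sum>(ls, b, rs)\<in>{(ls, b, rs)\<in>pcuts z c. length ls + 1 + length rs \<ge> 2}.
        sh_mod (beta M) (map (entry ds xa) ls) (entry ds xm b) (map (entry ds xa) rs))"

text \<open>The conditions on one triangular family, with index set \<open>P\<close>: the entries lie in the right
  graded piece and \<open>d(x\<^sub>i\<^sub>,\<^sub>j) = - S\<^sup>i\<^sup>,\<^sup>j\<close>.\<close>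

definition defining_family ::
  "('r, 'a::ab_group_add) ainf_algebra \<Rightarrow> ('r, 'a, 'm::ab_group_add) ainf_module \<Rightarrow> int list
     \<Rightarrow> nat \<Rightarrow> (nat \<times> nat) set \<Rightarrow> (nat \<Rightarrow> nat \<Rightarrow> 'a) \<Rightarrow> (nat \<Rightarrow> nat \<Rightarrow> 'm) \<Rightarrow> bool" where
  "defining_family A M ds z P xa xm \<longleftrightarrow>
     (\<forall>(i, j)\<in>P. let c = seg (length ds) i j in
        if z \<in> set c
        then entry ds xm c \<in> homog M \<and> d_mod M (entry ds xm c) = - stair_mod M ds z xa xm c
        else entry ds xa c \<in> homog A \<and> d_alg A (entry ds xa c) = - stair_alg A ds xa c)"

definition cyclic_defining_system ::
  "('r, 'a::ab_group_add) ainf_algebra \<Rightarrow> ('r, 'a, 'm::ab_group_add) ainf_module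
     \<Rightarrow> 'a elem list \<Rightarrow> 'm elem \<Rightarrow> 'a elem list \<Rightarrow> 'm elem
     \<Rightarrow> (nat \<Rightarrow> nat \<Rightarrow> 'a) \<Rightarrow> (nat \<Rightarrow> nat \<Rightarrow> 'm) \<Rightarrow> (nat \<Rightarrow> nat \<Rightarrow> 'a) \<Rightarrow> (nat \<Rightarrow> nat \<Rightarrow> 'm) \<Rightarrow> bool" where
  "cyclic_defining_system A M as m bs m' xa xm xa' xm' \<longleftrightarrow>
     (let k = length as; l = length bs; n = k + l + 2; ds = xsdegs as m bs m' in
        (\<forall>i\<in>{1..k}. xa i i = snd (as ! (i - 1)) \<and> xa' i i = snd (as ! (i - 1))) \<and>
        (\<forall>i\<in>{k + 2..k + l + 1}. xa i i = snd (bs ! (i - k - 2)) \<and> xa' i i = snd (bs ! (i - k - 2))) \<and>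
        xm (k + 1) (k + 1) = snd m \<and> xm' n n = snd m' \<and>
        (\<forall>i j. 1 \<le> i \<and> i \<le> j \<and> j \<le> k \<or> k + 2 \<le> i \<and> i \<le> j \<and> j \<le> k + l + 1 \<longrightarrow> xa i j = xa' i j) \<and>
        defining_family A M ds (k + 1) (pairs k l) xa xm \<and>
        defining_family A M ds n (pairs' k l) xa' xm')"

definition staircase_inner_product ::
  "('a, 'm, 'm \<Rightarrow> 'r::comm_ring_1) mod_maps
     \<Rightarrow> 'a elem list \<Rightarrow> 'm elem \<Rightarrow> 'a elem list \<Rightarrow> 'm elem
     \<Rightarrow> (nat \<Rightarrow> nat \<Rightarrow> 'a) \<Rightarrow> (nat \<Rightarrow> nat \<Rightarrow> 'm) \<Rightarrow> (nat \<Rightarrow> nat \<Rightarrow> 'm) \<Rightarrow> 'r" where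
  "staircase_inner_product I as m bs m' xa xm xm' =
     (let k = length as; l = length bs; n = k + l + 2; ds = xsdegs as m bs m' in
        \<Sum>p\<in>{1..k + 1}. \<Sum>q\<in>{k + 1..k + l + 1}. \<Sum>(ls, c, rs)\<in>pcuts (k + 1) (seg n p q).
          ksign (ssum ds [1..<p] * ssum ds [p..<Suc n])
            (sh_mod I (map (entry ds xa) ls) (entry ds xm c) (map (entry ds xa) rs)
               (xm' (q + 1) (if p = 1 then n else p - 1))))"

definition massey_inner_product ::
  "('r::comm_ring_1, 'a::ab_group_add) ainf_algebra \<Rightarrow> ('r, 'a, 'm::ab_group_add) ainf_module
     \<Rightarrow> ('a, 'm, 'm \<Rightarrow> 'r) mod_maps
     \<Rightarrow> 'a elem list \<Rightarrow> 'm elem \<Rightarrow> 'a elem list \<Rightarrow> 'm elem \<Rightarrow> 'r set" where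
  "massey_inner_product A M I as m bs m' =
     {staircase_inner_product I as m bs m' xa xm xm' | xa xm xa' xm'.
        cyclic_defining_system A M as m bs m' xa xm xa' xm'}"

end

theory Submission
  imports Defs "HOL-Library.Product_Plus"
begin

text \<open>
  An algebra and a module are combined into their direct sum, in which products with two module
  factors vanish. A cyclic defining system then becomes a family of elements, indexed by
  intervals, that solves a Maurer-Cartan equation, and the staircase inner product becomes a sum over
  cyclic cuts.

  In a model in which only the binary operations are nonzero, the images of the \<open>x\<^sub>i\<close> have vanishing
  consecutive products. The morphism back, applied to these images, hence gives a defining system for
  the elements \<open>g\<^sub>1 f\<^sub>1 x\<^sub>i\<close>, whose staircase inner product is the pulled back inner product at the
  images. This equals \<open>J\<close> plus an exact term; \<open>J\<close> vanishes in length at least three, and the exact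
  term because it only involves products of neighbours.

  It remains to replace \<open>g\<^sub>1 f\<^sub>1 x\<^sub>i\<close> by the cohomologous \<open>x\<^sub>i\<close>, one position at a time. If the
  difference is \<open>d h\<close>, the gauge transformation that inserts \<open>h\<close> at position \<open>i\<close> preserves the
  Maurer-Cartan equation, and the staircase inner product by the closedness of \<open>I\<close>.
\<close>

section \<open>Cutting and splitting lists\<close>

text \<open>Nothing is claimed about the value of the given defining system; it is only used to
  learn that the \<open>x_i\<close> are cocycles and that products of neighbours are exact, through
  its entries over intervals of length one and two. The model then supplies a whole new system. The
  obstacle is that this new system starts from elements that are merely cohomologous to the
  \<open>x_i\<close>. Correcting several positions in one step would create terms with several
  inserted elements; at a single position the linear term is already the full transformation, so no
  exponential series is needed over the arbitrary ring. The invariance argument is cyclic: an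
  interval around \<open>z\<close> and its complement through \<open>n\<close> feed the two
  arguments of \<open>I\<close>, and closedness moves an operation from one argument to the other.
  Letters record the number of module entries beside the degree. The full cycle has two such
  entries, at \<open>z\<close> and \<open>n\<close>, but no admissible interval contains both. Hence
  one Maurer-Cartan equation covers both triangular families. If the shifted degrees do not add up
  to \<open>- e - 2\<close>, the pairing vanishes for degree reasons and is treated apart.\<close>

definition split2 :: "'x list \<Rightarrow> ('x list \<times> 'x list) set" where
  "split2 xs = {(u, v). u @ v = xs}"

text \<open>The middle part receives an operation, and operations take at least one argument; the
  outer parts may be empty.\<close>

definition split3 :: "'x list \<Rightarrow> ('x list \<times> 'x list \<times> 'x list) set" where
  "split3 xs = {(u, v, w). u @ v @ w = xs \<and> v \<noteq> []}"

lemma split2_altdef: "split2 xs = (\<lambda>i. (take i xs, drop i xs)) ` {..length xs}"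
proof -
  have "(u, v) \<in> (\<lambda>i. (take i (u @ v), drop i (u @ v))) ` {..length (u @ v)}" for u v :: "'a list"
    by (rule image_eqI[of _ _ "length u"]) auto
  then show ?thesis by (auto simp: split2_def)
qed

lemma finite_split2 [simp, intro]: "finite (split2 xs)"
  by (simp add: split2_altdef)

lemma finite_split3 [simp, intro]: "finite (split3 xs)"
proof -
  have "split3 xs \<subseteq> (\<Union>(u, v)\<in>split2 xs. {u} \<times> split2 v)"
    by (auto simp: split2_def split3_def)
  then show ?thesis by (rule finite_subset) auto
qed

declare finite_cuts [simp, intro]

lemma split2_Nil [simp]: "split2 [] = {([], [])}"
  by (auto simp: split2_def)

lemma split3_Nil [simp]: "split3 [] = {}"
  by (auto simp: split3_def)

lemma blocks_eq_NilD: "\<forall>xs\<in>set xss. xs = [] \<Longrightarrow> [] \<notin> set xss \<Longrightarrow> xss = []"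
  by (cases xss) auto

lemma cuts_Nil [simp]: "cuts [] = {[]}"
  by (auto simp: cuts_def dest: blocks_eq_NilD)

lemma cuts_nonempty: "cs \<in> cuts c \<Longrightarrow> cs = [] \<longleftrightarrow> c = []"
  by (cases cs) (auto simp: cuts_def)

lemma sum_split2_conv:
  "(\<Sum>(u, v)\<in>split2 xs. f u v) = (\<Sum>i\<le>length xs. f (take i xs) (drop i xs))"
proof -
  have "inj_on (\<lambda>i. (take i xs, drop i xs)) {..length xs}"
    by (intro inj_onI) (metis Pair_inject atMost_iff length_take min.absorb2)
  then show ?thesis by (simp add: split2_altdef sum.reindex)
qed

lemma sum_split3_conv:
  "(\<Sum>(u, v, w)\<in>split3 xs. f u v w)
    = (\<Sum>i<length xs. \<Sum>l\<in>{1..length xs - i}. f (take i xs) (take l (drop i xs)) (drop (i + l) xs))"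
proof -
  have split: "take i xs @ take l (drop i xs) @ drop (i + l) xs = xs" for i l
    by (metis append_take_drop_id add.commute drop_drop)
  show ?thesis
    unfolding sum.Sigma[OF finite_lessThan ballI[OF finite_atLeastAtMost]]
    by (rule sum.reindex_bij_witness[where
        j = "\<lambda>(u, v, w). (length u, length v)" and
        i = "\<lambda>(i, l). (take i xs, take l (drop i xs), drop (i + l) xs)"])
     (auto simp: split3_def Suc_le_eq split)
qed

text \<open>Both sides run over all splittings into three possibly empty parts: deconcatenation is
  coassociative.\<close>

lemma sum_split2_assoc:
  "(\<Sum>(u, v)\<in>split2 xs. \<Sum>(a, b)\<in>split2 u. f a b v)
    = (\<Sum>(a, w)\<in>split2 xs. \<Sum>(b, v)\<in>split2 w. f a b v)"
  unfolding case_prod_unfold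
  by (subst (1 2) sum.Sigma, simp_all,
      rule sum.reindex_bij_witness[where
        j = "\<lambda>((u, v), (a, b)). ((a, b @ v), (b, v))" and
        i = "\<lambda>((a, w), (b, v)). ((a @ b, v), (a, b))"])
     (auto simp: split2_def)

lemma sum_split3_left:
  "(\<Sum>(u, v)\<in>split2 xs. \<Sum>(a, b, d)\<in>split3 u. f a b d v)
    = (\<Sum>(a, b, w)\<in>split3 xs. \<Sum>(d, v)\<in>split2 w. f a b d v)"
  unfolding case_prod_unfold
  by (subst (1 2) sum.Sigma, simp_all,
      rule sum.reindex_bij_witness[where
        j = "\<lambda>((u, v), (a, b, d)). ((a, b, d @ v), (d, v))" and
        i = "\<lambda>((a, b, w), (d, v)). ((a @ b @ d, v), (a, b, d))"])
     (auto simp: split2_def split3_def)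

lemma sum_split3_right:
  "(\<Sum>(u, v)\<in>split2 xs. \<Sum>(a, b, d)\<in>split3 v. f u a b d)
    = (\<Sum>(w, b, d)\<in>split3 xs. \<Sum>(u, a)\<in>split2 w. f u a b d)"
  unfolding case_prod_unfold
  by (subst (1 2) sum.Sigma, simp_all,
      rule sum.reindex_bij_witness[where
        j = "\<lambda>((u, v), (a, b, d)). ((u @ a, b, d), (u, a))" and
        i = "\<lambda>((w, b, d), (u, a)). ((u, a @ b @ d), (a, b, d))"])
     (auto simp: split2_def split3_def)

lemma sum_split2_Cons: "(\<Sum>(u, v)\<in>split2 (x # c). f u v) = f [] (x # c) + (\<Sum>(u, v)\<in>split2 c. f (x # u) v)"
  by (simp add: sum_split2_conv sum.atMost_Suc_shift del: sum.atMost_Suc)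

lemma sum_split3_Cons:
  "(\<Sum>(u, v, w)\<in>split3 (x # c). f u v w)
    = (\<Sum>(a, b)\<in>split2 c. f [] (x # a) b) + (\<Sum>(u, v, w)\<in>split3 c. f (x # u) v w)"
  by (simp add: sum_split2_conv sum_split3_conv sum.lessThan_Suc_shift sum.atLeast1_atMost_eq sum.atMost_shift
      del: sum.lessThan_Suc)

lemma sum_split2_pivot:
  "(\<Sum>(u, v)\<in>split2 (p @ x # q). f u v)
    = (\<Sum>(a, b)\<in>split2 p. f a (b @ x # q)) + (\<Sum>(a, b)\<in>split2 q. f (p @ x # a) b)"
proof (induction p arbitrary: f)
  case (Cons y p)
  show ?case using Cons[of "\<lambda>u. f (y # u)"] by (simp add: sum_split2_Cons add.assoc)
qed (simp add: sum_split2_Cons)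

text \<open>The three sums record whether the middle part lies before \<open>x\<close>, contains it,
  or lies after it. The distinguished letter will be an inserted \<open>h\<close>, a module letter,
  or a position of the cycle.\<close>

lemma sum_split3_pivot:
  "(\<Sum>(u, v, w)\<in>split3 (p @ x # q). f u v w)
    = (\<Sum>(a, b, d)\<in>split3 p. f a b (d @ x # q))
    + (\<Sum>(a, b)\<in>split2 p. \<Sum>(c, d)\<in>split2 q. f a (b @ x # c) d)
    + (\<Sum>(a, b, d)\<in>split3 q. f (p @ x # a) b d)"
proof (induction p arbitrary: f)
  case (Cons y p)
  show ?case using Cons[of "\<lambda>u. f (y # u)"]
    by (simp add: sum_split3_Cons sum_split2_Cons sum_split2_pivot ac_simps)
qed (simp add: sum_split3_Cons)

text \<open>Dividing a sequence of blocks amounts to dividing the underlying word first and cutting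
  both halves independently. This is what makes evaluation over all cuts compatible with
  deconcatenation.\<close>

lemma sum_cuts_split2:
  "(\<Sum>cs\<in>cuts c. \<Sum>(u, v)\<in>split2 cs. f u v)
    = (\<Sum>(a, b)\<in>split2 c. \<Sum>u\<in>cuts a. \<Sum>v\<in>cuts b. f u v)"
proof -
  have "(\<Sum>(a, b)\<in>split2 c. \<Sum>u\<in>cuts a. \<Sum>v\<in>cuts b. f u v)
      = (\<Sum>p\<in>split2 c. \<Sum>q\<in>cuts (fst p) \<times> cuts (snd p). f (fst q) (snd q))"
    by (simp add: case_prod_unfold sum.cartesian_product)
  also have "\<dots> = (\<Sum>(p, q)\<in>(SIGMA p:split2 c. cuts (fst p) \<times> cuts (snd p)). f (fst q) (snd q))"
    by (rule sum.Sigma) auto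
  also have "\<dots> = (\<Sum>(cs, q)\<in>(SIGMA cs:cuts c. split2 cs). f (fst q) (snd q))"
    by (rule sum.reindex_bij_witness[where
        j = "\<lambda>((a, b), (u, v)). (u @ v, (u, v))" and
        i = "\<lambda>(cs, (u, v)). ((concat u, concat v), (u, v))"])
       (auto simp: split2_def cuts_def)
  also have "\<dots> = (\<Sum>cs\<in>cuts c. \<Sum>q\<in>split2 cs. f (fst q) (snd q))"
    by (rule sum.Sigma[symmetric]) auto
  finally show ?thesis by (simp add: case_prod_unfold)
qed

lemma sum_cuts_split3:
  "(\<Sum>cs\<in>cuts c. \<Sum>(u, v, w)\<in>split3 cs. f u v w)
    = (\<Sum>(a, b, d)\<in>split3 c. \<Sum>u\<in>cuts a. \<Sum>v\<in>cuts b. \<Sum>w\<in>cuts d. f u v w)"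
proof -
  let ?C = "\<lambda>p :: 'b list \<times> 'b list \<times> 'b list. cuts (fst p) \<times> cuts (fst (snd p)) \<times> cuts (snd (snd p))"
  have "(\<Sum>(a, b, d)\<in>split3 c. \<Sum>u\<in>cuts a. \<Sum>v\<in>cuts b. \<Sum>w\<in>cuts d. f u v w)
      = (\<Sum>p\<in>split3 c. \<Sum>q\<in>?C p. f (fst q) (fst (snd q)) (snd (snd q)))"
    by (simp add: case_prod_unfold sum.cartesian_product)
  also have "\<dots> = (\<Sum>(p, q)\<in>(SIGMA p:split3 c. ?C p). f (fst q) (fst (snd q)) (snd (snd q)))"
    by (rule sum.Sigma) auto
  also have "\<dots> = (\<Sum>(cs, q)\<in>(SIGMA cs:cuts c. split3 cs). f (fst q) (fst (snd q)) (snd (snd q)))"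
    by (rule sum.reindex_bij_witness[where
        j = "\<lambda>((a, b, d), (u, v, w)). (u @ v @ w, (u, v, w))" and
        i = "\<lambda>(cs, (u, v, w)). ((concat u, concat v, concat w), (u, v, w))"])
       (auto simp: split3_def cuts_def dest: blocks_eq_NilD)
  also have "\<dots> = (\<Sum>cs\<in>cuts c. \<Sum>q\<in>split3 cs. f (fst q) (fst (snd q)) (snd (snd q)))"
    by (rule sum.Sigma[symmetric]) auto
  finally show ?thesis by (simp add: case_prod_unfold)
qed

lemma sum_cuts_Cons:
  "(\<Sum>cs\<in>cuts (x # c). f cs) = (\<Sum>(a, b)\<in>split2 c. \<Sum>v\<in>cuts b. f ((x # a) # v))"
proof -
  have "(\<Sum>cs\<in>cuts (x # c). f cs)
      = (\<Sum>(p, v)\<in>(SIGMA p:split2 c. cuts (snd p)). f ((x # fst p) # v))"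
  proof (rule sum.reindex_bij_witness[where
        i = "\<lambda>(p, v). (x # fst p) # v" and j = "\<lambda>cs. ((tl (hd cs), concat (tl cs)), tl cs)"], goal_cases)
    case (1 cs)
    then obtain b v where "cs = (x # b) # v" by (cases cs; cases "hd cs") (auto simp: cuts_def)
    then show ?case by simp
  next
    case (2 cs)
    then obtain b v where "cs = (x # b) # v" by (cases cs; cases "hd cs") (auto simp: cuts_def)
    with 2 show ?case by (auto simp: cuts_def split2_def)
  next
    case (5 cs)
    then obtain b v where "cs = (x # b) # v" by (cases cs; cases "hd cs") (auto simp: cuts_def)
    then show ?case by simp
  qed (auto simp: cuts_def split2_def)
  also have "\<dots> = (\<Sum>p\<in>split2 c. \<Sum>v\<in>cuts (snd p). f ((x # fst p) # v))"
    by (rule sum.Sigma[symmetric]) auto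
  finally show ?thesis by (simp add: case_prod_unfold)
qed

text \<open>Exactly one block contains the displayed occurrence of \<open>x\<close>; it takes a
  suffix \<open>b\<close> of \<open>p\<close> and a prefix \<open>c\<close> of \<open>q\<close>, and
  the rest is cut freely.\<close>

lemma sum_cuts_pivot:
  "(\<Sum>cs\<in>cuts (p @ x # q). f cs)
    = (\<Sum>(a, b)\<in>split2 p. \<Sum>(c, d)\<in>split2 q. \<Sum>u\<in>cuts a. \<Sum>v\<in>cuts d. f (u @ (b @ x # c) # v))"
\<comment> \<open>Peeling off the first block leaves an arbitrary shorter suffix of
  \<open>p\<close>, not just its tail.\<close>
proof (induction p arbitrary: f rule: length_induct)
  case (1 p)
  show ?case
  proof (cases p)
    case (Cons y p')
    let ?g = "\<lambda>a a' b. \<Sum>(c, d)\<in>split2 q. \<Sum>u\<in>cuts a'. \<Sum>v\<in>cuts d. f ((y # a) # u @ (b @ x # c) # v)"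
    have "(\<Sum>(a, b)\<in>split2 p'. \<Sum>v\<in>cuts (b @ x # q). f ((y # a) # v))
        = (\<Sum>(a, b)\<in>split2 p'. \<Sum>(a', b')\<in>split2 b. ?g a a' b')"
    proof (intro sum.cong refl, clarify)
      fix a b assume "(a, b) \<in> split2 p'"
      then have "length b < length p" by (auto simp: Cons split2_def)
      with 1 show "(\<Sum>v\<in>cuts (b @ x # q). f ((y # a) # v)) = (\<Sum>(a', b')\<in>split2 b. ?g a a' b')"
        by blast
    qed
    also have "\<dots> = (\<Sum>(A, b)\<in>split2 p'. \<Sum>(a, a')\<in>split2 A. ?g a a' b)"
      by (rule sum_split2_assoc[symmetric])
    also have "\<dots> = (\<Sum>(A, b)\<in>split2 p'. \<Sum>(c, d)\<in>split2 q. \<Sum>u\<in>cuts (y # A). \<Sum>v\<in>cuts d. f (u @ (b @ x # c) # v))"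
      unfolding sum_cuts_Cons case_prod_unfold by (rule sum.cong[OF refl], subst sum.swap) simp
    finally show ?thesis
      by (simp add: Cons sum_cuts_Cons[of f] sum_split2_pivot sum_split2_Cons add.commute)
  qed (simp add: sum_cuts_Cons)
qed

lemma cuts_map: "cuts (map f c) = map (map f) ` cuts c"
proof (intro equalityI subsetI)
  fix cs assume cs: "cs \<in> cuts (map f c)"
  then have "concat cs = map f c" "[] \<notin> set cs" by (auto simp: cuts_def)
  then have "\<exists>ds\<in>cuts c. cs = map (map f) ds"
  proof (induction cs arbitrary: c)
    case Nil then show ?case by (auto simp: cuts_def)
  next
    case (Cons B cs)
    then obtain c1 c2 where c: "c = c1 @ c2" "B = map f c1" "concat cs = map f c2"
      by (auto simp: append_eq_map_conv)
    from Cons.IH[OF c(3)] Cons.prems obtain ds where "ds \<in> cuts c2" "cs = map (map f) ds" by auto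
    with c Cons.prems show ?case by (intro bexI[of _ "c1 # ds"]) (auto simp: cuts_def)
  qed
  then show "cs \<in> map (map f) ` cuts c" by blast
qed (auto simp: cuts_def map_concat)

text \<open>\<open>map (map g)\<close> is injective on \<open>cuts c\<close> even if
  \<open>g\<close> is not: the concatenation is fixed, so a cut is determined by the lengths of its
  blocks.\<close>

lemma sum_cuts_map: "(\<Sum>cs\<in>cuts (map g c). f cs) = (\<Sum>cs\<in>cuts c. f (map (map g) cs))"
proof -
  have "inj_on (map (map g)) (cuts c)"
  proof (rule inj_onI)
    fix u v assume *: "u \<in> cuts c" "v \<in> cuts c" "map (map g) u = map (map g) v"
    then have "map length u = map length v"
      by (metis (no_types, lifting) length_map list.map_comp list.map_cong0 comp_apply)
    then have "length u = length v" "\<forall>(x, y)\<in>set (zip u v). length x = length y"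
      by (auto simp: set_zip dest: map_eq_imp_length_eq) (metis nth_map)
    with * show "u = v" by (auto simp: cuts_def intro: concat_injective)
  qed
  then show ?thesis by (simp add: cuts_map sum.reindex)
qed

section \<open>Triangular families and gauge transformations\<close>

lemma ksign_ksign [simp]: "ksign d (ksign e v) = ksign (d + e) v"
  by (simp add: ksign_def)

lemma ksign_0 [simp]: "ksign e 0 = 0" and ksign_0_left [simp]: "ksign 0 v = v"
  by (simp_all add: ksign_def)

lemma ksign_add: "ksign e (v + w) = ksign e v + ksign e w"
  and ksign_minus: "ksign e (- v) = - ksign e v"
  by (simp_all add: ksign_def)

lemma ksign_sum: "ksign e (sum f S) = (\<Sum>x\<in>S. ksign e (f x))"
  by (simp add: ksign_def sum_negf)

lemma ksign_eq_0_iff [simp]: "ksign e v = 0 \<longleftrightarrow> v = 0"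
  by (simp add: ksign_def)

lemma ksign_cong: "even (d - e) \<Longrightarrow> ksign d v = ksign e v"
  by (simp add: ksign_def)

lemma ksign_cong_minus: "odd (d - e) \<Longrightarrow> ksign d v = - ksign e v"
  by (auto simp add: ksign_def)

lemma sum_split2_map: "(\<Sum>(u, v)\<in>split2 (map g c). f u v) = (\<Sum>(u, v)\<in>split2 c. f (map g u) (map g v))"
  by (simp add: sum_split2_conv take_map drop_map)

lemma sum_split3_map:
  "(\<Sum>(u, v, w)\<in>split3 (map g c). f u v w) = (\<Sum>(u, v, w)\<in>split3 c. f (map g u) (map g v) (map g w))"
  by (simp add: sum_split3_conv take_map drop_map)

text \<open>The tag of a letter consists of the number of its module entries and its shifted degree.\<close>

type_synonym tag = "nat \<times> int"
type_synonym 'v letter = "tag \<times> 'v"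

definition wt :: "'v letter list \<Rightarrow> tag" where
  "wt w = sum_list (map fst w)"

lemma wt_simps [simp]: "wt [] = 0" "wt (x # w) = fst x + wt w" "wt (u @ w) = wt u + wt w"
  by (simp_all add: wt_def)

text \<open>This is \<open>\<phi>\<close> composed with the coderivation of the tensor coalgebra
  induced by \<open>m\<close>. The new letter has tag \<open>wt v + (0, 1)\<close> because shifted
  operations have degree 1.\<close>

definition ins :: "('v letter list \<Rightarrow> 'v) \<Rightarrow> ('v letter list \<Rightarrow> 'w) \<Rightarrow> 'v letter list \<Rightarrow> 'w::ab_group_add" where
  "ins m \<phi> w = (\<Sum>(u, v, x)\<in>split3 w. ksign (snd (wt u)) (\<phi> (u @ (wt v + (0, 1), m v) # x)))"

text \<open>The component at \<open>c\<close> of \<open>\<phi>\<close> applied to the sum of all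
  words in the entries of a triangular family. For \<open>\<phi> = m\<close> its vanishing is the
  Maurer-Cartan equation at \<open>c\<close>.\<close>

definition ev :: "('p list \<Rightarrow> 'v letter) \<Rightarrow> 'p list \<Rightarrow> ('v letter list \<Rightarrow> 'w::ab_group_add) \<Rightarrow> 'w" where
  "ev L c \<phi> = (\<Sum>cs\<in>cuts c. \<phi> (map L cs))"

lemma ev_cong: "c = c' \<Longrightarrow> (\<And>cs. cs \<in> cuts c' \<Longrightarrow> \<phi> (map L cs) = \<psi> (map L cs)) \<Longrightarrow> ev L c \<phi> = ev L c' \<psi>"
  by (simp add: ev_def)

lemma ev_cong_letters:
  "(\<And>b. b \<noteq> [] \<Longrightarrow> set b \<subseteq> set c \<Longrightarrow> L b = L' b) \<Longrightarrow> ev L c \<phi> = ev L' c \<phi>"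
  unfolding ev_def
proof (intro sum.cong refl arg_cong[of _ _ \<phi>] map_cong)
  fix cs b assume L: "\<And>b. b \<noteq> [] \<Longrightarrow> set b \<subseteq> set c \<Longrightarrow> L b = L' b" and b: "cs \<in> cuts c" "b \<in> set cs"
  from b have "b \<noteq> []" "set b \<subseteq> set c" by (auto simp: cuts_def)
  then show "L b = L' b" by (rule L)
qed

lemma ev_Nil [simp]: "ev L [] \<phi> = \<phi> []"
  by (simp add: ev_def)

lemma ev_0 [simp]: "ev L c (\<lambda>_. 0) = 0"
  by (simp add: ev_def)

lemma ev_add: "ev L c (\<lambda>w. \<phi> w + \<psi> w) = ev L c \<phi> + ev L c \<psi>"
  by (simp add: ev_def sum.distrib)

lemma ev_ksign: "ev L c (\<lambda>w. ksign e (\<phi> w)) = ksign e (ev L c \<phi>)"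
  by (simp add: ev_def ksign_sum)

lemma ev_sum: "ev L c (\<lambda>w. \<Sum>x\<in>S. \<phi> x w) = (\<Sum>x\<in>S. ev L c (\<phi> x))"
  by (simp add: ev_def sum.swap[of _ S])

lemma ev_swap: "ev L c (\<lambda>u. ev L' c' (\<lambda>v. \<phi> u v)) = ev L' c' (\<lambda>v. ev L c (\<lambda>u. \<phi> u v))"
  by (simp add: ev_def sum.swap[of _ "cuts c'"])

lemma ev_split2:
  "ev L c (\<lambda>w. \<Sum>(u, v)\<in>split2 w. \<phi> u v) = (\<Sum>(a, b)\<in>split2 c. ev L a (\<lambda>u. ev L b (\<lambda>v. \<phi> u v)))"
  by (simp add: ev_def sum_split2_map sum_cuts_split2)

lemma ev_split3:
  "ev L c (\<lambda>w. \<Sum>(u, v, x)\<in>split3 w. \<phi> u v x)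
    = (\<Sum>(a, b, d)\<in>split3 c. ev L a (\<lambda>u. ev L b (\<lambda>v. ev L d (\<lambda>x. \<phi> u v x))))"
  by (simp add: ev_def sum_split3_map sum_cuts_split3)

lemma ev_pivot:
  "ev L (p @ x # q) \<phi>
    = (\<Sum>(a, b)\<in>split2 p. \<Sum>(c, d)\<in>split2 q. ev L a (\<lambda>u. ev L d (\<lambda>v. \<phi> (u @ L (b @ x # c) # v))))"
  by (simp add: ev_def sum_cuts_pivot)

definition additive_on :: "'v::ab_group_add set \<Rightarrow> ('v \<Rightarrow> 'w::ab_group_add) \<Rightarrow> bool" where
  "additive_on H \<phi> \<longleftrightarrow> (\<forall>a\<in>H. \<forall>b\<in>H. \<phi> (a + b) = \<phi> a + \<phi> b)"

lemma additive_on_0: "additive_on H \<phi> \<Longrightarrow> 0 \<in> H \<Longrightarrow> \<phi> 0 = 0"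
  unfolding additive_on_def by (metis add.right_neutral add_left_cancel)

definition blk :: "('p \<Rightarrow> tag) \<Rightarrow> ('p list \<Rightarrow> 'v) \<Rightarrow> 'p list \<Rightarrow> 'v letter" where
  "blk \<tau> X b = (sum_list (map \<tau> b), X b)"

lemma fst_blk [simp]: "fst (blk \<tau> X b) = sum_list (map \<tau> b)" and snd_blk [simp]: "snd (blk \<tau> X b) = X b"
  by (simp_all add: blk_def)

lemma wt_blk: "cs \<in> cuts c \<Longrightarrow> wt (map (blk \<tau> X) cs) = sum_list (map \<tau> c)"
proof -
  have "wt (map (blk \<tau> X) cs) = sum_list (map \<tau> (concat cs))"
    by (induction cs) auto
  then show "cs \<in> cuts c \<Longrightarrow> ?thesis" by (simp add: cuts_def)
qed

text \<open>The cancellations below work with signs and sums only, so the graded pieces enter as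
  additive groups indexed by tags.\<close>

locale graded_groups =
  fixes G :: "tag \<Rightarrow> 'v::ab_group_add set"
  assumes G_0 [simp]: "0 \<in> G t"
    and G_add: "a \<in> G t \<Longrightarrow> b \<in> G t \<Longrightarrow> a + b \<in> G t"
    and G_minus: "a \<in> G t \<Longrightarrow> - a \<in> G t"
begin

definition adm :: "'v letter list \<Rightarrow> bool" where
  "adm w \<longleftrightarrow> (\<forall>x\<in>set w. snd x \<in> G (fst x))"

lemma adm_simps [simp]:
  "adm []" "adm (x # w) \<longleftrightarrow> snd x \<in> G (fst x) \<and> adm w" "adm (u @ w) \<longleftrightarrow> adm u \<and> adm w"
  by (auto simp: adm_def)

definition multiadditive :: "('v letter list \<Rightarrow> 'w::ab_group_add) \<Rightarrow> bool" where
  "multiadditive \<phi> \<longleftrightarrow> (\<forall>u w t. adm u \<longrightarrow> adm w \<longrightarrow> additive_on (G t) (\<lambda>v. \<phi> (u @ (t, v) # w)))"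

lemma multiadditiveD:
  "multiadditive \<phi> \<Longrightarrow> adm u \<Longrightarrow> adm w \<Longrightarrow> additive_on (G t) (\<lambda>v. \<phi> (u @ (t, v) # w))"
  unfolding multiadditive_def by blast

lemma multiadditive_0:
  "multiadditive \<phi> \<Longrightarrow> adm u \<Longrightarrow> adm w \<Longrightarrow> \<phi> (u @ (t, 0) # w) = 0"
  using additive_on_0[OF multiadditiveD, of \<phi> u w t] by simp

lemma G_ksign: "a \<in> G t \<Longrightarrow> ksign e a \<in> G t"
  by (simp add: ksign_def G_minus)

lemma G_sum: "(\<And>x. x \<in> S \<Longrightarrow> f x \<in> G t) \<Longrightarrow> sum f S \<in> G t"
  by (induction S rule: infinite_finite_induct) (auto intro: G_add)

lemma additive_on_sum:
  "additive_on (G t) \<phi> \<Longrightarrow> (\<And>x. x \<in> S \<Longrightarrow> f x \<in> G t) \<Longrightarrow> \<phi> (sum f S) = (\<Sum>x\<in>S. \<phi> (f x))"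
proof (induction S rule: infinite_finite_induct)
  case (insert x S)
  then have "\<phi> (f x + sum f S) = \<phi> (f x) + \<phi> (sum f S)"
    unfolding additive_on_def by (metis G_sum insertCI)
  with insert show ?case by simp
qed (auto dest: additive_on_0)

lemma additive_on_minus:
  assumes "additive_on (G t) \<phi>" "a \<in> G t"
  shows "\<phi> (- a) = - \<phi> a"
proof -
  have "\<phi> (a + - a) = \<phi> a + \<phi> (- a)" using assms unfolding additive_on_def by (blast intro: G_minus)
  then show ?thesis using additive_on_0[OF assms(1)] by (simp add: minus_unique)
qed

lemma additive_on_ksign:
  "additive_on (G t) \<phi> \<Longrightarrow> a \<in> G t \<Longrightarrow> \<phi> (ksign e a) = ksign e (\<phi> a)"
  by (simp add: ksign_def additive_on_minus)

lemma additive_on_ev: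
  "additive_on (G t) \<phi> \<Longrightarrow> (\<And>cs. cs \<in> cuts c \<Longrightarrow> f (map L cs) \<in> G t) \<Longrightarrow>
    \<phi> (ev L c f) = ev L c (\<lambda>w. \<phi> (f w))"
  unfolding ev_def by (rule additive_on_sum)

lemma G_ev: "(\<And>cs. cs \<in> cuts c \<Longrightarrow> f (map L cs) \<in> G t) \<Longrightarrow> ev L c f \<in> G t"
  unfolding ev_def by (rule G_sum)

end

locale ainf_structure = graded_groups G for G :: "tag \<Rightarrow> 'v::ab_group_add set" +
  fixes m :: "'v letter list \<Rightarrow> 'v"
  assumes m_closed: "adm w \<Longrightarrow> w \<noteq> [] \<Longrightarrow> m w \<in> G (wt w + (0, 1))"
    and m_multiadditive: "multiadditive m"
    and ins_m_m: "adm w \<Longrightarrow> ins m m w = 0"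

text \<open>Closure of \<open>S\<close> under nonempty factors ensures that the equation at
  \<open>c\<close> only involves entries over members of \<open>S\<close>. Distinctness means that a
  position meets at most one block of a cut, which is what makes gauge transformations
  linear.\<close>

locale mc_family = ainf_structure G m
  for G :: "tag \<Rightarrow> 'v::ab_group_add set" and m :: "'v letter list \<Rightarrow> 'v" +
  fixes \<tau> :: "'p \<Rightarrow> tag" and X :: "'p list \<Rightarrow> 'v" and S :: "'p list set"
  assumes S_nonempty: "c \<in> S \<Longrightarrow> c \<noteq> []"
    and S_factor: "a @ b @ c \<in> S \<Longrightarrow> b \<noteq> [] \<Longrightarrow> b \<in> S"
    and S_distinct: "c \<in> S \<Longrightarrow> distinct c"
    and X_closed: "c \<in> S \<Longrightarrow> X c \<in> G (sum_list (map \<tau> c))"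
    and mc: "c \<in> S \<Longrightarrow> ev (blk \<tau> X) c m = 0"
begin

abbreviation L where "L \<equiv> blk \<tau> X"
abbreviation T where "T c \<equiv> sum_list (map \<tau> c)"
abbreviation sdegT where "sdegT c \<equiv> snd (T c)"

definition S0 where "S0 = insert [] S"

lemma S0_factor: "a @ b @ c \<in> S0 \<Longrightarrow> b \<in> S0"
  using S_factor by (cases "b = []") (auto simp: S0_def)

lemma S0_append: "a @ b \<in> S0 \<Longrightarrow> a \<in> S0 \<and> b \<in> S0"
  using S0_factor[of "[]" a b] S0_factor[of a b "[]"] by simp

lemma S0_Cons: "x # b \<in> S0 \<Longrightarrow> b \<in> S0"
  using S0_append[of "[x]" b] by simp

lemma S0_nonempty: "c \<in> S0 \<Longrightarrow> c \<noteq> [] \<Longrightarrow> c \<in> S"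
  by (auto simp: S0_def)

lemma S0_split2: "(a, b) \<in> split2 c \<Longrightarrow> c \<in> S0 \<Longrightarrow> a \<in> S0 \<and> b \<in> S0"
  using S0_append[of a b] by (simp add: split2_def)

lemma S0_split3: "(a, b, d) \<in> split3 c \<Longrightarrow> c \<in> S0 \<Longrightarrow> a \<in> S0 \<and> b \<in> S \<and> d \<in> S0"
  using S0_append[of a "b @ d"] S0_append[of b d] S0_nonempty[of b] by (simp add: split3_def)

lemma adm_L: "c \<in> S0 \<Longrightarrow> cs \<in> cuts c \<Longrightarrow> adm (map L cs)"
proof -
  assume c: "c \<in> S0" "cs \<in> cuts c"
  have "X b \<in> G (T b)" if "b \<in> set cs" for b
  proof -
    from that obtain us vs where "cs = us @ b # vs" by (meson split_list)
    with c have "concat us @ b @ concat vs \<in> S0" "b \<noteq> []" by (auto simp: cuts_def)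
    then show ?thesis using S0_factor S0_nonempty X_closed by blast
  qed
  then show "adm (map L cs)" by (auto simp: adm_def)
qed

lemma m_L_closed: "c \<in> S \<Longrightarrow> cs \<in> cuts c \<Longrightarrow> m (map L cs) \<in> G (T c + (0, 1))"
  using m_closed[OF adm_L, of c cs] cuts_nonempty[of cs c] wt_blk[of cs c \<tau> X]
  by (simp add: S0_def S_nonempty)

text \<open>All cuts of \<open>c\<close> have the same total tag, so the inserted values may be
  added up inside one letter, where they give the Maurer-Cartan sum.\<close>

lemma ev_insert_m_eq_0:
  assumes "multiadditive \<phi>" "adm u" "adm w" "c \<in> S"
  shows "ev L c (\<lambda>v. \<phi> (u @ (wt v + (0, 1), m v) # w)) = 0"
proof -
  have "ev L c (\<lambda>v. \<phi> (u @ (wt v + (0, 1), m v) # w)) = ev L c (\<lambda>v. \<phi> (u @ (T c + (0, 1), m v) # w))"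
    by (rule ev_cong) (simp_all add: wt_blk)
  also have "\<dots> = \<phi> (u @ (T c + (0, 1), ev L c m) # w)"
    by (rule additive_on_ev[OF multiadditiveD, OF assms(1-3), symmetric]) (simp add: m_L_closed assms)
  finally show ?thesis using assms by (simp add: mc multiadditive_0)
qed

text \<open>For fixed outer words the sum over the cuts of the middle interval already vanishes. The
  sign may therefore be any function \<open>s\<close> of the left word, which allows a surrounding
  context \<open>p\<close>, \<open>q\<close> with its own degrees.\<close>

lemma ev_insert_m_context_eq_0:
  assumes "multiadditive \<phi>" "c \<in> S0" "adm p" "adm q"
  shows "ev L c (\<lambda>w. \<Sum>(u, v, x)\<in>split3 w. ksign (s u) (\<phi> (p @ u @ (wt v + (0, 1), m v) # x @ q))) = 0"
  unfolding ev_split3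
proof (rule sum.neutral, clarify, goal_cases)
  case (1 a b d)
  note abd = S0_split3[OF 1 assms(2)]
  let ?F = "\<lambda>u v x. ksign (s u) (\<phi> (p @ u @ (wt v + (0, 1), m v) # x @ q))"
  have "ev L a (\<lambda>u. ev L b (\<lambda>v. ev L d (?F u v))) = ev L a (\<lambda>u. ev L d (\<lambda>x. ev L b (\<lambda>v. ?F u v x)))"
    by (subst ev_swap) (rule refl)
  also have "\<dots> = ev L a (\<lambda>u. ev L d (\<lambda>x. 0))"
  proof (intro ev_cong refl)
    fix us xs assume "us \<in> cuts a" "xs \<in> cuts d"
    then show "ev L b (\<lambda>v. ?F (map L us) v (map L xs)) = 0"
      unfolding ev_ksign using ev_insert_m_eq_0[OF assms(1), of "p @ map L us" "map L xs @ q" b]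
        abd assms(3,4) adm_L[of a us] adm_L[of d xs] by simp
  qed
  finally show ?case by simp
qed

lemma ev_ins_eq_0:
  assumes "multiadditive \<phi>" "c \<in> S0"
  shows "ev L c (ins m \<phi>) = 0"
  using ev_insert_m_context_eq_0[OF assms, of "[]" "[]" "\<lambda>u. snd (wt u)"] by (simp add: ins_def[abs_def])

end

section \<open>Gauge transformation at a single position\<close>

locale mc_gauge = mc_family G m \<tau> X S
  for G :: "tag \<Rightarrow> 'v::ab_group_add set" and m and \<tau> :: "'p \<Rightarrow> tag" and X S +
  fixes i :: 'p and h :: 'v
  assumes h_closed: "h \<in> G (fst (\<tau> i), snd (\<tau> i) - 1)"
begin

abbreviation hl where "hl \<equiv> ((fst (\<tau> i), snd (\<tau> i) - 1), h)"

text \<open>The letter at \<open>i\<close> is replaced by \<open>h\<close>. As \<open>h\<close> lies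
  one degree below it, the sign is that of an odd operator passing \<open>c1\<close>.\<close>

definition evh :: "('v letter list \<Rightarrow> 'w::ab_group_add) \<Rightarrow> 'p list \<Rightarrow> 'p list \<Rightarrow> 'w" where
  "evh \<phi> c1 c2 = ksign (sdegT c1) (ev L c1 (\<lambda>u. ev L c2 (\<lambda>v. \<phi> (u @ hl # v))))"

text \<open>Since \<open>i\<close> occurs at most once in a word, the gauge transformation along \<open>h\<close> stops after its
  linear term.\<close>

definition gauge :: "('v letter list \<Rightarrow> 'w::ab_group_add) \<Rightarrow> 'p list \<Rightarrow> 'w" where
  "gauge \<phi> c = (if i \<in> set c then evh \<phi> (takeWhile (\<lambda>x. x \<noteq> i) c) (tl (dropWhile (\<lambda>x. x \<noteq> i) c)) else 0)"

lemma gauge_append [simp]: "i \<notin> set c1 \<Longrightarrow> gauge \<phi> (c1 @ i # c2) = evh \<phi> c1 c2"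
  by (simp add: gauge_def dropWhile_append takeWhile_append)

lemma gauge_notin [simp]: "i \<notin> set c \<Longrightarrow> gauge \<phi> c = 0"
  by (simp add: gauge_def)

definition Y where "Y c = X c + gauge m c"

lemma wt_gauge: "cs1 \<in> cuts c1 \<Longrightarrow> cs2 \<in> cuts c2 \<Longrightarrow>
    wt (map L cs1 @ hl # map L cs2) + (0, 1) = T (c1 @ i # c2)"
  by (simp add: wt_blk plus_prod_def prod_eq_iff)

lemma m_gauge_closed:
  assumes "c1 \<in> S0" "c2 \<in> S0" "cs1 \<in> cuts c1" "cs2 \<in> cuts c2"
  shows "m (map L cs1 @ hl # map L cs2) \<in> G (T (c1 @ i # c2))"
proof -
  have "m (map L cs1 @ hl # map L cs2) \<in> G (wt (map L cs1 @ hl # map L cs2) + (0, 1))"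
    using assms h_closed by (intro m_closed) (auto simp: adm_L)
  then show ?thesis by (subst (asm) wt_gauge) (use assms in auto)
qed

lemma evh_m_closed: "c1 \<in> S0 \<Longrightarrow> c2 \<in> S0 \<Longrightarrow> evh m c1 c2 \<in> G (T (c1 @ i # c2))"
  unfolding evh_def by (intro G_ksign G_ev m_gauge_closed)

lemma additive_on_evh:
  assumes "c1 \<in> S0" "c2 \<in> S0" "additive_on (G (T (c1 @ i # c2))) \<psi>"
  shows "\<psi> (evh m c1 c2) = ksign (sdegT c1) (ev L c1 (\<lambda>u. ev L c2 (\<lambda>v. \<psi> (m (u @ hl # v)))))"
proof -
  note cl = m_gauge_closed[OF assms(1,2)]
  have "\<psi> (evh m c1 c2) = ksign (sdegT c1) (\<psi> (ev L c1 (\<lambda>u. ev L c2 (\<lambda>v. m (u @ hl # v)))))"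
    unfolding evh_def by (intro additive_on_ksign[OF assms(3)] G_ev cl)
  also have "\<psi> (ev L c1 (\<lambda>u. ev L c2 (\<lambda>v. m (u @ hl # v))))
      = ev L c1 (\<lambda>u. \<psi> (ev L c2 (\<lambda>v. m (u @ hl # v))))"
    by (intro additive_on_ev[OF assms(3)] G_ev cl)
  also have "\<dots> = ev L c1 (\<lambda>u. ev L c2 (\<lambda>v. \<psi> (m (u @ hl # v))))"
    by (intro ev_cong refl additive_on_ev[OF assms(3)] cl)
  finally show ?thesis .
qed

lemma distinct_S0: "c \<in> S0 \<Longrightarrow> distinct c"
  using S_distinct by (auto simp: S0_def)

lemma Y_closed: "c \<in> S \<Longrightarrow> Y c \<in> G (T c)"
proof (cases "i \<in> set c")
  case True
  assume c: "c \<in> S"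
  from True obtain c1 c2 where c12: "c = c1 @ i # c2" by (meson split_list)
  with c have "c1 \<in> S0" "c2 \<in> S0" "i \<notin> set c1"
    using S0_append[of c1 "i # c2"] S0_Cons S_distinct[of c] by (auto simp: S0_def)
  with evh_m_closed[of c1 c2] X_closed[OF c] c12 show ?thesis
    by (auto simp: Y_def intro!: G_add)
qed (simp add: Y_def X_closed)

lemma ev_Y_notin: "i \<notin> set c \<Longrightarrow> ev (blk \<tau> Y) c \<phi> = ev L c \<phi>"
  by (rule ev_cong_letters) (auto simp: blk_def Y_def intro!: gauge_notin)

text \<open>By the Maurer-Cartan equation, the terms in which the inserted operation does not take \<open>h\<close> as
  an argument cancel.\<close>

lemma evh_ins:
  assumes \<phi>: "multiadditive \<phi>" and c: "c1 @ i # c2 \<in> S0"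
  shows "evh (ins m \<phi>) c1 c2 = (\<Sum>(a, b)\<in>split2 c1. \<Sum>(c, d)\<in>split2 c2.
    ev L a (\<lambda>u. ev L d (\<lambda>v. \<phi> (u @ (T (b @ i # c), evh m b c) # v))))" (is "_ = ?R")
proof -
  have c12: "c1 \<in> S0" "c2 \<in> S0" using S0_append[OF c] S0_Cons by auto
  let ?F = "\<lambda>u v x. ksign (snd (wt u)) (\<phi> (u @ (wt v + (0, 1), m v) # x))"
  have "ev L c1 (\<lambda>u. ev L c2 (\<lambda>v. ins m \<phi> (u @ hl # v)))
    = ev L c1 (\<lambda>u. ev L c2 (\<lambda>v. \<Sum>(p1, p2, p3)\<in>split3 u. ?F p1 p2 (p3 @ hl # v)))
    + ev L c1 (\<lambda>u. ev L c2 (\<lambda>v. \<Sum>(p1, p2)\<in>split2 u. \<Sum>(q1, q2)\<in>split2 v. ?F p1 (p2 @ hl # q1) q2))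
    + ev L c1 (\<lambda>u. ev L c2 (\<lambda>v. \<Sum>(q1, q2, q3)\<in>split3 v. ?F (u @ hl # q1) q2 q3))"
    (is "_ = ?A + ?B + ?C")
    unfolding ins_def sum_split3_pivot ev_add ..
  also have "?A = 0"
  proof -
    have "?A = ev L c2 (\<lambda>v. ev L c1 (\<lambda>u. \<Sum>(p1, p2, p3)\<in>split3 u. ?F p1 p2 (p3 @ hl # v)))"
      by (rule ev_swap)
    also have "\<dots> = ev L c2 (\<lambda>v. 0)"
    proof (intro ev_cong refl)
      fix cs assume "cs \<in> cuts c2"
      then show "ev L c1 (\<lambda>u. \<Sum>(p1, p2, p3)\<in>split3 u. ?F p1 p2 (p3 @ hl # map L cs)) = 0"
        using ev_insert_m_context_eq_0[OF \<phi> c12(1), of "[]" "hl # map L cs" "\<lambda>u. snd (wt u)"]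
          adm_L[of c2 cs] c12 h_closed by simp
    qed
    finally show ?thesis by simp
  qed
  also have "?C = 0"
  proof -
    have "?C = ev L c1 (\<lambda>u. 0)"
    proof (intro ev_cong refl)
      fix cs assume "cs \<in> cuts c1"
      then show "ev L c2 (\<lambda>v. \<Sum>(q1, q2, q3)\<in>split3 v. ?F (map L cs @ hl # q1) q2 q3) = 0"
        using ev_insert_m_context_eq_0[OF \<phi> c12(2), of "map L cs @ [hl]" "[]" "\<lambda>u. snd (wt (map L cs @ hl # u))"]
          adm_L[of c1 cs] c12 h_closed by (simp add: add_ac)
    qed
    then show ?thesis by simp
  qed
  also have "?B = (\<Sum>(a, b)\<in>split2 c1. \<Sum>(c, d)\<in>split2 c2.
      ev L a (\<lambda>p1. ev L b (\<lambda>p2. ev L c (\<lambda>q1. ev L d (\<lambda>q2. ?F p1 (p2 @ hl # q1) q2)))))"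
  proof -
    have "?B = ev L c1 (\<lambda>u. \<Sum>(p1, p2)\<in>split2 u. ev L c2 (\<lambda>v. \<Sum>(q1, q2)\<in>split2 v. ?F p1 (p2 @ hl # q1) q2))"
      by (simp only: case_prod_unfold ev_sum)
    also have "\<dots> = (\<Sum>(a, b)\<in>split2 c1. ev L a (\<lambda>p1. ev L b (\<lambda>p2.
        \<Sum>(c, d)\<in>split2 c2. ev L c (\<lambda>q1. ev L d (\<lambda>q2. ?F p1 (p2 @ hl # q1) q2)))))"
      unfolding ev_split2 ..
    finally show ?thesis by (simp only: case_prod_unfold ev_sum)
  qed
  also have "\<dots> = ksign (sdegT c1) ?R"
    unfolding ksign_sum case_prod_unfold
  proof (intro sum.cong refl, goal_cases)
    case (1 s t)
    obtain a b c d where st: "s = (a, b)" "t = (c, d)" by (metis prod.exhaust)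
    with 1 have ab: "(a, b) \<in> split2 c1" and cd: "(c, d) \<in> split2 c2" by auto
    note S0s = S0_split2[OF ab c12(1)] S0_split2[OF cd c12(2)]
    have T1: "T c1 = T a + T b" using ab by (auto simp: split2_def)
    have "ev L a (\<lambda>p1. ev L b (\<lambda>p2. ev L c (\<lambda>q1. ev L d (\<lambda>q2. ?F p1 (p2 @ hl # q1) q2))))
      = ev L a (\<lambda>p1. ev L d (\<lambda>q2. ev L b (\<lambda>p2. ev L c (\<lambda>q1. ?F p1 (p2 @ hl # q1) q2))))"
      by (simp only: ev_swap[of L d])
    also have "\<dots> = ev L a (\<lambda>p1. ev L d (\<lambda>q2.
        ksign (sdegT a) (ksign (sdegT b) (\<phi> (p1 @ (T (b @ i # c), evh m b c) # q2)))))"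
    proof (intro ev_cong refl)
      fix us vs assume us: "us \<in> cuts a" and vs: "vs \<in> cuts d"
      have "ev L b (\<lambda>p2. ev L c (\<lambda>q1. ?F (map L us) (p2 @ hl # q1) (map L vs)))
        = ev L b (\<lambda>p2. ev L c (\<lambda>q1. ksign (sdegT a) (\<phi> (map L us @ (T (b @ i # c), m (p2 @ hl # q1)) # map L vs))))"
        \<comment> \<open>\<open>h\<close> lowers the degree by one and \<open>m\<close> raises it
          by one, so the new letter carries the ordinary tag of the interval
          \<open>b @ i # c\<close>.\<close>
        by (intro ev_cong refl) (subst wt_gauge, simp_all add: wt_blk[OF us])
      also have "\<dots> = ksign (sdegT a) (ksign (sdegT b)
          (\<phi> (map L us @ (T (b @ i # c), evh m b c) # map L vs)))"
      proof -
        have "\<phi> (map L us @ (T (b @ i # c), evh m b c) # map L vs) = ksign (sdegT b)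
            (ev L b (\<lambda>u. ev L c (\<lambda>v. \<phi> (map L us @ (T (b @ i # c), m (u @ hl # v)) # map L vs))))"
          using us vs S0s by (intro additive_on_evh multiadditiveD[OF \<phi>] adm_L) auto
        then show ?thesis unfolding ev_ksign by (simp only: ksign_ksign) (rule ksign_cong, simp)
      qed
      finally show "ev L b (\<lambda>p2. ev L c (\<lambda>q1. ?F (map L us) (p2 @ hl # q1) (map L vs)))
        = ksign (sdegT a) (ksign (sdegT b) (\<phi> (map L us @ (T (b @ i # c), evh m b c) # map L vs)))" .
    qed
    finally show ?case by (simp add: st ev_ksign T1)
  qed
  \<comment> \<open>The sign built into \<open>evh\<close> meets the sign just extracted; both have
    exponent \<open>sdegT c1\<close> and cancel.\<close>
  finally show ?thesis by (simp add: evh_def) (simp add: ksign_def)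
qed

text \<open>In each cut only the block containing \<open>i\<close> is altered, so multiadditivity
  gives the old value plus one linear correction. \<open>evh_ins\<close> identifies the sum of these
  corrections with the gauge term of \<open>ins m \<phi>\<close>.\<close>

lemma ev_Y_eq:
  assumes \<phi>: "multiadditive \<phi>" and c: "c \<in> S0"
  shows "ev (blk \<tau> Y) c \<phi> = ev L c \<phi> + gauge (ins m \<phi>) c"
proof (cases "i \<in> set c")
  case True
  then obtain c1 c2 where c12: "c = c1 @ i # c2" by (meson split_list)
  have S0: "c1 \<in> S0" "c2 \<in> S0" using S0_append[OF c[unfolded c12]] S0_Cons by auto
  have ni: "i \<notin> set c1" "i \<notin> set c2" using distinct_S0[OF c] c12 by auto
  have "ev (blk \<tau> Y) c \<phi> = (\<Sum>(a, b)\<in>split2 c1. \<Sum>(c, d)\<in>split2 c2.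
      ev L a (\<lambda>u. ev L d (\<lambda>v. \<phi> (u @ L (b @ i # c) # v)))
      + ev L a (\<lambda>u. ev L d (\<lambda>v. \<phi> (u @ (T (b @ i # c), evh m b c) # v))))"
    unfolding c12 ev_pivot case_prod_unfold
  proof (intro sum.cong refl, goal_cases)
    case (1 s t)
    obtain a b c' d where st: "s = (a, b)" "t = (c', d)" by (metis prod.exhaust)
    with 1 have ab: "(a, b) \<in> split2 c1" and cd: "(c', d) \<in> split2 c2" by auto
    note S0s = S0_split2[OF ab S0(1)] S0_split2[OF cd S0(2)]
    have nis: "i \<notin> set a" "i \<notin> set b" "i \<notin> set d" using ni ab cd by (auto simp: split2_def)
    have "a @ (b @ i # c') @ d = c" using ab cd c12 by (auto simp: split2_def)
    with c S0_factor[of a "b @ i # c'" d] have b: "b @ i # c' \<in> S" by (auto intro: S0_nonempty)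
    have "ev (blk \<tau> Y) a (\<lambda>u. ev (blk \<tau> Y) d (\<lambda>v. \<phi> (u @ blk \<tau> Y (b @ i # c') # v)))
      = ev L a (\<lambda>u. ev L d (\<lambda>v. \<phi> (u @ (T (b @ i # c'), X (b @ i # c') + evh m b c') # v)))"
      using nis by (simp add: ev_Y_notin) (simp add: blk_def Y_def)
    also have "\<dots> = ev L a (\<lambda>u. ev L d (\<lambda>v. \<phi> (u @ L (b @ i # c') # v)
        + \<phi> (u @ (T (b @ i # c'), evh m b c') # v)))"
    proof (intro ev_cong refl)
      fix us vs assume "us \<in> cuts a" "vs \<in> cuts d"
      then have "additive_on (G (T (b @ i # c'))) (\<lambda>x. \<phi> (map L us @ (T (b @ i # c'), x) # map L vs))"
        using S0s by (intro multiadditiveD[OF \<phi>] adm_L) auto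
      then show "\<phi> (map L us @ (T (b @ i # c'), X (b @ i # c') + evh m b c') # map L vs)
        = \<phi> (map L us @ L (b @ i # c') # map L vs) + \<phi> (map L us @ (T (b @ i # c'), evh m b c') # map L vs)"
        using X_closed[OF b] evh_m_closed[of b c'] S0s unfolding additive_on_def blk_def by blast
    qed
    finally show ?case by (simp add: st ev_add)
  qed
  also have "\<dots> = ev L c \<phi> + evh (ins m \<phi>) c1 c2"
    unfolding c12 ev_pivot evh_ins[OF \<phi> c[unfolded c12]] case_prod_unfold sum.distrib ..
  finally show ?thesis using ni by (simp add: c12)
qed (simp add: ev_Y_notin)

text \<open>With \<open>\<phi> = m\<close> the correction is the gauge term of
  \<open>ins m m\<close>, which is zero by the structure relations.\<close>

lemma mc_Y: "c \<in> S \<Longrightarrow> ev (blk \<tau> Y) c m = 0"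
proof -
  assume c: "c \<in> S"
  have "gauge (ins m m) c = 0"
  proof (cases "i \<in> set c")
    case True
    then obtain c1 c2 where c12: "c = c1 @ i # c2" by (meson split_list)
    with c have S0: "c1 \<in> S0" "c2 \<in> S0" "i \<notin> set c1"
      using S0_append[of c1 "i # c2"] S0_Cons S_distinct[of c] by (auto simp: S0_def)
    have "ev L c1 (\<lambda>u. ev L c2 (\<lambda>v. ins m m (u @ hl # v))) = ev L c1 (\<lambda>u. ev L c2 (\<lambda>v. 0))"
      using S0 h_closed by (intro ev_cong refl ins_m_m) (auto simp: adm_L)
    then show ?thesis using S0(3) by (simp add: c12 evh_def)
  qed simp
  then show ?thesis using ev_Y_eq[OF m_multiadditive, of c] mc[OF c] c by (simp add: S0_def)
qed

lemma mc_family_Y: "mc_family G m \<tau> Y S"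
  by unfold_locales (simp_all add: S_nonempty S_factor S_distinct Y_closed mc_Y)

text \<open>On the diagonal the transformation adds the differential of \<open>h\<close> at
  \<open>i\<close> and leaves the other positions alone: this replaces an element by a cohomologous
  one.\<close>

lemma Y_singleton: "Y [j] = (if j = i then X [i] + m [hl] else X [j])"
  using gauge_append[of "[]" m "[]"] by (auto simp: Y_def evh_def)

end

section \<open>Invariance of the cyclic pairing\<close>

lemma sum_split2_swap:
  "(\<Sum>(a, b)\<in>A. \<Sum>(c, d)\<in>B. f a b c d) = (\<Sum>(c, d)\<in>B. \<Sum>(a, b)\<in>A. f a b c d)"
  unfolding case_prod_unfold by (rule sum.swap)

lemma sum2_cong:
  "(\<And>a b. (a, b) \<in> A \<Longrightarrow> f a b = g a b) \<Longrightarrow> (\<Sum>(a, b)\<in>A. f a b) = (\<Sum>(a, b)\<in>A. g a b)"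
  by (auto intro!: sum.cong)

lemma sum3_cong:
  "(\<And>a b c. (a, b, c) \<in> A \<Longrightarrow> f a b c = g a b c) \<Longrightarrow>
    (\<Sum>(a, b, c)\<in>A. f a b c) = (\<Sum>(a, b, c)\<in>A. g a b c)"
  by (auto intro!: sum.cong)

lemma sum2_add: "(\<Sum>(a, b)\<in>A. f a b + g a b) = (\<Sum>(a, b)\<in>A. f a b) + (\<Sum>(a, b)\<in>A. g a b)"
  by (simp add: case_prod_unfold sum.distrib)

lemma sum3_add:
  "(\<Sum>(a, b, c)\<in>A. f a b c + g a b c) = (\<Sum>(a, b, c)\<in>A. f a b c) + (\<Sum>(a, b, c)\<in>A. g a b c)"
  by (simp add: case_prod_unfold sum.distrib)

lemma sum2_minus: "(\<Sum>(a, b)\<in>A. - f a b) = - (\<Sum>(a, b)\<in>A. f a b :: 'a::ab_group_add)"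
  by (simp add: case_prod_unfold sum_negf)

lemma sum3_minus: "(\<Sum>(a, b, c)\<in>A. - f a b c) = - (\<Sum>(a, b, c)\<in>A. f a b c :: 'a::ab_group_add)"
  by (simp add: case_prod_unfold sum_negf)

lemma ksign_sum2: "ksign e (\<Sum>(a, b)\<in>A. f a b) = (\<Sum>(a, b)\<in>A. ksign e (f a b))"
  by (simp add: case_prod_unfold ksign_sum)

lemma ksign_sum3: "ksign e (\<Sum>(a, b, c)\<in>A. f a b c) = (\<Sum>(a, b, c)\<in>A. ksign e (f a b c))"
  by (simp add: case_prod_unfold ksign_sum)

lemma ev_sum2: "ev L c (\<lambda>w. \<Sum>(a, b)\<in>A. f a b w) = (\<Sum>(a, b)\<in>A. ev L c (f a b))"
  by (simp add: case_prod_unfold ev_sum)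

lemma ev_sum3: "ev L c (\<lambda>w. \<Sum>(a, b, d)\<in>A. f a b d w) = (\<Sum>(a, b, d)\<in>A. ev L c (f a b d))"
  by (simp add: case_prod_unfold ev_sum)

text \<open>This is a sum over the cyclic cuts of \<open>c @ [n]\<close>: the block containing \<open>n\<close> is \<open>c3 @ n # c1\<close>, and
  \<open>c2\<close> is cut further.\<close>

definition pairval :: "('v letter list \<Rightarrow> 'v \<Rightarrow> 'r::ab_group_add) \<Rightarrow> ('p \<Rightarrow> tag) \<Rightarrow> ('p list \<Rightarrow> 'v)
    \<Rightarrow> 'p list \<Rightarrow> 'p \<Rightarrow> 'r" where
  "pairval I \<tau> X c n = (\<Sum>(c1, c2, c3)\<in>split3 c.
     ksign (snd (sum_list (map \<tau> c1)) * (snd (sum_list (map \<tau> c2)) + snd (sum_list (map \<tau> c3)) + snd (\<tau> n)))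
       (ev (blk \<tau> X) c2 (\<lambda>w. I w (X (c3 @ n # c1)))))"

text \<open>\<open>D\<close> is the total tag of a complete cycle. \<open>I_closed\<close> is
  closedness of an inner product with the action on the dual unfolded: an operation inside the first
  argument of \<open>I\<close> is traded for one around its second argument, which also swallows the
  letters that the first argument no longer contains.\<close>

locale pairing = ainf_structure G m for G :: "tag \<Rightarrow> 'v::ab_group_add set" and m +
  fixes I :: "'v letter list \<Rightarrow> 'v \<Rightarrow> 'r::ab_group_add" and D :: tag
  assumes I_multiadditive: "multiadditive (\<lambda>w. I w x)"
    and I_eq_0: "fst (wt w) \<noteq> 1 \<Longrightarrow> I w x = 0"
    and I_additive: "adm w \<Longrightarrow> wt w + t = D \<Longrightarrow> additive_on (G t) (I w)"
    and I_closed: "adm w \<Longrightarrow> fst (wt w) = 1 \<Longrightarrow> x \<in> G t \<Longrightarrow> wt w + t + (0, 1) = D \<Longrightarrow>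
      ins m (\<lambda>w. I w x) w = (\<Sum>(w1, w2, w3)\<in>split3 w.
        ksign (1 + snd (wt w1) * (snd (wt w2) + snd (wt w3) + snd t) + snd (wt w2))
          (I w2 (m (w3 @ (t, x) # w1))))"

text \<open>\<open>rest_in_S\<close> says that once the first argument of \<open>I\<close> uses up
  the module entry of \<open>c\<close>, the complementary interval through \<open>n\<close> is one
  on which the Maurer-Cartan equation holds.\<close>

locale pairing_gauge = mc_gauge G m \<tau> X S i h + pairing G m I D
  for G :: "tag \<Rightarrow> 'v::ab_group_add set" and m and \<tau> :: "'p \<Rightarrow> tag" and X S i h
    and I :: "'v letter list \<Rightarrow> 'v \<Rightarrow> 'r::ab_group_add" and D +
  fixes c :: "'p list" and n :: 'p
  assumes c_in_S: "c \<in> S" and n_notin: "n \<notin> set c"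
    and T_c: "fst (T c) = 1" and T_c_n: "T c + \<tau> n = D"
    and rest_in_S: "c1 @ c2 @ c3 = c \<Longrightarrow> fst (T c2) = 1 \<Longrightarrow> c3 @ n # c1 \<in> S"
begin

lemma c_in_S0: "c \<in> S0" using c_in_S by (simp add: S0_def)

lemma ev_I_eq_0: "fst (T c2) \<noteq> 1 \<Longrightarrow> ev (blk \<tau> X') c2 (\<lambda>w. I w (x w)) = 0"
  unfolding ev_def by (intro sum.neutral ballI I_eq_0) (simp add: wt_blk)

lemma ev_I_add:
  assumes "c1 @ c2 @ c3 = c" "c2 \<noteq> []" "fst (T c2) = 1" "a \<in> G (T (c3 @ n # c1))" "b \<in> G (T (c3 @ n # c1))"
  shows "ev L c2 (\<lambda>w. I w (a + b)) = ev L c2 (\<lambda>w. I w a) + ev L c2 (\<lambda>w. I w b)"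
  unfolding ev_add[symmetric]
proof (intro ev_cong refl)
  fix cs assume cs: "cs \<in> cuts c2"
  have "c2 \<in> S0" using assms c_in_S0 S0_factor by blast
  with cs have "additive_on (G (T (c3 @ n # c1))) (I (map L cs))"
    using T_c_n assms(1) by (intro I_additive adm_L) (auto simp: wt_blk add_ac)
  with assms show "I (map L cs) (a + b) = I (map L cs) a + I (map L cs) b"
    unfolding additive_on_def by blast
qed

lemma ev_I_Y:
  assumes "c1 @ c2 @ c3 = c" "c2 \<noteq> []" "i \<notin> set c2"
  shows "ev (blk \<tau> Y) c2 (\<lambda>w. I w (Y (c3 @ n # c1)))
    = ev L c2 (\<lambda>w. I w (X (c3 @ n # c1))) + ev L c2 (\<lambda>w. I w (gauge m (c3 @ n # c1)))"
proof (cases "fst (T c2) = 1")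
  case True
  have R: "c3 @ n # c1 \<in> S" using rest_in_S assms True by blast
  have "gauge m (c3 @ n # c1) = Y (c3 @ n # c1) + - X (c3 @ n # c1)"
    by (simp add: Y_def)
  also have "\<dots> \<in> G (T (c3 @ n # c1))"
    using R by (intro G_add G_minus Y_closed X_closed)
  finally show ?thesis
    using ev_I_add[OF assms(1,2) True X_closed[OF R]] assms(3) by (simp add: Y_def ev_Y_notin)
qed (simp add: ev_I_eq_0)

lemma ev_I_gauge:
  assumes "c1 @ c2 @ c3 = c" "c2 \<noteq> []" "c3 @ n # c1 = e1 @ i # e2" "i \<notin> set e1"
  shows "ev L c2 (\<lambda>w. I w (gauge m (c3 @ n # c1)))
    = ksign (sdegT e1) (ev L c2 (\<lambda>w. ev L e1 (\<lambda>u. ev L e2 (\<lambda>v. I w (m (u @ hl # v))))))"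
proof (cases "fst (T c2) = 1")
  case True
  have R: "e1 @ i # e2 \<in> S0" using rest_in_S assms True by (metis S0_def insertCI)
  then have e: "e1 \<in> S0" "e2 \<in> S0" using S0_append S0_Cons by blast+
  have "c2 \<in> S0" using assms c_in_S0 S0_factor by blast
  have T_e: "T (e1 @ i # e2) = T (c3 @ n # c1)" using assms by simp
  show ?thesis
    unfolding assms(3) gauge_append[OF assms(4)]
    apply (subst ev_ksign[symmetric])
  proof (intro ev_cong refl)
    fix cs assume "cs \<in> cuts c2"
    then have "additive_on (G (T (e1 @ i # e2))) (I (map L cs))"
      unfolding T_e using T_c_n assms(1) \<open>c2 \<in> S0\<close>
      by (intro I_additive adm_L) (auto simp: wt_blk add_ac)
    from additive_on_evh[OF e this] show "I (map L cs) (evh m e1 e2)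
      = ksign (sdegT e1) (ev L e1 (\<lambda>u. ev L e2 (\<lambda>v. I (map L cs) (m (u @ hl # v)))))" .
  qed
next
  case False
  have "ev L c2 (\<lambda>w. ev L e1 (\<lambda>u. ev L e2 (\<lambda>v. I w (m (u @ hl # v))))) = ev L c2 (\<lambda>w. 0)"
    using False by (intro ev_cong refl) (simp add: I_eq_0 wt_blk)
  with False show ?thesis by (simp add: ev_I_eq_0)
qed

text \<open>Only the second argument of \<open>I\<close> changes. Closedness identifies the total
  change, up to a global sign, with the evaluation of \<open>ins m (\<lambda>w. I w h)\<close> on
  \<open>c\<close>, which vanishes for a Maurer-Cartan family.\<close>

lemma pairval_Y_last:
  assumes "i = n"
  shows "pairval I \<tau> Y c n = pairval I \<tau> X c n"
proof -
  have "ev L c (ins m (\<lambda>w. I w h)) = 0"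
    by (rule ev_ins_eq_0[OF I_multiadditive c_in_S0])
  also have "ev L c (ins m (\<lambda>w. I w h)) = ev L c (\<lambda>w. \<Sum>(w1, w2, w3)\<in>split3 w.
        ksign (1 + snd (wt w1) * (snd (wt w2) + snd (wt w3) + (snd (\<tau> i) - 1)) + snd (wt w2))
          (I w2 (m (w3 @ hl # w1))))"
  proof (intro ev_cong refl)
    fix cs assume cs: "cs \<in> cuts c"
    have "T c + hlt + (0, 1) = D" if "hlt = (fst (\<tau> i), snd (\<tau> i) - 1)" for hlt
      using T_c_n assms that by (simp add: prod_eq_iff)
    with cs T_c h_closed show "ins m (\<lambda>w. I w h) (map L cs) = (\<Sum>(w1, w2, w3)\<in>split3 (map L cs).
        ksign (1 + snd (wt w1) * (snd (wt w2) + snd (wt w3) + (snd (\<tau> i) - 1)) + snd (wt w2))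
          (I w2 (m (w3 @ hl # w1))))"
      by (subst I_closed[where t = "(fst (\<tau> i), snd (\<tau> i) - 1)"]) (auto simp: wt_blk adm_L[OF c_in_S0 cs])
  qed
  also have "\<dots> = (\<Sum>(c1, c2, c3)\<in>split3 c.
      ksign (1 + sdegT c1 * (sdegT c2 + sdegT c3 + (snd (\<tau> i) - 1)) + sdegT c2)
        (ev L c2 (\<lambda>w. ev L c3 (\<lambda>u. ev L c1 (\<lambda>v. I w (m (u @ hl # v)))))))"
    unfolding ev_split3
  proof (rule sum3_cong, goal_cases)
    case (1 c1 c2 c3)
    have "ev L c1 (\<lambda>u. ev L c2 (\<lambda>v. ev L c3 (\<lambda>x.
        ksign (1 + snd (wt u) * (snd (wt v) + snd (wt x) + (snd (\<tau> i) - 1)) + snd (wt v)) (I v (m (x @ hl # u))))))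
      = ev L c1 (\<lambda>u. ev L c2 (\<lambda>v. ev L c3 (\<lambda>x.
        ksign (1 + sdegT c1 * (sdegT c2 + sdegT c3 + (snd (\<tau> i) - 1)) + sdegT c2) (I v (m (x @ hl # u))))))"
      by (intro ev_cong refl) (simp add: wt_blk)
    then show ?case by (simp only: ev_ksign ev_swap[of L c1])
  qed
  also have "\<dots> = ksign (1 + sdegT c) (\<Sum>(c1, c2, c3)\<in>split3 c.
     ksign (sdegT c1 * (sdegT c2 + sdegT c3 + snd (\<tau> n)))
       (ev L c2 (\<lambda>w. I w (gauge m (c3 @ n # c1)))))"
    unfolding ksign_sum3
  proof (rule sum3_cong, goal_cases)
    case (1 c1 c2 c3)
    then have c: "c1 @ c2 @ c3 = c" "c2 \<noteq> []" by (auto simp: split3_def)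
    then have "ev L c2 (\<lambda>w. I w (gauge m (c3 @ n # c1)))
      = ksign (sdegT c3) (ev L c2 (\<lambda>w. ev L c3 (\<lambda>u. ev L c1 (\<lambda>v. I w (m (u @ hl # v))))))"
      using n_notin assms by (intro ev_I_gauge) auto
    then show ?case
      using assms c(1)[symmetric] by (simp only: ksign_ksign) (rule ksign_cong, auto simp: algebra_simps)
  qed
  finally have "(\<Sum>(c1, c2, c3)\<in>split3 c.
     ksign (sdegT c1 * (sdegT c2 + sdegT c3 + snd (\<tau> n)))
       (ev L c2 (\<lambda>w. I w (gauge m (c3 @ n # c1))))) = 0" by simp
  moreover have "pairval I \<tau> Y c n = pairval I \<tau> X c n + (\<Sum>(c1, c2, c3)\<in>split3 c.
     ksign (sdegT c1 * (sdegT c2 + sdegT c3 + snd (\<tau> n)))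
       (ev L c2 (\<lambda>w. I w (gauge m (c3 @ n # c1)))))"
    unfolding pairval_def sum3_add[symmetric] ksign_add[symmetric]
  proof (rule sum3_cong, goal_cases)
    case (1 c1 c2 c3)
    then show ?case using n_notin assms by (subst ev_I_Y) (auto simp: split3_def)
  qed
  ultimately show ?thesis by simp
qed

definition K where
  "K t x w1 w2 w3 = ksign (1 + snd (wt w1) * (snd (wt w2) + snd (wt w3) + snd t) + snd (wt w2))
     (I w2 (m (w3 @ (t, x) # w1)))"

text \<open>Without a module entry in \<open>w\<close> both sides are zero. Including this case lets
  closedness be applied around \<open>h\<close> before it is known whether the interval contains the
  module position.\<close>

lemma ins_I:
  assumes "adm w" "fst (wt w) \<le> 1" "fst (wt w) = 1 \<Longrightarrow> x \<in> G t" "wt w + t + (0, 1) = D"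
  shows "ins m (\<lambda>w. I w x) w = (\<Sum>(w1, w2, w3)\<in>split3 w. K t x w1 w2 w3)"
proof (cases "fst (wt w) = 1")
  case True
  with assms show ?thesis unfolding K_def by (intro I_closed) auto
next
  case False
  with assms have 0: "fst (wt w) = 0" by simp
  have "ins m (\<lambda>w. I w x) w = 0"
    unfolding ins_def using 0 by (intro sum.neutral) (auto simp: split3_def I_eq_0)
  moreover have "(\<Sum>(w1, w2, w3)\<in>split3 w. K t x w1 w2 w3) = 0"
    unfolding K_def using 0 by (intro sum.neutral) (auto simp: split3_def I_eq_0)
  ultimately show ?thesis by simp
qed

text \<open>After closedness, the three sums distinguish whether \<open>h\<close> ends up in the
  third, the second or the first part of the word: before the vector in the outer operation, in the
  first argument of \<open>I\<close>, or after that vector.\<close>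

lemma evh_ins_I:
  assumes c: "a @ (b @ i # q) @ d = c"
  defines "K' \<equiv> K (T (d @ n # a)) (X (d @ n # a))"
  shows "evh (ins m (\<lambda>w. I w (X (d @ n # a)))) b q = ksign (sdegT b)
      ((\<Sum>(p1, p2, p3)\<in>split3 b. ev L p1 (\<lambda>u. ev L p2 (\<lambda>v. ev L p3 (\<lambda>x. ev L q (\<lambda>y. K' u v (x @ hl # y))))))
      + (\<Sum>(p1, p2)\<in>split2 b. \<Sum>(q1, q2)\<in>split2 q.
           ev L p1 (\<lambda>u. ev L p2 (\<lambda>v. ev L q1 (\<lambda>x. ev L q2 (\<lambda>y. K' u (v @ hl # x) y)))))
      + (\<Sum>(q1, q2, q3)\<in>split3 q. ev L b (\<lambda>u. ev L q1 (\<lambda>v. ev L q2 (\<lambda>x. ev L q3 (\<lambda>y. K' (u @ hl # v) x y))))))"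
proof -
  have biq: "b @ i # q \<in> S" using c c_in_S S_factor[of a "b @ i # q" d] by simp
  then have "b \<in> S0" "i # q \<in> S0" using S0_append[of b "i # q"] by (auto simp: S0_def)
  then have bq: "b \<in> S0" "q \<in> S0" using S0_Cons by blast+
  have "ev L b (\<lambda>u. ev L q (\<lambda>v. ins m (\<lambda>w. I w (X (d @ n # a))) (u @ hl # v)))
    = ev L b (\<lambda>u. ev L q (\<lambda>v. \<Sum>(w1, w2, w3)\<in>split3 (u @ hl # v). K' w1 w2 w3))"
  proof (intro ev_cong refl)
    fix us vs assume us: "us \<in> cuts b" and vs: "vs \<in> cuts q"
    have wt: "wt (map L us @ hl # map L vs) + (0, 1) = T (b @ i # q)" by (rule wt_gauge[OF us vs])
    then have fst: "fst (wt (map L us @ hl # map L vs)) = fst (T (b @ i # q))"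
      by (metis add.right_neutral fst_add fst_conv)
    show "ins m (\<lambda>w. I w (X (d @ n # a))) (map L us @ hl # map L vs)
      = (\<Sum>(w1, w2, w3)\<in>split3 (map L us @ hl # map L vs). K' w1 w2 w3)"
      unfolding K'_def
    proof (rule ins_I)
      show "adm (map L us @ hl # map L vs)" using us vs bq h_closed by (simp add: adm_L)
      show "fst (wt (map L us @ hl # map L vs)) \<le> 1" unfolding fst using T_c c[symmetric] by simp
      show "X (d @ n # a) \<in> G (T (d @ n # a))" if "fst (wt (map L us @ hl # map L vs)) = 1"
        using rest_in_S[OF c] that unfolding fst by (intro X_closed)
      have "wt (map L us @ hl # map L vs) + (0, 1) + T (d @ n # a) = D"
        unfolding wt using T_c_n c[symmetric] by (simp add: add_ac)
      then show "wt (map L us @ hl # map L vs) + T (d @ n # a) + (0, 1) = D" by (simp add: add_ac)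
    qed
  qed
  also have "\<dots> =
      ev L b (\<lambda>u. ev L q (\<lambda>v. \<Sum>(p1, p2, p3)\<in>split3 u. K' p1 p2 (p3 @ hl # v)))
    + ev L b (\<lambda>u. ev L q (\<lambda>v. \<Sum>(p1, p2)\<in>split2 u. \<Sum>(q1, q2)\<in>split2 v. K' p1 (p2 @ hl # q1) q2))
    + ev L b (\<lambda>u. ev L q (\<lambda>v. \<Sum>(q1, q2, q3)\<in>split3 v. K' (u @ hl # q1) q2 q3))"
    unfolding sum_split3_pivot ev_add ..
  also have "ev L b (\<lambda>u. ev L q (\<lambda>v. \<Sum>(p1, p2, p3)\<in>split3 u. K' p1 p2 (p3 @ hl # v)))
    = (\<Sum>(p1, p2, p3)\<in>split3 b. ev L p1 (\<lambda>u. ev L p2 (\<lambda>v. ev L p3 (\<lambda>x. ev L q (\<lambda>y. K' u v (x @ hl # y))))))"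
    by (simp only: ev_sum3 ev_split3)
  also have "ev L b (\<lambda>u. ev L q (\<lambda>v. \<Sum>(p1, p2)\<in>split2 u. \<Sum>(q1, q2)\<in>split2 v. K' p1 (p2 @ hl # q1) q2))
    = (\<Sum>(p1, p2)\<in>split2 b. \<Sum>(q1, q2)\<in>split2 q.
           ev L p1 (\<lambda>u. ev L p2 (\<lambda>v. ev L q1 (\<lambda>x. ev L q2 (\<lambda>y. K' u (v @ hl # x) y)))))"
    by (simp only: ev_sum2 ev_split2)
  also have "ev L b (\<lambda>u. ev L q (\<lambda>v. \<Sum>(q1, q2, q3)\<in>split3 v. K' (u @ hl # q1) q2 q3))
    = (\<Sum>(q1, q2, q3)\<in>split3 q. ev L b (\<lambda>u. ev L q1 (\<lambda>v. ev L q2 (\<lambda>x. ev L q3 (\<lambda>y. K' (u @ hl # v) x y)))))"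
    by (simp only: ev_split3 ev_sum3)
  finally show ?thesis by (simp add: evh_def)
qed

text \<open>If \<open>i\<close> lies in \<open>c3\<close> (\<open>A\<close>) or in \<open>c1\<close>
  (\<open>C\<close>), the second argument of \<open>I\<close> changes; if it lies in
  \<open>c2\<close> (\<open>B\<close>), the first one does. Closedness turns \<open>B\<close> into
  terms with an operation in the second argument, where \<open>h\<close> stands before the block of
  \<open>n\<close> (\<open>B1\<close>) or after it (\<open>B3\<close>), or stays in the first
  argument (\<open>B2\<close>). \<open>B1\<close> cancels \<open>A\<close>, \<open>B3\<close>
  cancels \<open>C\<close>, and \<open>B2\<close> vanishes by the Maurer-Cartan equation on the
  complement.\<close>

lemma pairval_Y_inner:
  assumes c: "c = ca @ i # cb"
  shows "pairval I \<tau> Y c n = pairval I \<tau> X c n"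
proof -
  have ni: "i \<notin> set ca" "i \<notin> set cb" using S_distinct[OF c_in_S] c by auto
  have in': "i \<noteq> n" using n_notin c by auto
  let ?s = "\<lambda>c1 c2 c3. sdegT c1 * (sdegT c2 + sdegT c3 + snd (\<tau> n))"
  let ?F = "\<lambda>X c1 c2 c3. ksign (?s c1 c2 c3) (ev (blk \<tau> X) c2 (\<lambda>w. I w (X (c3 @ n # c1))))"
  let ?KK = "\<lambda>a d. K (T (d @ n # a)) (X (d @ n # a))"
  define A where "A = (\<Sum>(p1, p2, p3)\<in>split3 ca. ksign (?s p1 p2 (p3 @ i # cb))
      (ev L p2 (\<lambda>w. I w (gauge m ((p3 @ i # cb) @ n # p1)))))"
  define B where "B = (\<Sum>(a, b)\<in>split2 ca. \<Sum>(q, d)\<in>split2 cb. ksign (?s a (b @ i # q) d)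
      (evh (ins m (\<lambda>w. I w (X (d @ n # a)))) b q))"
  define C where "C = (\<Sum>(q1, q2, q3)\<in>split3 cb. ksign (?s (ca @ i # q1) q2 q3)
      (ev L q2 (\<lambda>w. I w (gauge m (q3 @ n # ca @ i # q1)))))"
  define B1 where "B1 = (\<Sum>(a, b)\<in>split2 ca. \<Sum>(q, d)\<in>split2 cb. ksign (?s a (b @ i # q) d + sdegT b)
      (\<Sum>(p1, p2, p3)\<in>split3 b. ev L p1 (\<lambda>u. ev L p2 (\<lambda>v. ev L p3 (\<lambda>x. ev L q (\<lambda>y. ?KK a d u v (x @ hl # y)))))))"
  define B2 where "B2 = (\<Sum>(a, b)\<in>split2 ca. \<Sum>(q, d)\<in>split2 cb. ksign (?s a (b @ i # q) d + sdegT b)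
      (\<Sum>(p1, p2)\<in>split2 b. \<Sum>(q1, q2)\<in>split2 q.
           ev L p1 (\<lambda>u. ev L p2 (\<lambda>v. ev L q1 (\<lambda>x. ev L q2 (\<lambda>y. ?KK a d u (v @ hl # x) y))))))"
  define B3 where "B3 = (\<Sum>(a, b)\<in>split2 ca. \<Sum>(q, d)\<in>split2 cb. ksign (?s a (b @ i # q) d + sdegT b)
      (\<Sum>(q1, q2, q3)\<in>split3 q. ev L b (\<lambda>u. ev L q1 (\<lambda>v. ev L q2 (\<lambda>x. ev L q3 (\<lambda>y. ?KK a d (u @ hl # v) x y))))))"
  have B: "B = B1 + B2 + B3"
    unfolding B_def B1_def B2_def B3_def sum2_add[symmetric] ksign_add[symmetric]
  proof (intro sum2_cong, goal_cases)
    case (1 a b q d)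
    then have "a @ (b @ i # q) @ d = c" by (auto simp: c split2_def)
    then show ?case by (simp only: evh_ins_I ksign_ksign)
  qed
  \<comment> \<open>To compare the two, the gauge term in \<open>A\<close> is expanded at its block
    \<open>d @ n # a\<close> containing \<open>n\<close>; in \<open>B1\<close> the entry over this
    block is the vector to which closedness was applied.\<close>
  have AB: "A + B1 = 0"
  proof -
    let ?G = "\<lambda>p2 p3 q a d p1. ev L p2 (\<lambda>w. ev L p3 (\<lambda>u. ev L q (\<lambda>x. ev L p1 (\<lambda>y.
        I w (m (u @ hl # x @ L (d @ n # a) # y))))))"
    have "A = (\<Sum>(e, p2, p3)\<in>split3 ca. \<Sum>(q, d)\<in>split2 cb. \<Sum>(a, p1)\<in>split2 e.
        ksign (?s e p2 (p3 @ i # cb) + sdegT p3) (?G p2 p3 q a d p1))"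
      unfolding A_def
    proof (rule sum3_cong, goal_cases)
      case (1 e p2 p3)
      then have "ev L p2 (\<lambda>w. I w (gauge m ((p3 @ i # cb) @ n # e)))
        = ksign (sdegT p3) (ev L p2 (\<lambda>w. ev L p3 (\<lambda>u. ev L (cb @ n # e) (\<lambda>v. I w (m (u @ hl # v))))))"
        using ni by (intro ev_I_gauge) (auto simp: split3_def c)
      then show ?case by (simp only: ev_pivot ev_sum2 ksign_sum2 ksign_ksign append_Cons append_assoc)
    qed
    moreover have "B1 = (\<Sum>(e, p2, p3)\<in>split3 ca. \<Sum>(q, d)\<in>split2 cb. \<Sum>(a, p1)\<in>split2 e.
        - ksign (?s e p2 (p3 @ i # cb) + sdegT p3) (?G p2 p3 q a d p1))"
    proof -
      let ?H = "\<lambda>a p1 p2 p3 q d. - ksign (?s (a @ p1) p2 (p3 @ i # cb) + sdegT p3) (?G p2 p3 q a d p1)"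
      have "B1 = (\<Sum>(a, b)\<in>split2 ca. \<Sum>(q, d)\<in>split2 cb. \<Sum>(p1, p2, p3)\<in>split3 b.
          ?H a p1 p2 p3 q d)"
        unfolding B1_def ksign_sum3
      proof (rule sum2_cong, rule sum2_cong, rule sum3_cong, goal_cases)
        case (1 a b q d p1 p2 p3)
        then have bq: "b = p1 @ p2 @ p3" "cb = q @ d" by (auto simp: split2_def split3_def)
        let ?e = "1 + sdegT p1 * (sdegT p2 + (sdegT p3 + (snd (\<tau> i) - 1) + sdegT q) + sdegT (d @ n # a)) + sdegT p2"
        have "ev L p1 (\<lambda>u. ev L p2 (\<lambda>v. ev L p3 (\<lambda>x. ev L q (\<lambda>y. ?KK a d u v (x @ hl # y)))))
          = ev L p1 (\<lambda>u. ev L p2 (\<lambda>v. ev L p3 (\<lambda>x. ev L q (\<lambda>y.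
            ksign (?e)
              (I v (m (x @ hl # y @ L (d @ n # a) # u)))))))"
          by (intro ev_cong refl) (simp add: wt_blk K_def blk_def add_ac)
        also have "\<dots> = ksign (?e)
            (?G p2 p3 q a d p1)"
          by (simp only: ev_ksign ev_swap[of L p1])
        finally show ?case unfolding bq
          by (simp only: ksign_ksign) (rule ksign_cong_minus, auto)
      qed
      also have "\<dots> = (\<Sum>(q, d)\<in>split2 cb. \<Sum>(a, b)\<in>split2 ca. \<Sum>(p1, p2, p3)\<in>split3 b.
          ?H a p1 p2 p3 q d)"
        by (rule sum_split2_swap)
      also have "\<dots> = (\<Sum>(q, d)\<in>split2 cb. \<Sum>(e, p2, p3)\<in>split3 ca. \<Sum>(a, p1)\<in>split2 e.
          ?H a p1 p2 p3 q d)"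
        unfolding sum_split3_right ..
      also have "\<dots> = (\<Sum>(e, p2, p3)\<in>split3 ca. \<Sum>(q, d)\<in>split2 cb. \<Sum>(a, p1)\<in>split2 e.
          ?H a p1 p2 p3 q d)"
        unfolding case_prod_unfold by (rule sum.swap)
      also have "\<dots> = (\<Sum>(e, p2, p3)\<in>split3 ca. \<Sum>(q, d)\<in>split2 cb. \<Sum>(a, p1)\<in>split2 e.
          - ksign (?s e p2 (p3 @ i # cb) + sdegT p3) (?G p2 p3 q a d p1))"
        by (rule sum3_cong, rule sum2_cong, rule sum2_cong) (auto simp: split2_def)
      finally show ?thesis .
    qed
    ultimately show ?thesis by (simp only: sum2_minus sum3_minus) simp
  qed
  \<comment> \<open>The mirror image: now \<open>h\<close> follows the block of \<open>n\<close>, so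
    the gauge sign in \<open>C\<close> also counts \<open>f @ n # ca\<close>.\<close>
  have CB: "C + B3 = 0"
  proof -
    let ?G = "\<lambda>q1 q2 q3 d a b. ev L q2 (\<lambda>w. ev L q3 (\<lambda>x. ev L b (\<lambda>y. ev L q1 (\<lambda>v.
        I w (m (x @ L (d @ n # a) # y @ hl # v))))))"
    have "C = (\<Sum>(q1, q2, f)\<in>split3 cb. \<Sum>(q3, d)\<in>split2 f. \<Sum>(a, b)\<in>split2 ca.
        ksign (?s (ca @ i # q1) q2 f + sdegT (f @ n # ca)) (?G q1 q2 q3 d a b))"
      unfolding C_def
    proof (rule sum3_cong, goal_cases)
      case (1 q1 q2 f)
      then have "ev L q2 (\<lambda>w. I w (gauge m (f @ n # ca @ i # q1)))
        = ksign (sdegT (f @ n # ca)) (ev L q2 (\<lambda>w. ev L (f @ n # ca) (\<lambda>u. ev L q1 (\<lambda>v. I w (m (u @ hl # v))))))"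
        using ni in' ev_I_gauge[of "ca @ i # q1" q2 f "f @ n # ca" q1] by (auto simp: split3_def c)
      then show ?case by (simp only: ev_pivot ev_sum2 ksign_sum2 ksign_ksign append_Cons append_assoc)
    qed
    moreover have "B3 = (\<Sum>(q1, q2, f)\<in>split3 cb. \<Sum>(q3, d)\<in>split2 f. \<Sum>(a, b)\<in>split2 ca.
        - ksign (?s (ca @ i # q1) q2 f + sdegT (f @ n # ca)) (?G q1 q2 q3 d a b))"
    proof -
      let ?H = "\<lambda>a b q1 q2 q3 d. - ksign (?s (ca @ i # q1) q2 (q3 @ d) + sdegT ((q3 @ d) @ n # ca)) (?G q1 q2 q3 d a b)"
      have "B3 = (\<Sum>(a, b)\<in>split2 ca. \<Sum>(q, d)\<in>split2 cb. \<Sum>(q1, q2, q3)\<in>split3 q.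
          ?H a b q1 q2 q3 d)"
        unfolding B3_def ksign_sum3
      proof (rule sum2_cong, rule sum2_cong, rule sum3_cong, goal_cases)
        case (1 a b q d q1 q2 q3)
        then have bq: "q = q1 @ q2 @ q3" "ca = a @ b" by (auto simp: split2_def split3_def)
        let ?e = "1 + (sdegT b + (snd (\<tau> i) - 1) + sdegT q1) * (sdegT q2 + sdegT q3 + sdegT (d @ n # a)) + sdegT q2"
        have "ev L b (\<lambda>u. ev L q1 (\<lambda>v. ev L q2 (\<lambda>x. ev L q3 (\<lambda>y. ?KK a d (u @ hl # v) x y))))
          = ev L b (\<lambda>u. ev L q1 (\<lambda>v. ev L q2 (\<lambda>x. ev L q3 (\<lambda>y.
            ksign (?e)
              (I x (m (y @ L (d @ n # a) # u @ hl # v)))))))"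
          by (intro ev_cong refl) (simp add: wt_blk K_def blk_def add_ac)
        also have "\<dots> = ksign (?e)
            (ev L q1 (\<lambda>v. ev L q2 (\<lambda>x. ev L q3 (\<lambda>y. ev L b (\<lambda>u. I x (m (y @ L (d @ n # a) # u @ hl # v)))))))"
          by (simp only: ev_ksign ev_swap[of L b])
        also have "\<dots> = ksign (?e)
            (?G q1 q2 q3 d a b)"
          by (simp only: ev_swap[of L q1])
        finally show ?case unfolding bq
          by (simp only: ksign_ksign) (rule ksign_cong_minus, auto)
      qed
      also have "\<dots> = (\<Sum>(a, b)\<in>split2 ca. \<Sum>(q1, q2, f)\<in>split3 cb. \<Sum>(q3, d)\<in>split2 f.
          ?H a b q1 q2 q3 d)"
        unfolding sum_split3_left ..
      also have "\<dots> = (\<Sum>(q1, q2, f)\<in>split3 cb. \<Sum>(a, b)\<in>split2 ca. \<Sum>(q3, d)\<in>split2 f.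
          ?H a b q1 q2 q3 d)"
        unfolding case_prod_unfold by (rule sum.swap)
      also have "\<dots> = (\<Sum>(q1, q2, f)\<in>split3 cb. \<Sum>(q3, d)\<in>split2 f. \<Sum>(a, b)\<in>split2 ca.
          ?H a b q1 q2 q3 d)"
        by (rule sum3_cong, rule sum_split2_swap)
      also have "\<dots> = (\<Sum>(q1, q2, f)\<in>split3 cb. \<Sum>(q3, d)\<in>split2 f. \<Sum>(a, b)\<in>split2 ca.
          - ksign (?s (ca @ i # q1) q2 f + sdegT (f @ n # ca)) (?G q1 q2 q3 d a b))"
        by (rule sum3_cong, rule sum2_cong, rule sum2_cong) (auto simp: split2_def)
      finally show ?thesis .
    qed
    ultimately show ?thesis by (simp only: sum2_minus sum3_minus) simp
  qed
  have B2: "B2 = 0"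
  proof -
    let ?G = "\<lambda>p2 q1 q2 p1 a d. ev L p2 (\<lambda>v. ev L q1 (\<lambda>x. ev L q2 (\<lambda>y. ev L p1 (\<lambda>u.
        I (v @ hl # x) (m (y @ L (d @ n # a) # u))))))"
    let ?t = "\<lambda>e p2 q1 f. sdegT e * (sdegT p2 + snd (\<tau> i) + sdegT q1 + sdegT f + snd (\<tau> n)) + snd (\<tau> i) + sdegT q1"
    let ?H = "\<lambda>a p1 p2 q1 q2 d. ksign (?t (a @ p1) p2 q1 (q2 @ d)) (?G p2 q1 q2 p1 a d)"
    have "B2 = (\<Sum>(a, b)\<in>split2 ca. \<Sum>(q, d)\<in>split2 cb. \<Sum>(p1, p2)\<in>split2 b. \<Sum>(q1, q2)\<in>split2 q.
        ?H a p1 p2 q1 q2 d)"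
      unfolding B2_def ksign_sum2
    proof (intro sum2_cong, goal_cases)
      case (1 a b q d p1 p2 q1 q2)
      then have bq: "q = q1 @ q2" "b = p1 @ p2" by (auto simp: split2_def)
      have "ev L p1 (\<lambda>u. ev L p2 (\<lambda>v. ev L q1 (\<lambda>x. ev L q2 (\<lambda>y. ?KK a d u (v @ hl # x) y))))
        = ev L p1 (\<lambda>u. ev L p2 (\<lambda>v. ev L q1 (\<lambda>x. ev L q2 (\<lambda>y.
          ksign (1 + sdegT p1 * ((sdegT p2 + (snd (\<tau> i) - 1) + sdegT q1) + sdegT q2 + sdegT (d @ n # a))
              + (sdegT p2 + (snd (\<tau> i) - 1) + sdegT q1))
            (I (v @ hl # x) (m (y @ L (d @ n # a) # u)))))))"
        by (intro ev_cong refl) (simp add: wt_blk K_def blk_def add_ac)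
      also have "\<dots> = ksign (1 + sdegT p1 * ((sdegT p2 + (snd (\<tau> i) - 1) + sdegT q1) + sdegT q2 + sdegT (d @ n # a))
              + (sdegT p2 + (snd (\<tau> i) - 1) + sdegT q1)) (?G p2 q1 q2 p1 a d)"
        by (simp only: ev_ksign ev_swap[of L p1])
      finally show ?case unfolding bq
        by (simp only: ksign_ksign) (rule ksign_cong, auto)
    qed
    also have "\<dots> = (\<Sum>(a, b)\<in>split2 ca. \<Sum>(p1, p2)\<in>split2 b. \<Sum>(q, d)\<in>split2 cb. \<Sum>(q1, q2)\<in>split2 q.
        ?H a p1 p2 q1 q2 d)"
      by (rule sum2_cong, rule sum_split2_swap)
    also have "\<dots> = (\<Sum>(e, p2)\<in>split2 ca. \<Sum>(a, p1)\<in>split2 e. \<Sum>(q1, f)\<in>split2 cb. \<Sum>(q2, d)\<in>split2 f.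
        ?H a p1 p2 q1 q2 d)"
      unfolding sum_split2_assoc[where xs = cb] sum_split2_assoc[where xs = ca, symmetric] ..
    also have "\<dots> = (\<Sum>(e, p2)\<in>split2 ca. \<Sum>(q1, f)\<in>split2 cb. \<Sum>(q2, d)\<in>split2 f. \<Sum>(a, p1)\<in>split2 e.
        ?H a p1 p2 q1 q2 d)"
      by (rule sum2_cong, rule trans[OF sum_split2_swap], rule sum2_cong, rule sum_split2_swap)
    also have "\<dots> = (\<Sum>(e, p2)\<in>split2 ca. \<Sum>(q1, f)\<in>split2 cb. 0)"
    proof (intro sum2_cong, goal_cases)
      case (1 e p2 q1 f)
      then have eq: "e @ (p2 @ i # q1) @ f = c" by (auto simp: c split2_def)
      have S0: "p2 \<in> S0" "q1 \<in> S0"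
        using S0_factor[of e "p2 @ i # q1" f] S0_append[of p2 "i # q1"] S0_Cons[of i q1] c_in_S0 eq by auto
      have "(\<Sum>(q2, d)\<in>split2 f. \<Sum>(a, p1)\<in>split2 e. ?H a p1 p2 q1 q2 d)
        = ksign (?t e p2 q1 f) (\<Sum>(q2, d)\<in>split2 f. \<Sum>(a, p1)\<in>split2 e. ?G p2 q1 q2 p1 a d)"
        unfolding ksign_sum2 by (intro sum2_cong) (auto simp: split2_def)
      \<comment> \<open>For a fixed first argument, the remaining splittings and cuts make up all
        cuts of the complement \<open>f @ n # e\<close>, by the position of the block of
        \<open>n\<close>. Hence \<open>m\<close> is evaluated on a whole interval of
        \<open>S\<close>.\<close>
      also have "(\<Sum>(q2, d)\<in>split2 f. \<Sum>(a, p1)\<in>split2 e. ?G p2 q1 q2 p1 a d)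
        = ev L p2 (\<lambda>v. ev L q1 (\<lambda>x. ev L (f @ n # e) (\<lambda>w. I (v @ hl # x) (m w))))"
        unfolding ev_pivot ev_sum2 ..
      also have "\<dots> = ev L p2 (\<lambda>v. ev L q1 (\<lambda>x. 0))"
      proof (intro ev_cong refl)
        fix us vs assume us: "us \<in> cuts p2" and vs: "vs \<in> cuts q1"
        let ?w = "map L us @ hl # map L vs"
        have wt: "wt ?w + (0, 1) = T (p2 @ i # q1)" by (rule wt_gauge[OF us vs])
        then have fst: "fst (wt ?w) = fst (T (p2 @ i # q1))"
          by (metis add.right_neutral fst_add fst_conv)
        show "ev L (f @ n # e) (\<lambda>w. I ?w (m w)) = 0"
        proof (cases "fst (wt ?w) = 1")
          case True
          then have R: "f @ n # e \<in> S" using rest_in_S[OF eq] fst by simp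
          have "wt ?w + (0, 1) + T (f @ n # e) = D"
            unfolding wt using T_c_n eq by (auto simp: add_ac)
          then have add: "additive_on (G (T (f @ n # e) + (0, 1))) (I ?w)"
            using us vs S0 h_closed by (intro I_additive) (auto simp: adm_L add_ac)
          then have "I ?w (ev L (f @ n # e) m) = ev L (f @ n # e) (\<lambda>w. I ?w (m w))"
            by (rule additive_on_ev) (rule m_L_closed[OF R])
          with additive_on_0[OF add] show ?thesis by (simp add: mc[OF R])
        next
          case False
          then show ?thesis by (simp add: I_eq_0)
        qed
      qed
      finally show ?case by simp
    qed
    finally show ?thesis by (simp add: case_prod_unfold)
  qed
  have "pairval I \<tau> Y c n = pairval I \<tau> X c n + A + B + C"
  proof -
    have "(\<Sum>(p1, p2, p3)\<in>split3 ca. ?F Y p1 p2 (p3 @ i # cb)) = (\<Sum>(p1, p2, p3)\<in>split3 ca. ?F X p1 p2 (p3 @ i # cb)) + A"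
      unfolding A_def sum3_add[symmetric] ksign_add[symmetric] using ni
      by (intro sum3_cong, subst ev_I_Y) (auto simp: split3_def c)
    moreover have "(\<Sum>(q1, q2, q3)\<in>split3 cb. ?F Y (ca @ i # q1) q2 q3)
        = (\<Sum>(q1, q2, q3)\<in>split3 cb. ?F X (ca @ i # q1) q2 q3) + C"
      unfolding C_def sum3_add[symmetric] ksign_add[symmetric] using ni
      by (intro sum3_cong, subst ev_I_Y) (auto simp: split3_def c)
    moreover have "(\<Sum>(a, b)\<in>split2 ca. \<Sum>(q, d)\<in>split2 cb. ?F Y a (b @ i # q) d)
        = (\<Sum>(a, b)\<in>split2 ca. \<Sum>(q, d)\<in>split2 cb. ?F X a (b @ i # q) d) + B"
      unfolding B_def sum2_add[symmetric] ksign_add[symmetric]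
    proof (intro sum2_cong arg_cong[where f = "ksign _"], goal_cases)
      case (1 a b q d)
      then have *: "a @ (b @ i # q) @ d = c" "i \<notin> set (d @ n # a)" "i \<notin> set b"
        using ni in' by (auto simp: c split2_def)
      then have "b @ i # q \<in> S0" using c_in_S0 S0_factor by blast
      from ev_Y_eq[OF I_multiadditive this] show ?case
        using *(2,3) by (simp add: Y_def)
    qed
    ultimately show ?thesis unfolding pairval_def c sum_split3_pivot by (simp add: ac_simps)
  qed
  also have "\<dots> = pairval I \<tau> X c n + (A + B1) + (C + B3) + B2"
    by (simp only: B add_ac)
  finally show ?thesis by (simp only: AB CB B2 add_0_right)
qed

theorem pairval_Y: "i \<in> set c \<or> i = n \<Longrightarrow> pairval I \<tau> Y c n = pairval I \<tau> X c n"
  using pairval_Y_last pairval_Y_inner by (meson split_list)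

end

section \<open>The square-zero extension of an algebra by a module\<close>

text \<open>Words in the direct sum of an algebra and a module; a tag with two or more module entries
  only admits the value \<open>0\<close>.\<close>

definition comb :: "('r, 'a::ab_group_add, 'z) graded_module_scheme \<Rightarrow> ('r, 'm::ab_group_add, 'y) graded_module_scheme
    \<Rightarrow> tag \<Rightarrow> ('a \<times> 'm) set" where
  "comb A M t = (if fst t = 0 then gr A (snd t + 1) \<times> {0}
     else if fst t = 1 then {0} \<times> gr M (snd t + 1) else {0})"

definition toA :: "('a \<times> 'm) letter \<Rightarrow> 'a elem" where
  "toA x = (snd (fst x) + 1, fst (snd x))"

definition toM :: "('a \<times> 'm) letter \<Rightarrow> 'm elem" where
  "toM x = (snd (fst x) + 1, snd (snd x))"

lemma sdeg_toA [simp]: "sdeg (toA x) = snd (fst x)" and sdeg_toM [simp]: "sdeg (toM x) = snd (fst x)"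
  by (simp_all add: sdeg_def toA_def toM_def)

lemma sdegs_simps [simp]: "sdegs [] = 0" "sdegs (x # xs) = sdeg x + sdegs xs" "sdegs (xs @ ys) = sdegs xs + sdegs ys"
  by (simp_all add: sdegs_def)

lemma sdegs_map_toA [simp]: "sdegs (map toA w) = snd (wt w)"
  by (induction w) auto

lemma fst_wt_eq_0_iff: "fst (wt w) = 0 \<longleftrightarrow> (\<forall>x\<in>set w. fst (fst x) = 0)"
  by (induction w) auto

lemma fst_wt_eq_1E:
  assumes "fst (wt w) = 1"
  obtains ls x rs where "w = ls @ x # rs" "fst (wt ls) = 0" "fst (fst x) = 1" "fst (wt rs) = 0"
proof -
  have "\<exists>ls x rs. w = ls @ x # rs \<and> fst (wt ls) = 0 \<and> fst (fst x) = 1 \<and> fst (wt rs) = 0"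
    using assms
  proof (induction w)
    case (Cons y w)
    show ?case
    proof (cases "fst (fst y) = 0")
      case True
      with Cons obtain ls x rs where "w = ls @ x # rs" "fst (wt ls) = 0" "fst (fst x) = 1" "fst (wt rs) = 0"
        by auto
      with True show ?thesis by (intro exI[of _ "y # ls"] exI[of _ x] exI[of _ rs]) auto
    next
      case False
      with Cons.prems show ?thesis by (intro exI[of _ "[]"] exI[of _ y] exI[of _ w]) auto
    qed
  qed simp
  with that show thesis by blast
qed

text \<open>The first letter with a module entry becomes the module argument. This is meaningful for
  words with a single such entry, the only ones to which it is applied in earnest.\<close>

definition modw :: "('a, 'm, 'w) mod_maps \<Rightarrow> ('a \<times> 'm) letter list \<Rightarrow> 'w" where
  "modw F w = (let rs = dropWhile (\<lambda>x. fst (fst x) = 0) w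
     in F (map toA (takeWhile (\<lambda>x. fst (fst x) = 0) w)) (toM (hd rs)) (map toA (tl rs)))"

lemma modw_append: "fst (wt ls) = 0 \<Longrightarrow> fst (fst x) = 1 \<Longrightarrow>
    modw F (ls @ x # rs) = F (map toA ls) (toM x) (map toA rs)"
  by (simp add: modw_def fst_wt_eq_0_iff takeWhile_append dropWhile_append Let_def)

definition joint :: "('a, 'b::ab_group_add) alg_maps \<Rightarrow> ('a, 'm, 'n::ab_group_add) mod_maps
    \<Rightarrow> ('a \<times> 'm) letter list \<Rightarrow> 'b \<times> 'n" where
  "joint f F w = (if fst (wt w) = 0 then (sh_alg f (map toA w), 0)
     else if fst (wt w) = 1 then (0, modw (sh_mod F) w) else 0)"

lemma joint_alg: "fst (wt w) = 0 \<Longrightarrow> joint f F w = (sh_alg f (map toA w), 0)"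
  by (simp add: joint_def)

lemma joint_mod: "fst (wt ls) = 0 \<Longrightarrow> fst (fst x) = 1 \<Longrightarrow> fst (wt rs) = 0 \<Longrightarrow>
    joint f F (ls @ x # rs) = (0, sh_mod F (map toA ls) (toM x) (map toA rs))"
  by (simp add: joint_def modw_append)

definition ell :: "int \<Rightarrow> (('a \<times> 'm) letter list \<Rightarrow> 'b \<times> 'n) \<Rightarrow> ('a \<times> 'm) letter list \<Rightarrow> ('b \<times> 'n) letter" where
  "ell e \<phi> w = (wt w + (0, e), \<phi> w)"

lemma fst_ell [simp]: "fst (ell e \<phi> w) = wt w + (0, e)"
  by (simp add: ell_def)

lemma toA_ell: "fst (wt w) = 0 \<Longrightarrow> toA (ell e (joint f F) w) = el_alg e f (map toA w)"
  by (simp add: ell_def toA_def el_alg_def joint_alg)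

lemma toM_ell: "fst (wt ls) = 0 \<Longrightarrow> fst (fst x) = 1 \<Longrightarrow> fst (wt rs) = 0 \<Longrightarrow>
    toM (ell e (joint f F) (ls @ x # rs)) = el_mod e F (map toA ls) (toM x) (map toA rs)"
  by (simp add: ell_def toM_def el_mod_def joint_mod add_ac sdeg_def)

lemma insert_mu_split3:
  "insert_mu A \<phi> xs = (\<Sum>(u, v, w)\<in>split3 xs. ksign (sdegs u) (\<phi> (u @ el_alg 1 (mu A) v # w)))"
  by (simp add: insert_mu_def sum_split3_conv)

text \<open>\<open>comp_beta\<close> with an arbitrary outer family in place of a shifted one, so
  that it also applies to families of functionals evaluated at a fixed vector.\<close>

definition comp_gen ::
  "('r, 'a::ab_group_add, 'z) ainf_algebra_scheme \<Rightarrow> ('r, 'a, 'm::ab_group_add, 'y) ainf_module_scheme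
     \<Rightarrow> ('a, 'm, 'w::ab_group_add) mod_maps \<Rightarrow> ('a, 'm, 'w) mod_maps" where
  "comp_gen A M \<gamma> as m bs =
     insert_mu A (\<lambda>as'. \<gamma> as' m bs) as
   + (\<Sum>(as1, as2)\<in>split2 as. \<Sum>(bs1, bs2)\<in>split2 bs.
        ksign (sdegs as1) (\<gamma> as1 (el_mod 1 (beta M) as2 m bs1) bs2))
   + ksign (sdegs as + sdeg m) (insert_mu A (\<lambda>bs'. \<gamma> as m bs') bs)"

lemma comp_beta_conv: "comp_beta A M F = comp_gen A M (sh_mod F)"
  by (intro HOL.ext) (simp add: comp_beta_def comp_gen_def sum_split2_conv)

lemma ins_alg:
  assumes "fst (wt w) = 0" "\<And>w. fst (wt w) = 0 \<Longrightarrow> \<phi> w = \<alpha> (map toA w)"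
  shows "ins (joint (mu A) F) \<phi> w = insert_mu A \<alpha> (map toA w)"
  unfolding insert_mu_split3 ins_def sum_split3_map
proof (rule sum3_cong, goal_cases)
  case (1 u v x)
  then have 0: "fst (wt u) = 0" "fst (wt v) = 0" "fst (wt x) = 0" using assms(1) by (auto simp: split3_def)
  have "\<phi> (u @ ell 1 (joint (mu A) F) v # x) = \<alpha> (map toA u @ el_alg 1 (mu A) (map toA v) # map toA x)"
    using 0 by (subst assms(2)) (auto simp: toA_ell)
  then show ?case by (simp add: ell_def)
qed

text \<open>The inserted operation lies before the module letter, contains it, or lies after it.
  These are the three sums of the module relation, the last with the additional sign for passing the
  module letter.\<close>

lemma ins_mod:
  assumes w: "fst (wt ls) = 0" "fst (fst x) = 1" "fst (wt rs) = 0"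
    and \<phi>: "\<And>w. fst (wt w) = 1 \<Longrightarrow> \<phi> w = modw \<gamma> w"
  shows "ins (joint (mu A) (beta M)) \<phi> (ls @ x # rs) = comp_gen A M \<gamma> (map toA ls) (toM x) (map toA rs)"
  unfolding insert_mu_split3 ins_def sum_split3_map comp_gen_def sum_split3_pivot sum_split2_map ksign_sum3
proof (intro arg_cong2[where f = "(+)"], goal_cases)
  case 1
  show ?case
  proof (rule sum3_cong, goal_cases)
    case (1 u v y)
    then have 0: "fst (wt u) = 0" "fst (wt v) = 0" "fst (wt y) = 0" using w by (auto simp: split3_def)
    have "\<phi> ((u @ ell 1 (joint (mu A) (beta M)) v # y) @ x # rs)
      = \<gamma> (map toA u @ el_alg 1 (mu A) (map toA v) # map toA y) (toM x) (map toA rs)"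
      using 0 w by (subst \<phi>, simp, subst modw_append) (auto simp: toA_ell)
    then show ?case by (simp add: ell_def)
  qed
next
  case 2
  show ?case
  proof (rule sum2_cong, rule sum2_cong, goal_cases)
    case (1 a b c d)
    then have 0: "fst (wt a) = 0" "fst (wt b) = 0" "fst (wt c) = 0" "fst (wt d) = 0"
      using w by (auto simp: split2_def)
    have "\<phi> (a @ ell 1 (joint (mu A) (beta M)) (b @ x # c) # d)
      = \<gamma> (map toA a) (el_mod 1 (beta M) (map toA b) (toM x) (map toA c)) (map toA d)"
      using 0 w by (subst \<phi>, simp, subst modw_append) (auto simp: toM_ell)
    then show ?case by (simp add: ell_def)
  qed
next
  case 3
  show ?case
  proof (rule sum3_cong, goal_cases)
    case (1 u v y)
    then have 0: "fst (wt u) = 0" "fst (wt v) = 0" "fst (wt y) = 0" using w by (auto simp: split3_def)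
    have "\<phi> (ls @ x # (u @ ell 1 (joint (mu A) (beta M)) v # y))
      = \<gamma> (map toA ls) (toM x) (map toA u @ el_alg 1 (mu A) (map toA v) # map toA y)"
      using 0 w by (subst \<phi>, simp, subst modw_append) (auto simp: toA_ell)
    then show ?case by (simp add: ell_def add_ac)
  qed
qed

lemma ins_eq_0: "fst (wt w) \<ge> 2 \<Longrightarrow> (\<And>w. fst (wt w) \<ge> 2 \<Longrightarrow> \<phi> w = 0) \<Longrightarrow> ins m \<phi> w = 0"
  unfolding ins_def by (intro sum.neutral) (auto simp: split3_def)

lemma hom_sum:
  fixes p :: "'a::ab_group_add \<Rightarrow> 'b::ab_group_add"
  assumes "\<And>a b. p (a + b) = p a + p b"
  shows "p (sum f S) = (\<Sum>x\<in>S. p (f x))"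
proof -
  have "p 0 = 0" using assms[of 0 0] by simp
  then show ?thesis by (induction S rule: infinite_finite_induct) (simp_all add: assms)
qed

lemma ins_hom:
  assumes "\<And>a b. p (a + b) = p a + p b"
  shows "p (ins m \<phi> w) = ins m (\<lambda>w. p (\<phi> w)) w"
proof -
  have 0: "p 0 = 0" using assms[of 0 0] by simp
  have "p (- a) = - p a" for a using assms[of a "- a"] by (simp add: 0 minus_unique)
  then have "p (ksign e a) = ksign e (p a)" for e a by (simp add: ksign_def)
  then show ?thesis by (simp add: ins_def case_prod_unfold hom_sum[of p] assms)
qed

lemma ins_joint_alg:
  assumes "fst (wt w) = 0"
  shows "ins (joint (mu A) F') (joint f F) w = (insert_mu A (sh_alg f) (map toA w), 0)"
proof (rule prod_eqI)
  show "fst (ins (joint (mu A) F') (joint f F) w) = fst (insert_mu A (sh_alg f) (map toA w), 0)"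
    by (subst ins_hom) (auto simp: joint_alg intro!: ins_alg assms)
  have "snd (ins (joint (mu A) F') (joint f F) w) = insert_mu A (\<lambda>_. 0) (map toA w)"
    by (subst ins_hom) (auto simp: joint_alg intro!: ins_alg assms)
  then show "snd (ins (joint (mu A) F') (joint f F) w) = snd (insert_mu A (sh_alg f) (map toA w), 0)"
    by (simp add: insert_mu_def)
qed

lemma ins_joint_mod:
  assumes w: "fst (wt ls) = 0" "fst (fst x) = 1" "fst (wt rs) = 0"
  shows "ins (joint (mu A) (beta M)) (joint f F) (ls @ x # rs)
    = (0, comp_beta A M F (map toA ls) (toM x) (map toA rs))"
proof (rule prod_eqI)
  show "snd (ins (joint (mu A) (beta M)) (joint f F) (ls @ x # rs))
    = snd (0, comp_beta A M F (map toA ls) (toM x) (map toA rs))"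
    by (subst ins_hom) (auto simp: comp_beta_conv joint_def intro!: ins_mod w)
  have "fst (ins (joint (mu A) (beta M)) (joint f F) (ls @ x # rs))
    = comp_gen A M (\<lambda>_ _ _. 0) (map toA ls) (toM x) (map toA rs)"
    by (subst ins_hom) (auto simp: joint_def modw_def Let_def intro!: ins_mod w)
  then show "fst (ins (joint (mu A) (beta M)) (joint f F) (ls @ x # rs))
    = fst (0, comp_beta A M F (map toA ls) (toM x) (map toA rs))"
    by (simp add: comp_gen_def insert_mu_def case_prod_unfold)
qed

lemma ins_joint_many: "fst (wt w) \<ge> 2 \<Longrightarrow> ins m (joint f F) w = 0"
  by (rule ins_eq_0) (auto simp: joint_def)

lemma push_split2:
  "push f e F \<Gamma> as m bs = (\<Sum>(as1, as2)\<in>split2 as. \<Sum>(bs1, bs2)\<in>split2 bs. \<Sum>ass\<in>cuts as1. \<Sum>bss\<in>cuts bs2.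
     ksign (e * sdegs as1) (sh_mod \<Gamma> (map (el_alg 0 f) ass) (el_mod e F as2 m bs1) (map (el_alg 0 f) bss)))"
  by (simp add: push_def sum_split2_conv)

lemma wt_map_ell: "wt (map (ell 0 \<phi>) cs) = wt (concat cs)"
  by (induction cs) (auto simp flip: zero_prod_def)

lemma map_toA_ell: "fst (wt (concat cs)) = 0 \<Longrightarrow>
    map toA (map (ell 0 (joint f F)) cs) = map (el_alg 0 f) (map (map toA) cs)"
  by (induction cs) (auto simp: toA_ell)

text \<open>Singling out the block with the module letter turns a sum over cuts into
  \<open>push\<close>: this block is fed to \<open>F\<close> and all others to
  \<open>f\<close>.\<close>

lemma sum_cuts_modw:
  assumes w: "fst (wt ls) = 0" "fst (fst x) = 1" "fst (wt rs) = 0"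
    and \<phi>: "\<And>w. fst (wt w) = 1 \<Longrightarrow> \<phi> w = modw (sh_mod \<Gamma>) w"
  shows "(\<Sum>cs\<in>cuts (ls @ x # rs). \<phi> (map (ell 0 (joint f F)) cs))
    = push f 0 F \<Gamma> (map toA ls) (toM x) (map toA rs)"
  unfolding sum_cuts_pivot push_split2 sum_split2_map sum_cuts_map
proof (rule sum2_cong, rule sum2_cong, rule sum.cong[OF refl], rule sum.cong[OF refl], goal_cases)
  case (1 a b c d u v)
  then have 0: "fst (wt a) = 0" "fst (wt b) = 0" "fst (wt c) = 0" "fst (wt d) = 0"
     and cc: "concat u = a" "concat v = d"
    using w by (auto simp: split2_def cuts_def)
  show ?case
    using 0 w cc by (subst \<phi>, simp add: wt_map_ell flip: zero_prod_def, simp, subst modw_append)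
      (auto simp: wt_map_ell toM_ell simp flip: zero_prod_def map_map simp: map_toA_ell simp del: map_map)
qed

section \<open>Degrees and additivity of the combined maps\<close>

lemma graded_module_gr:
  assumes "is_graded_module V"
  shows gr_0: "0 \<in> gr V k" and gr_add: "a \<in> gr V k \<Longrightarrow> b \<in> gr V k \<Longrightarrow> a + b \<in> gr V k"
    and gr_minus: "a \<in> gr V k \<Longrightarrow> - a \<in> gr V k"
    and gr_disjoint: "a \<in> gr V k \<Longrightarrow> a \<in> gr V k' \<Longrightarrow> k \<noteq> k' \<Longrightarrow> a = 0"
proof -
  interpret module "smul V" using assms unfolding is_graded_module_def by (elim conjE)
  have sub: "subspace (gr V k)" for k using assms unfolding is_graded_module_def by (elim conjE) (rule spec)
  show "0 \<in> gr V k" using subspace_0[OF sub] .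
  show "a + b \<in> gr V k" if "a \<in> gr V k" "b \<in> gr V k" using subspace_add[OF sub that] .
  have minus: "- a \<in> gr V k" if "a \<in> gr V k" for k using subspace_neg[OF sub that] .
  then show "- a \<in> gr V k" if "a \<in> gr V k" using that .
  show "a = 0" if a: "a \<in> gr V k" "a \<in> gr V k'" "k \<noteq> k'"
  proof -
    \<comment> \<open>\<open>a\<close> in degree \<open>k\<close> and \<open>- a\<close> in degree
      \<open>k'\<close> sum to zero, so independence of the graded pieces applies.\<close>
    let ?v = "\<lambda>j. if j = k then a else - a"
    have "\<forall>j\<in>{k, k'}. ?v j \<in> gr V j" using a minus[of k'] by simp
    moreover have "(\<Sum>j\<in>{k, k'}. ?v j) = 0" using a(3) by simp
    moreover have "\<forall>S v. finite S \<longrightarrow> (\<forall>k\<in>S. v k \<in> gr V k) \<longrightarrow> (\<Sum>k\<in>S. v k) = 0 \<longrightarrow> (\<forall>k\<in>S. v k = 0)"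
      using assms unfolding is_graded_module_def by (elim conjE)
    from this[THEN spec, of "{k, k'}", THEN spec, of ?v, THEN mp, THEN mp, THEN mp] calculation
    have "\<forall>j\<in>{k, k'}. ?v j = 0" by blast
    then show ?thesis by simp
  qed
qed

lemma gr_ksign: "is_graded_module V \<Longrightarrow> a \<in> gr V k \<Longrightarrow> ksign e a \<in> gr V k"
  by (simp add: ksign_def gr_minus)

lemma graded_groups_comb:
  "is_graded_module A \<Longrightarrow> is_graded_module M \<Longrightarrow> graded_groups (comb A M)"
  by unfold_locales (auto simp: comb_def gr_0 gr_add gr_minus zero_prod_def)

definition adm_word :: "('r, 'a::ab_group_add, 'z) graded_module_scheme \<Rightarrow> ('r, 'm::ab_group_add, 'y) graded_module_scheme
    \<Rightarrow> ('a \<times> 'm) letter list \<Rightarrow> bool" where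
  "adm_word A M w \<longleftrightarrow> (\<forall>x\<in>set w. snd x \<in> comb A M (fst x))"

lemma adm_word_simps [simp]:
  "adm_word A M []" "adm_word A M (x # w) \<longleftrightarrow> snd x \<in> comb A M (fst x) \<and> adm_word A M w"
  "adm_word A M (u @ w) \<longleftrightarrow> adm_word A M u \<and> adm_word A M w"
  by (auto simp: adm_word_def)

lemma toA_homog: "snd x \<in> comb A M (fst x) \<Longrightarrow> fst (fst x) = 0 \<Longrightarrow> toA x \<in> homog A"
  by (auto simp: comb_def homog_def toA_def)

lemma toM_homog: "snd x \<in> comb A M (fst x) \<Longrightarrow> fst (fst x) = 1 \<Longrightarrow> toM x \<in> homog M"
  by (auto simp: comb_def homog_def toM_def)

lemma map_toA_homog: "adm_word A M w \<Longrightarrow> fst (wt w) = 0 \<Longrightarrow> map toA w \<in> lists (homog A)"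
  by (simp add: adm_word_def fst_wt_eq_0_iff lists_eq_set image_subset_iff) (metis toA_homog)

lemma sum_list_fst: "sum_list (map fst xs) = sdegs xs + int (length xs)"
  by (induction xs) (auto simp: sdeg_def)

lemma sh_alg_gr:
  assumes "is_graded_module B" "alg_family A B e f" "xs \<in> lists (homog A)" "xs \<noteq> []"
  shows "sh_alg f xs \<in> gr B (sdegs xs + e)"
proof -
  have "f xs \<in> gr B ((\<Sum>x\<leftarrow>xs. fst x) + e - int (length xs))"
    using assms unfolding alg_family_def by blast
  then show ?thesis using assms(1) by (simp add: sh_alg_def gr_ksign sum_list_fst)
qed

lemma mod_family_gr:
  assumes "mod_family A M N e F" "as \<in> lists (homog A)" "x \<in> homog M" "bs \<in> lists (homog A)"
  shows "F as x bs \<in> gr N (sdegs as + sdeg x + sdegs bs + e + 1)"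
proof -
  have "F as x bs \<in> gr N ((\<Sum>x\<leftarrow>as. fst x) + fst x + (\<Sum>x\<leftarrow>bs. fst x)
      + e - int (length as) - int (length bs))"
    using assms unfolding mod_family_def by blast
  moreover have "(\<Sum>x\<leftarrow>as. fst x) + fst x + (\<Sum>x\<leftarrow>bs. fst x) + e - int (length as) - int (length bs)
     = sdegs as + sdeg x + sdegs bs + e + 1"
    by (simp add: sum_list_fst sdeg_def)
  ultimately show ?thesis by simp
qed

lemma sh_mod_gr:
  assumes "is_graded_module N" "mod_family A M N e F" "as \<in> lists (homog A)" "x \<in> homog M" "bs \<in> lists (homog A)"
  shows "sh_mod F as x bs \<in> gr N (sdegs as + sdeg x + sdegs bs + e + 1)"
  unfolding sh_mod_def by (intro gr_ksign[OF assms(1)] mod_family_gr[OF assms(2-5)])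

lemma sh_alg_additive:
  assumes "alg_family A B e f" "xs \<in> lists (homog A)" "ys \<in> lists (homog A)"
  shows "additive_on (gr A d) (\<lambda>v. sh_alg f (xs @ (d, v) # ys))"
proof -
  have "linear_on_degree A (smul B) d (\<lambda>v. f (xs @ (d, v) # ys))"
    using assms unfolding alg_family_def by blast
  then show ?thesis
    by (simp add: additive_on_def linear_on_degree_def sh_alg_def ksign_add sdeg_def)
qed

lemma sh_mod_additive:
  assumes "mod_family A M N e F" "as \<in> lists (homog A)" "bs \<in> lists (homog A)"
  shows "additive_on (gr M d) (\<lambda>v. sh_mod F as (d, v) bs)"
proof -
  have "linear_on_degree M (smul N) d (\<lambda>v. F as (d, v) bs)"
    using assms unfolding mod_family_def by blast
  then show ?thesis
    by (simp add: additive_on_def linear_on_degree_def sh_mod_def ksign_add sdeg_def)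
qed

lemma sh_mod_additive_alg:
  assumes "mod_family A M N e F" "as \<in> lists (homog A)" "cs \<in> lists (homog A)" "bs \<in> lists (homog A)" "x \<in> homog M"
  shows "additive_on (gr A d) (\<lambda>v. sh_mod F (as @ (d, v) # cs) x bs)"
    and "additive_on (gr A d) (\<lambda>v. sh_mod F bs x (as @ (d, v) # cs))"
proof -
  have "linear_on_degree A (smul N) d (\<lambda>v. F (as @ (d, v) # cs) x bs) \<and>
        linear_on_degree A (smul N) d (\<lambda>v. F bs x (as @ (d, v) # cs))"
    using assms unfolding mod_family_def by blast
  then show "additive_on (gr A d) (\<lambda>v. sh_mod F (as @ (d, v) # cs) x bs)"
    and "additive_on (gr A d) (\<lambda>v. sh_mod F bs x (as @ (d, v) # cs))"
    by (simp_all add: additive_on_def linear_on_degree_def sh_mod_def ksign_add sdeg_def)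
qed

lemma adm_wordE:
  assumes "adm_word A M w" "fst (wt w) = 1"
  obtains ls x rs where "w = ls @ x # rs" "fst (wt ls) = 0" "fst (fst x) = 1" "fst (wt rs) = 0"
    "map toA ls \<in> lists (homog A)" "toM x \<in> homog M" "map toA rs \<in> lists (homog A)"
proof -
  from fst_wt_eq_1E[OF assms(2)] obtain ls x rs where
    w: "w = ls @ x # rs" "fst (wt ls) = 0" "fst (fst x) = 1" "fst (wt rs) = 0" by blast
  moreover have "map toA ls \<in> lists (homog A)" "map toA rs \<in> lists (homog A)" "toM x \<in> homog M"
    using assms(1) map_toA_homog[of A M ls] map_toA_homog[of A M rs] toM_homog[of x A M]
    unfolding w(1) by (simp_all only: w adm_word_simps simp_thms)
  ultimately show thesis using that by blast
qed

lemma joint_closed: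
  assumes B: "is_graded_module B" "is_graded_module N"
    and f: "alg_family A B (e + 1) f" "mod_family A M N e F"
    and w: "adm_word A M w" "w \<noteq> []"
  shows "joint f F w \<in> comb B N (wt w + (0, e))"
proof -
  consider "fst (wt w) = 0" | "fst (wt w) = 1" | "fst (wt w) \<ge> 2" by linarith
  then show ?thesis
  proof cases
    case 1
    then show ?thesis
      using sh_alg_gr[OF B(1) f(1) map_toA_homog[OF w(1) 1]] w(2)
      by (simp add: joint_alg comb_def add_ac)
  next
    case 2
    with w(1) obtain ls x rs where w': "w = ls @ x # rs" "fst (wt ls) = 0" "fst (fst x) = 1" "fst (wt rs) = 0"
      "map toA ls \<in> lists (homog A)" "toM x \<in> homog M" "map toA rs \<in> lists (homog A)" by (rule adm_wordE)
    with sh_mod_gr[OF B(2) f(2) w'(5-7)] show ?thesis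
      by (simp add: joint_mod comb_def add_ac)
  next
    case 3
    then show ?thesis by (simp add: joint_def comb_def)
  qed
qed

text \<open>The additive map \<open>H\<close> is an evaluation at a vector when \<open>F\<close> takes values in a dual module.\<close>

lemma modw_additive:
  assumes F: "mod_family A M N e F" and H: "\<And>a b. H (a + b) = H a + H b"
    and w: "adm_word A M u" "adm_word A M w" "fst (wt u) + fst t + fst (wt w) = 1"
  shows "additive_on (comb A M t) (\<lambda>v. H (modw (sh_mod F) (u @ (t, v) # w)))"
proof -
  consider "fst t = 1" "fst (wt u) = 0" "fst (wt w) = 0"
    | "fst t = 0" "fst (wt u) = 1" "fst (wt w) = 0" | "fst t = 0" "fst (wt u) = 0" "fst (wt w) = 1"
    using w(3) by linarith
  then show ?thesis
  proof cases
    case 1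
    have "additive_on (gr M (snd t + 1)) (\<lambda>v. sh_mod F (map toA u) (snd t + 1, v) (map toA w))"
      using 1 w by (intro sh_mod_additive[OF F] map_toA_homog) auto
    then show ?thesis using 1 by (auto simp: modw_append additive_on_def comb_def toM_def H)
  next
    case 2
    from w(1) 2(2) obtain ls x rs where u: "u = ls @ x # rs" "fst (wt ls) = 0" "fst (fst x) = 1" "fst (wt rs) = 0"
      "map toA ls \<in> lists (homog A)" "toM x \<in> homog M" "map toA rs \<in> lists (homog A)" by (rule adm_wordE)
    have "additive_on (gr A (snd t + 1)) (\<lambda>v. sh_mod F (map toA ls) (toM x) (map toA rs @ (snd t + 1, v) # map toA w))"
      using 2 w u by (intro sh_mod_additive_alg[OF F] map_toA_homog) auto
    then show ?thesis using 2 u by (auto simp: modw_append additive_on_def comb_def toA_def H)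
  next
    case 3
    from w(2) 3(3) obtain ls x rs where w': "w = ls @ x # rs" "fst (wt ls) = 0" "fst (fst x) = 1" "fst (wt rs) = 0"
      "map toA ls \<in> lists (homog A)" "toM x \<in> homog M" "map toA rs \<in> lists (homog A)" by (rule adm_wordE)
    have "additive_on (gr A (snd t + 1)) (\<lambda>v. sh_mod F (map toA u @ (snd t + 1, v) # map toA ls) (toM x) (map toA rs))"
      using 3 w w' by (intro sh_mod_additive_alg[OF F] map_toA_homog) auto
    moreover have "modw (sh_mod F) (u @ (t, v) # w)
      = sh_mod F (map toA u @ toA (t, v) # map toA ls) (toM x) (map toA rs)" for v
      using modw_append[of "u @ (t, v) # ls" x "sh_mod F" rs] 3 w' by simp
    ultimately show ?thesis using 3 by (auto simp: additive_on_def comb_def toA_def H)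
  qed
qed

lemma joint_additive:
  assumes f: "alg_family A B e' f" "mod_family A M N e F" and w: "adm_word A M u" "adm_word A M w"
  shows "additive_on (comb A M t) (\<lambda>v. joint f F (u @ (t, v) # w))"
proof -
  consider "fst (wt u) + fst t + fst (wt w) = 0" | "fst (wt u) + fst t + fst (wt w) = 1"
    | "fst (wt u) + fst t + fst (wt w) \<ge> 2" by linarith
  then show ?thesis
  proof cases
    case 1
    then have "additive_on (gr A (snd t + 1)) (\<lambda>v. sh_alg f (map toA u @ (snd t + 1, v) # map toA w))"
      using w by (intro sh_alg_additive[OF f(1)] map_toA_homog) auto
    then show ?thesis using 1 by (auto simp: joint_alg additive_on_def comb_def toA_def)
  next
    case 2
    have "additive_on (comb A M t) (\<lambda>v. (\<lambda>y. (0, y)) (modw (sh_mod F) (u @ (t, v) # w)))"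
      by (rule modw_additive[OF f(2) _ w 2]) simp
    moreover have "joint f F (u @ (t, v) # w) = (0, modw (sh_mod F) (u @ (t, v) # w))" for v
      using 2 by (auto simp: joint_def)
    ultimately show ?thesis by (simp only:)
  next
    case 3
    then show ?thesis by (auto simp: joint_def additive_on_def)
  qed
qed

locale ainf_module_pair =
  fixes A :: "('r::comm_ring_1, 'a::ab_group_add) ainf_algebra"
    and M :: "('r, 'a, 'm::ab_group_add) ainf_module"
  assumes algebra: "is_ainf_algebra A" and module: "is_ainf_module A M"
begin

lemma graded_A: "is_graded_module A" and graded_M: "is_graded_module M"
  using algebra module by (simp_all add: is_ainf_algebra_def is_ainf_module_def)

sublocale graded_groups "comb A M"
  by (rule graded_groups_comb[OF graded_A graded_M])

lemma adm_conv: "adm w \<longleftrightarrow> adm_word A M w"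
  by (simp add: adm_def adm_word_def)

abbreviation op where "op \<equiv> joint (mu A) (beta M)"

lemma mu_family: "alg_family A A 2 (mu A)" and beta_family: "mod_family A M M 1 (beta M)"
  using algebra module by (simp_all add: is_ainf_algebra_def is_ainf_module_def)

text \<open>Words with no module entry give the algebra relations and words with one give the module
  relations; with two or more, every operation is zero.\<close>

sublocale ainf_structure "comb A M" op
proof
  fix w :: "('a \<times> 'm) letter list" assume w: "adm w"
  show "op w \<in> comb A M (wt w + (0, 1))" if "w \<noteq> []"
    using joint_closed[OF graded_A graded_M _ beta_family] mu_family w that by (simp add: adm_conv)
  consider "w = []" | "fst (wt w) = 0" "w \<noteq> []" | "fst (wt w) = 1" | "fst (wt w) \<ge> 2" by linarith
  then show "ins op op w = 0"
  proof cases
    case 2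
    then show ?thesis using w algebra map_toA_homog[of A M w]
      by (simp add: ins_joint_alg is_ainf_algebra_def adm_conv zero_prod_def)
  next
    case 3
    with w obtain ls x rs where w': "w = ls @ x # rs" "fst (wt ls) = 0" "fst (fst x) = 1" "fst (wt rs) = 0"
      "map toA ls \<in> lists (homog A)" "toM x \<in> homog M" "map toA rs \<in> lists (homog A)"
      unfolding adm_conv by (rule adm_wordE)
    then show ?thesis using module
      by (simp add: ins_joint_mod is_ainf_module_def zero_prod_def)
  next
    case 4
    then show ?thesis by (rule ins_joint_many)
  qed (simp add: ins_def)
qed (auto simp: multiadditive_def adm_conv intro!: joint_additive mu_family beta_family)

end

section \<open>Morphisms and inner products as structures on words\<close>

text \<open>The morphism equations of \<open>f\<close> and of \<open>F\<close> are the components of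
  one equation, for words with zero and with one module entry; with more entries both sides
  vanish.\<close>

lemma joint_morphism:
  assumes f: "is_alg_morphism A B f" and F: "is_mod_morphism A M N f 0 F"
    and w: "adm_word A M w" "w \<noteq> []"
  shows "ins (joint (mu A) (beta M)) (joint f F) w
    = (\<Sum>cs\<in>cuts w. joint (mu B) (beta N) (map (ell 0 (joint f F)) cs))"
proof -
  have wt_cs: "wt (map (ell 0 (joint f F)) cs) = wt w" if "cs \<in> cuts w" for cs
    using that by (simp add: wt_map_ell cuts_def)
  consider "fst (wt w) = 0" | "fst (wt w) = 1" | "fst (wt w) \<ge> 2" by linarith
  then show ?thesis
  proof cases
    case 1
    have "(\<Sum>cs\<in>cuts w. joint (mu B) (beta N) (map (ell 0 (joint f F)) cs))
      = (\<Sum>cs\<in>cuts w. (sh_alg (mu B) (map (el_alg 0 f) (map (map toA) cs)), 0))"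
    proof (intro sum.cong refl)
      fix cs assume cs: "cs \<in> cuts w"
      with 1 have "map toA (map (ell 0 (joint f F)) cs) = map (el_alg 0 f) (map (map toA) cs)"
        by (intro map_toA_ell) (simp add: cuts_def)
      with 1 wt_cs[OF cs] show "joint (mu B) (beta N) (map (ell 0 (joint f F)) cs)
          = (sh_alg (mu B) (map (el_alg 0 f) (map (map toA) cs)), 0)"
        by (simp only: joint_alg)
    qed
    also have "\<dots> = (\<Sum>xss\<in>cuts (map toA w). (sh_alg (mu B) (map (el_alg 0 f) xss), 0))"
      by (rule sum_cuts_map[symmetric])
    also have "\<dots> = (insert_mu A (sh_alg f) (map toA w), 0)"
      using f w(2) map_toA_homog[OF w(1) 1]
      by (intro prod_eqI) (simp_all add: fst_sum snd_sum is_alg_morphism_def)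
    finally show ?thesis using 1 by (simp add: ins_joint_alg)
  next
    case 2
    with w(1) obtain ls x rs where w': "w = ls @ x # rs" "fst (wt ls) = 0" "fst (fst x) = 1" "fst (wt rs) = 0"
      "map toA ls \<in> lists (homog A)" "toM x \<in> homog M" "map toA rs \<in> lists (homog A)" by (rule adm_wordE)
    show ?thesis
    proof (rule prod_eqI)
      have "fst (\<Sum>cs\<in>cuts w. joint (mu B) (beta N) (map (ell 0 (joint f F)) cs)) = 0"
        unfolding fst_sum using 2 by (intro sum.neutral) (simp add: joint_def wt_cs)
      then show "fst (ins (joint (mu A) (beta M)) (joint f F) w)
        = fst (\<Sum>cs\<in>cuts w. joint (mu B) (beta N) (map (ell 0 (joint f F)) cs))"
        by (simp add: w' ins_joint_mod)
      have "(\<Sum>cs\<in>cuts (ls @ x # rs). snd (joint (mu B) (beta N) (map (ell 0 (joint f F)) cs)))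
        = push f 0 F (beta N) (map toA ls) (toM x) (map toA rs)"
        by (rule sum_cuts_modw) (simp_all add: w' joint_def)
      then show "snd (ins (joint (mu A) (beta M)) (joint f F) w)
        = snd (\<Sum>cs\<in>cuts w. joint (mu B) (beta N) (map (ell 0 (joint f F)) cs))"
        using F w'(5-7) unfolding is_mod_morphism_def
        by (simp add: w'(1) snd_sum ins_joint_mod[OF w'(2-4)])
    qed
  next
    case 3
    have "(\<Sum>cs\<in>cuts w. joint (mu B) (beta N) (map (ell 0 (joint f F)) cs)) = 0"
      using 3 by (intro sum.neutral) (simp add: joint_def wt_cs)
    with 3 show ?thesis by (simp add: ins_joint_many)
  qed
qed

section \<open>Dual modules and the identity morphism\<close>

lemma sh_mod_sh_mod [simp]: "sh_mod (sh_mod F) = F"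
  by (intro HOL.ext) (simp add: sh_mod_def, simp add: ksign_def)

lemma ksign_apply: "ksign e \<phi> y = ksign e (\<phi> y)"
  by (simp add: ksign_def)

lemma dual_gr_ksign: "\<phi> \<in> gr (dual M) k \<Longrightarrow> ksign e \<phi> \<in> gr (dual M) k"
  by (auto simp: dual_def linear_on_degree_def ksign_def)

lemma dual_gr_additive: "\<phi> \<in> gr (dual M) k \<Longrightarrow> additive_on (gr M (- k)) \<phi>"
  by (simp add: dual_def linear_on_degree_def additive_on_def)

lemma dual_gr_eq_0: "\<phi> \<in> gr (dual M) k \<Longrightarrow> y \<notin> gr M (- k) \<Longrightarrow> \<phi> y = 0"
  by (simp add: dual_def)

lemma dual_gr_0: "is_graded_module M \<Longrightarrow> \<phi> \<in> gr (dual M) k \<Longrightarrow> \<phi> 0 = 0"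
  using additive_on_0[OF dual_gr_additive gr_0] .

text \<open>Either \<open>y\<close> is outside \<open>gr M (- k)\<close>, where functionals of
  degree \<open>k\<close> are extended by zero, or it lies in two different graded pieces and is
  zero.\<close>

lemma dual_gr_eq_0_degree:
  "is_graded_module M \<Longrightarrow> \<phi> \<in> gr (dual M) k \<Longrightarrow> y \<in> gr M d \<Longrightarrow> d \<noteq> - k \<Longrightarrow> \<phi> y = 0"
  by (metis dual_gr_0 dual_gr_eq_0 gr_disjoint)

lemma sh_mod_dual_gr:
  assumes "mod_family A M (dual M) e F" "as \<in> lists (homog A)" "x \<in> homog M" "bs \<in> lists (homog A)"
  shows "sh_mod F as x bs \<in> gr (dual M) (sdegs as + sdeg x + sdegs bs + e + 1)"
  unfolding sh_mod_def by (intro dual_gr_ksign mod_family_gr[OF assms])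

lemma comp_gen_apply: "comp_gen A M (\<lambda>as x bs. F as x bs y) as x bs = comp_gen A M F as x bs y"
proof -
  have "(sum f S) y = (\<Sum>i\<in>S. f i y)" for f :: "'i \<Rightarrow> 'b \<Rightarrow> 'c::ab_group_add" and S y
    by (rule hom_sum[of "\<lambda>\<phi>. \<phi> y"]) simp
  then show ?thesis
    by (simp add: comp_gen_def insert_mu_def case_prod_unfold hom_sum[of "\<lambda>\<phi>. \<phi> y"] ksign_apply)
qed

lemma singletons_in_cuts: "map (\<lambda>x. [x]) xs \<in> cuts xs"
  by (auto simp: cuts_def)

lemma cuts_not_singletons:
  assumes "cs \<in> cuts xs" "cs \<noteq> map (\<lambda>x. [x]) xs"
  shows "\<exists>b\<in>set cs. length b \<ge> 2"
proof (rule ccontr)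
  assume *: "\<not> ?thesis"
  have "cs = map (\<lambda>x. [x]) (concat cs)" if "[] \<notin> set cs" "\<forall>b\<in>set cs. \<not> 2 \<le> length b"
    using that
  proof (induction cs)
    case (Cons b cs)
    then show ?case by (cases b rule: remdups_adj.cases) auto
  qed simp
  with assms * show False by (auto simp: cuts_def)
qed

lemma el_id_singleton: "el_alg 0 id_alg [x] = x"
  by (cases x) (simp add: el_alg_def sh_alg_def id_alg_def desusp_def sdeg_def)

lemma el_id_eq_0: "length b \<ge> 2 \<Longrightarrow> snd (el_alg 0 id_alg b) = 0"
  by (auto simp: el_alg_def sh_alg_def id_alg_def split: list.split)

lemma el_id_homog: "is_graded_module A \<Longrightarrow> b \<in> lists (homog A) \<Longrightarrow> el_alg 0 id_alg b \<in> homog A"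
proof (cases "\<exists>x. b = [x]")
  case False
  assume "is_graded_module A"
  moreover from False have "id_alg b = 0" by (auto simp: id_alg_def split: list.split)
  ultimately show ?thesis by (simp add: el_alg_def sh_alg_def homog_def gr_0)
qed (auto simp: el_id_singleton)

text \<open>The identity has no components of arity two or more, so a cut with a longer block
  produces a zero argument. Hypothesis \<open>z\<close> asks that the outer maps vanish there; only
  the cut into singletons survives.\<close>

lemma push_id:
  assumes A: "is_graded_module A" and as: "as \<in> lists (homog A)" and bs: "bs \<in> lists (homog A)"
    and z: "\<And>as1 as2 bs1 bs2 xs ys. (as1, as2) \<in> split2 as \<Longrightarrow> (bs1, bs2) \<in> split2 bs \<Longrightarrow>
      xs \<in> lists (homog A) \<Longrightarrow> ys \<in> lists (homog A) \<Longrightarrow> (\<exists>x\<in>set xs \<union> set ys. snd x = 0) \<Longrightarrow>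
      sh_mod \<Gamma> xs (el_mod e F as2 m bs1) ys = 0"
  shows "push id_alg e F \<Gamma> as m bs = (\<Sum>(as1, as2)\<in>split2 as. \<Sum>(bs1, bs2)\<in>split2 bs.
    ksign (e * sdegs as1) (sh_mod \<Gamma> as1 (el_mod e F as2 m bs1) bs2))"
  unfolding push_split2
proof (rule sum2_cong, rule sum2_cong, goal_cases)
  case (1 as1 as2 bs1 bs2)
  let ?s = "map (\<lambda>x. [x])" let ?e = "map (el_alg 0 id_alg)"
  let ?t = "\<lambda>ass bss. sh_mod \<Gamma> (?e ass) (el_mod e F as2 m bs1) (?e bss)"
  have homog: "?e cs \<in> lists (homog A)" if "cs \<in> cuts xs" "xs \<in> lists (homog A)" for cs xs
  proof -
    have "el_alg 0 id_alg b \<in> homog A" if "b \<in> set cs" for b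
      using that \<open>cs \<in> cuts xs\<close> \<open>xs \<in> lists (homog A)\<close>
      by (intro el_id_homog[OF A]) (auto simp: cuts_def)
    then show ?thesis by auto
  qed
  have as1: "as1 \<in> lists (homog A)" and bs2: "bs2 \<in> lists (homog A)"
    using 1 as bs by (auto simp: split2_def)
  have 0: "?t ass bss = 0" if "ass \<in> cuts as1" "bss \<in> cuts bs2" "ass \<noteq> ?s as1 \<or> bss \<noteq> ?s bs2" for ass bss
  proof -
    have "\<exists>b\<in>set ass \<union> set bss. length b \<ge> 2" using that cuts_not_singletons by blast
    then have "\<exists>x\<in>set (?e ass) \<union> set (?e bss). snd x = 0" using el_id_eq_0 by fastforce
    then show ?thesis by (rule z[OF 1 homog[OF that(1) as1] homog[OF that(2) bs2]])
  qed
  have "(\<Sum>ass\<in>cuts as1. \<Sum>bss\<in>cuts bs2. ksign (e * sdegs as1) (?t ass bss))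
    = (\<Sum>p\<in>cuts as1 \<times> cuts bs2. ksign (e * sdegs as1) (?t (fst p) (snd p)))"
    by (simp add: sum.cartesian_product case_prod_unfold)
  also have "\<dots> = (\<Sum>p\<in>{(?s as1, ?s bs2)}. ksign (e * sdegs as1) (?t (fst p) (snd p)))"
  proof (intro sum.mono_neutral_right ballI)
    fix p assume p: "p \<in> cuts as1 \<times> cuts bs2 - {(?s as1, ?s bs2)}"
    then have "?t (fst p) (snd p) = 0" by (intro 0) (auto simp: prod_eq_iff)
    then show "ksign (e * sdegs as1) (?t (fst p) (snd p)) = 0" by simp
  qed (auto simp: singletons_in_cuts)
  also have "\<dots> = ksign (e * sdegs as1) (sh_mod \<Gamma> as1 (el_mod e F as2 m bs1) bs2)"
    by (simp add: comp_def el_id_singleton)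
  finally show ?case .
qed

lemma beta_dual [simp]: "sh_mod (beta (dual M)) = sh_dual_beta M"
  by (simp add: dual_def)

context ainf_module_pair
begin

text \<open>This provides the vanishing hypothesis of \<open>push_id\<close> for the dual: a zero
  argument makes the underlying operation of \<open>M\<close> zero, and the functional is then
  evaluated at \<open>0\<close>.\<close>

lemma sh_dual_beta_eq_0:
  assumes "xs \<in> lists (homog A)" "ys \<in> lists (homog A)" "\<exists>x\<in>set xs \<union> set ys. snd x = 0" "snd \<phi> 0 = 0"
  shows "sh_dual_beta M xs \<phi> ys = 0"
proof -
  have "sh_mod (beta M) ys x xs = 0" if x: "x \<in> homog M" for x
  proof -
    from assms(3) consider u d v where "xs = u @ (d, 0) # v" | u d v where "ys = u @ (d, 0) # v"
      by (metis UnE prod.collapse split_list)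
    then show ?thesis
    proof cases
      case 1
      with assms show ?thesis
        using additive_on_0[OF sh_mod_additive_alg(2)[OF beta_family, of u v ys x d] gr_0[OF graded_A]] x by auto
    next
      case 2
      with assms show ?thesis
        using additive_on_0[OF sh_mod_additive_alg(1)[OF beta_family, of u v xs x d] gr_0[OF graded_A]] x by auto
    qed
  qed
  then have "snd \<phi> (sh_mod (beta M) ys (k, t) xs) = 0" if "t \<in> gr M k" for t k
    using that assms(4) by (simp add: homog_def)
  then show ?thesis by (intro HOL.ext) (simp add: sh_dual_beta_def Let_def)
qed

lemma push_id_dual:
  assumes "mod_family A M (dual M) e F" "as \<in> lists (homog A)" "x \<in> homog M" "bs \<in> lists (homog A)"
  shows "push id_alg e F (beta (dual M)) as x bs = (\<Sum>(as1, as2)\<in>split2 as. \<Sum>(bs1, bs2)\<in>split2 bs.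
    ksign (e * sdegs as1) (sh_dual_beta M as1 (el_mod e F as2 x bs1) bs2))"
proof (subst push_id[OF graded_A assms(2,4)], goal_cases)
  case (1 as1 as2 bs1 bs2 xs ys)
  have "sh_mod F as2 x bs1 \<in> gr (dual M) (sdegs as2 + sdeg x + sdegs bs1 + e + 1)"
    using 1 assms by (intro sh_mod_dual_gr) (auto simp: split2_def)
  then show ?case unfolding beta_dual using 1
    by (intro sh_dual_beta_eq_0) (auto simp: el_mod_def dual_gr_0[OF graded_M])
qed simp

end

section \<open>The inner product as an invariant pairing on words\<close>

locale ainf_triple = ainf_module_pair A M
  for A :: "('r::comm_ring_1, 'a::ab_group_add) ainf_algebra" and M :: "('r, 'a, 'm::ab_group_add) ainf_module" +
  fixes e :: int and I :: "('a, 'm, 'm \<Rightarrow> 'r) mod_maps"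
  assumes inner: "is_inner_product A M e I"
begin

lemma I_family: "mod_family A M (dual M) e I"
  using inner by (simp add: is_inner_product_def is_mod_morphism_def)

definition pair_word :: "('a \<times> 'm) letter list \<Rightarrow> 'a \<times> 'm \<Rightarrow> 'r" where
  "pair_word w x = (if fst (wt w) = 1 then modw (sh_mod I) w (snd x) else 0)"

lemma pair_word_append:
  "fst (wt ls) = 0 \<Longrightarrow> fst (fst x) = 1 \<Longrightarrow> fst (wt rs) = 0 \<Longrightarrow>
    pair_word (ls @ x # rs) y = sh_mod I (map toA ls) (toM x) (map toA rs) (snd y)"
  by (simp add: pair_word_def modw_append)

lemma pair_word_gr:
  assumes "adm_word A M w" "fst (wt w) = 1"
  obtains \<phi> where "\<phi> \<in> gr (dual M) (snd (wt w) + e + 1)" "\<And>y. pair_word w y = \<phi> (snd y)"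
proof -
  from assms obtain ls x rs where w: "w = ls @ x # rs" "fst (wt ls) = 0" "fst (fst x) = 1" "fst (wt rs) = 0"
      "map toA ls \<in> lists (homog A)" "toM x \<in> homog M" "map toA rs \<in> lists (homog A)" by (rule adm_wordE)
  with sh_mod_dual_gr[OF I_family w(5-7)] have
    "sh_mod I (map toA ls) (toM x) (map toA rs) \<in> gr (dual M) (snd (wt w) + e + 1)"
    by (simp add: add_ac)
  with w show thesis using pair_word_append that by blast
qed

text \<open>This is the morphism equation of \<open>I\<close> over the identity, evaluated at a
  vector.\<close>

lemma ins_pair_word:
  assumes "fst (wt ls) = 0" "fst (fst x) = 1" "fst (wt rs) = 0"
    "map toA ls \<in> lists (homog A)" "toM x \<in> homog M" "map toA rs \<in> lists (homog A)"
  shows "ins op (\<lambda>w. pair_word w y) (ls @ x # rs) = (\<Sum>(a, b)\<in>split2 ls. \<Sum>(c, d)\<in>split2 rs.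
    ksign (e + e * snd (wt a)) (sh_dual_beta M (map toA a) (el_mod e I (map toA b) (toM x) (map toA c)) (map toA d) (snd y)))"
proof -
  have "ins op (\<lambda>w. pair_word w y) (ls @ x # rs)
    = comp_gen A M (\<lambda>as x bs. sh_mod I as x bs (snd y)) (map toA ls) (toM x) (map toA rs)"
    by (rule ins_mod[OF assms(1-3)]) (simp add: pair_word_def modw_def Let_def)
  also have "\<dots> = comp_beta A M I (map toA ls) (toM x) (map toA rs) (snd y)"
    by (simp add: comp_gen_apply comp_beta_conv)
  also have "\<dots> = ksign e (push id_alg e I (beta (dual M)) (map toA ls) (toM x) (map toA rs)) (snd y)"
    using inner assms by (simp add: is_inner_product_def is_mod_morphism_def)
  also have "\<dots> = (\<Sum>(a, b)\<in>split2 ls. \<Sum>(c, d)\<in>split2 rs.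
    ksign (e + e * snd (wt a)) (sh_dual_beta M (map toA a) (el_mod e I (map toA b) (toM x) (map toA c)) (map toA d) (snd y)))"
    unfolding push_id_dual[OF I_family assms(4-6)] sum_split2_map
    by (simp add: ksign_sum2 ksign_sum ksign_apply case_prod_unfold hom_sum[of "\<lambda>\<phi>. \<phi> (snd y)"])
  finally show ?thesis .
qed

text \<open>The constant: a cycle has two module entries, and for a word \<open>w\<close> the
  functional has degree \<open>snd (wt w) + e + 1\<close>, so it pairs with vectors of the opposite
  degree \<open>snd t + 1\<close>. This forces \<open>snd (wt w) + snd t = - e - 2\<close>.\<close>

sublocale pairing "comb A M" op pair_word "(2, - e - 2)"
proof
  fix x :: "'a \<times> 'm"
  show "multiadditive (\<lambda>w. pair_word w x)"
    unfolding multiadditive_def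
  proof (intro allI impI)
    fix u w t assume w: "adm u" "adm w"
    show "additive_on (comb A M t) (\<lambda>v. pair_word (u @ (t, v) # w) x)"
    proof (cases "fst (wt u) + fst t + fst (wt w) = 1")
      case True
      with modw_additive[OF I_family, of "\<lambda>\<phi>. \<phi> (snd x)" u w t] w show ?thesis
        by (simp add: pair_word_def adm_conv)
    next
      case False
      then show ?thesis by (auto simp: pair_word_def additive_on_def)
    qed
  qed
next
  fix w :: "('a \<times> 'm) letter list" and x
  show "fst (wt w) \<noteq> 1 \<Longrightarrow> pair_word w x = 0" by (simp add: pair_word_def)
next
  fix w :: "('a \<times> 'm) letter list" and t
  assume w: "adm w" "wt w + t = (2, - e - 2)"
  show "additive_on (comb A M t) (pair_word w)"
  proof (cases "fst (wt w) = 1")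
    case True
    with w pair_word_gr obtain \<phi> where \<phi>: "\<phi> \<in> gr (dual M) (snd (wt w) + e + 1)" "\<And>y. pair_word w y = \<phi> (snd y)"
      by (auto simp: adm_conv)
    have fst: "fst t = 1" and snd: "snd t + 1 = - (snd (wt w) + e + 1)"
      using arg_cong[OF w(2), of fst] arg_cong[OF w(2), of snd] True by simp_all
    show ?thesis
      using dual_gr_additive[OF \<phi>(1), folded snd] fst by (auto simp: \<phi>(2) additive_on_def comb_def)
  qed (simp add: pair_word_def additive_on_def)
next
  fix w :: "('a \<times> 'm) letter list" and x t
  assume w: "adm w" "fst (wt w) = 1" and x: "x \<in> comb A M t" and t: "wt w + t + (0, 1) = (2, - e - 2)"
  from w obtain ls z rs where w': "w = ls @ z # rs" "fst (wt ls) = 0" "fst (fst z) = 1" "fst (wt rs) = 0"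
      "map toA ls \<in> lists (homog A)" "toM z \<in> homog M" "map toA rs \<in> lists (homog A)"
    unfolding adm_conv by (rule adm_wordE)
  have fst_t: "fst t = 1" and snd_t: "snd (wt w) + snd t = - e - 3"
    using arg_cong[OF t, of fst] arg_cong[OF t, of snd] w(2) by simp_all
  let ?K = "\<lambda>w1 w2 w3. ksign (1 + snd (wt w1) * (snd (wt w2) + snd (wt w3) + snd t) + snd (wt w2))
          (pair_word w2 (op (w3 @ (t, x) # w1)))"
  have "(\<Sum>(w1, w2, w3)\<in>split3 w. ?K w1 w2 w3)
    = (\<Sum>(a, b, d)\<in>split3 ls. ?K a b (d @ z # rs))
    + (\<Sum>(a, b)\<in>split2 ls. \<Sum>(c, d)\<in>split2 rs. ?K a (b @ z # c) d)
    + (\<Sum>(a, b, d)\<in>split3 rs. ?K (ls @ z # a) b d)"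
    unfolding w'(1) by (rule sum_split3_pivot)
  also have "(\<Sum>(a, b, d)\<in>split3 ls. ?K a b (d @ z # rs)) = 0"
    using w'(2) by (intro sum.neutral) (auto simp: split3_def pair_word_def)
  also have "(\<Sum>(a, b, d)\<in>split3 rs. ?K (ls @ z # a) b d) = 0"
    using w'(4) by (intro sum.neutral) (auto simp: split3_def pair_word_def)
  also have "(\<Sum>(a, b)\<in>split2 ls. \<Sum>(c, d)\<in>split2 rs. ?K a (b @ z # c) d) = ins op (\<lambda>w. pair_word w x) w"
    unfolding w'(1) ins_pair_word[OF w'(2-7)]
  proof (rule sum2_cong, rule sum2_cong, goal_cases)
    case (1 a b c d)
    then have ab: "ls = a @ b" "rs = c @ d" by (auto simp: split2_def)
    then have 0: "fst (wt a) = 0" "fst (wt b) = 0" "fst (wt c) = 0" "fst (wt d) = 0"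
      using w' by auto
    \<comment> \<open>The degree at which the dual action evaluates is exactly that of
      \<open>x\<close>, so the default value \<open>0\<close> in \<open>sh_dual_beta\<close> is not
      taken.\<close>
    have deg: "- (snd (wt a) + sdeg (el_mod e I (map toA b) (toM z) (map toA c)) + snd (wt d) + 1 + 1) = snd t + 1"
      using snd_t by (simp add: w'(1) ab el_mod_def sdeg_def[of "(_, _)"])
    have "snd x \<in> gr M (snd t + 1)" using x fst_t by (auto simp: comb_def)
    then have 1: "sh_dual_beta M (map toA a) (el_mod e I (map toA b) (toM z) (map toA c)) (map toA d) (snd x)
      = - ksign (snd (wt a) * (sdeg (el_mod e I (map toA b) (toM z) (map toA c)) + snd (wt d) + snd t)
            + sdeg (el_mod e I (map toA b) (toM z) (map toA c)))
          (sh_mod I (map toA b) (toM z) (map toA c) (sh_mod (beta M) (map toA d) (snd t + 1, snd x) (map toA a)))"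
      unfolding sh_dual_beta_def Let_def sdegs_map_toA deg by (simp add: el_mod_def sdeg_def[of "(_ + 1, _)"])
    have "op (d @ (t, x) # a) = (0, sh_mod (beta M) (map toA d) (snd t + 1, snd x) (map toA a))"
      using joint_mod[OF 0(4) _ 0(1), of "(t, x)"] fst_t by (simp add: toM_def)
    then have 2: "pair_word (b @ z # c) (op (d @ (t, x) # a))
      = sh_mod I (map toA b) (toM z) (map toA c) (sh_mod (beta M) (map toA d) (snd t + 1, snd x) (map toA a))"
      using pair_word_append[OF 0(2) w'(3) 0(3)] by simp
    have 3: "sdeg (el_mod e I (map toA b) (toM z) (map toA c)) = snd (wt b) + snd (fst z) + snd (wt c) + e"
      by (simp add: el_mod_def sdeg_def[of "(_, _)"])
    \<comment> \<open>The summand \<open>1\<close> in the closedness sign is the minus sign in the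
      action on the dual; the contributions of \<open>e\<close> occur twice and drop out modulo
      2.\<close>
    show ?case
      unfolding 1 2 3 ksign_minus ksign_ksign by (rule ksign_cong_minus) auto
  qed
  finally show "ins op (\<lambda>w. pair_word w x) w = (\<Sum>(w1, w2, w3)\<in>split3 w. ?K w1 w2 w3)" by simp
qed

end

section \<open>Low arities, and words whose consecutive products vanish\<close>

lemma sh_alg_singleton: "sh_alg f [x] = f [x]"
  by (simp add: sh_alg_def desusp_def)

lemma sh_mod_singleton: "sh_mod F [] x [] = F [] x []"
  by (simp add: sh_mod_def desusp_def)

lemma sum_cuts_singleton: "(\<Sum>cs\<in>cuts [x]. f cs) = f [[x]]"
  by (simp add: sum_cuts_Cons)

lemma sum_cuts_pair: "(\<Sum>cs\<in>cuts [x, y]. f cs) = f [[x], [y]] + f [[x, y]]"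
  by (simp add: sum_cuts_Cons[of f] sum_split2_Cons sum_cuts_singleton)

lemma sum_split3_singleton: "(\<Sum>(u, v, w)\<in>split3 [x]. f u v w) = f [] [x] []"
  using sum_split3_pivot[of f "[]" x "[]"] by simp

lemma sum_split3_pair:
  "(\<Sum>(u, v, w)\<in>split3 [x, y]. f u v w) = f [] [x] [y] + f [] [x, y] [] + f [x] [y] []"
  using sum_split3_pivot[of f "[]" x "[y]"] sum_split3_singleton[of "\<lambda>a. f (x # a)" y]
  by (simp add: sum_split2_Cons)

context ainf_module_pair
begin

lemma ins_eq_0_factors:
  assumes "\<And>u w t. adm_word A M u \<Longrightarrow> adm_word A M w \<Longrightarrow> additive_on (comb A M t) (\<lambda>v. \<phi> (u @ (t, v) # w))"
    and "adm_word A M w" "\<And>u v x. u @ v @ x = w \<Longrightarrow> v \<noteq> [] \<Longrightarrow> op v = 0"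
  shows "ins op \<phi> w = 0"
  unfolding ins_def
proof (rule sum.neutral, clarify)
  fix u v x assume "(u, v, x) \<in> split3 w"
  then have *: "u @ v @ x = w" "v \<noteq> []" by (auto simp: split3_def)
  with assms(2) have "adm_word A M u" "adm_word A M x" by auto
  from additive_on_0[OF assms(1)[OF this] G_0] assms(3)[OF *]
  show "ksign (snd (wt u)) (\<phi> (u @ (wt v + (0, 1), op v) # x)) = 0" by simp
qed

text \<open>Every term inserts an operation on a consecutive subword, and by \<open>z\<close> these
  values are zero.\<close>

lemma comp_beta_eq_0:
  assumes H: "mod_family A M N e H"
    and w: "adm_word A M (ls @ x # rs)" "fst (wt ls) = 0" "fst (fst x) = 1" "fst (wt rs) = 0"
    and z: "\<And>u v y. u @ v @ y = ls @ x # rs \<Longrightarrow> v \<noteq> [] \<Longrightarrow> op v = 0"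
  shows "comp_beta A M H (map toA ls) (toM x) (map toA rs) = 0"
proof -
  let ?\<phi> = "\<lambda>w. if fst (wt w) = 1 then modw (sh_mod H) w else 0"
  have "comp_beta A M H (map toA ls) (toM x) (map toA rs) = ins op ?\<phi> (ls @ x # rs)"
    unfolding comp_beta_conv by (rule ins_mod[OF w(2-4), symmetric]) simp
  also have "\<dots> = 0"
  proof (rule ins_eq_0_factors[OF _ w(1) z])
    fix u w t assume uw: "adm_word A M u" "adm_word A M w"
    show "additive_on (comb A M t) (\<lambda>v. ?\<phi> (u @ (t, v) # w))"
    proof (cases "fst (wt u) + fst t + fst (wt w) = 1")
      case True
      with modw_additive[OF H, of "\<lambda>x. x" u w t] uw show ?thesis by simp
    qed (auto simp: additive_on_def)
  qed
  finally show ?thesis .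
qed

text \<open>The terms of \<open>delta\<close> insert operations either on subwords of
  \<open>ls @ x # rs\<close>, or, through the action on the dual, on a word \<open>d @ y # a\<close>
  that runs around the cycle through \<open>y\<close>. The hypotheses \<open>z\<close> and
  \<open>zy\<close> kill the two kinds.\<close>

lemma delta_dual_eq_0:
  assumes H: "mod_family A M (dual M) e H"
    and w: "adm_word A M (ls @ x # rs)" "fst (wt ls) = 0" "fst (fst x) = 1" "fst (wt rs) = 0"
    and y: "snd y \<in> comb A M (fst y)" "fst (fst y) = 1"
    and z: "\<And>u v y. u @ v @ y = ls @ x # rs \<Longrightarrow> v \<noteq> [] \<Longrightarrow> op v = 0"
    and zy: "\<And>a b c d. ls = a @ b \<Longrightarrow> rs = c @ d \<Longrightarrow> op (d @ y # a) = 0"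
  shows "delta A M (dual M) e H (map toA ls) (toM x) (map toA rs) (snd (snd y)) = 0"
proof -
  have "sh_dual_beta M (map toA a) (el_mod e H (map toA b) (toM x) (map toA c)) (map toA d) (snd (snd y)) = 0"
    if "ls = a @ b" "rs = c @ d" for a b c d
  proof -
    note ls_rs = that
    note 0 = w(2,4)[unfolded that]
    have ad: "adm_word A M a" "adm_word A M b" "adm_word A M c" "adm_word A M d" "snd x \<in> comb A M (fst x)"
      using w(1) that by simp_all
    have h: "map toA a \<in> lists (homog A)" "map toA b \<in> lists (homog A)" "map toA c \<in> lists (homog A)"
        "map toA d \<in> lists (homog A)" "toM x \<in> homog M"
      using w(3) 0 by (simp_all add: map_toA_homog[OF ad(1)] map_toA_homog[OF ad(2)] map_toA_homog[OF ad(3)]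
          map_toA_homog[OF ad(4)] toM_homog[OF ad(5)] del: in_lists_conv_set)
    let ?\<phi> = "el_mod e H (map toA b) (toM x) (map toA c)"
    have \<phi>0: "snd ?\<phi> 0 = 0"
      using dual_gr_0[OF graded_M sh_mod_dual_gr[OF H h(2,5,3)]] by (simp add: el_mod_def)
    have "sh_mod (beta M) (map toA d) (k, snd (snd y)) (map toA a) = 0" if k: "snd (snd y) \<in> gr M k" for k
    \<comment> \<open>The degree \<open>k\<close> is dictated by the functional and may differ from
      that of \<open>y\<close>; in that case \<open>y\<close> has to be zero.\<close>
    proof (cases "k = snd (fst y) + 1")
      case True
      then have "op (d @ y # a) = (0, sh_mod (beta M) (map toA d) (k, snd (snd y)) (map toA a))"
        using joint_mod[of d y a "mu A" "beta M"] 0 y(2) by (simp add: toM_def)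
      with zy[OF ls_rs] show ?thesis by (simp add: zero_prod_def)
    next
      case False
      have "snd (snd y) \<in> gr M (snd (fst y) + 1)" using y by (auto simp: comb_def)
      with False k have "snd (snd y) = 0" using gr_disjoint[OF graded_M] by blast
      then show ?thesis
        using additive_on_0[OF sh_mod_additive[OF beta_family h(4,1)] gr_0[OF graded_M]] by simp
    qed
    with \<phi>0 show ?thesis by (simp add: sh_dual_beta_def Let_def)
  qed
  then have "(\<Sum>(a, b)\<in>split2 ls. \<Sum>(c, d)\<in>split2 rs. ksign (e * snd (wt a))
      (sh_dual_beta M (map toA a) (el_mod e H (map toA b) (toM x) (map toA c)) (map toA d) (snd (snd y)))) = 0"
    by (intro sum.neutral) (auto simp: split2_def intro!: sum.neutral)
  moreover have "comp_beta A M H (map toA ls) (toM x) (map toA rs) = 0"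
    using H w z by (rule comp_beta_eq_0)
  ultimately show ?thesis
    unfolding delta_def
    by (intro trans[OF fun_cong[OF sh_mod_def]]) (simp add: ksign_apply sum_split2_conv take_map drop_map
        hom_sum[of "\<lambda>\<phi>. \<phi> (snd (snd y))"])
qed

end

text \<open>The pullback differs from \<open>J\<close> by an exact term; \<open>J\<close> is zero at
  this word by hypothesis and the exact term by \<open>delta_dual_eq_0\<close>. The condition
  \<open>deg\<close> ensures that the pulled back functional is evaluated in its own degree, where
  the displayed sum computes it.\<close>

lemma pullback_eq_0:
  fixes B :: "('r::comm_ring_1, 'b::ab_group_add) ainf_algebra" and N :: "('r, 'b, 'n::ab_group_add) ainf_module"
  assumes B: "is_ainf_algebra B" and N: "is_ainf_module B N"
    and ex: "is_exact_inner_product B N (\<lambda>as m bs. pullback N g G e I as m bs - J as m bs)"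
    and J: "J (map toA ls) (toM x) (map toA rs) = 0"
    and w: "adm_word B N (ls @ x # rs)" "fst (wt ls) = 0" "fst (fst x) = 1" "fst (wt rs) = 0"
    and y: "snd y \<in> comb B N (fst y)" "fst (fst y) = 1"
    and deg: "snd (wt (ls @ x # rs)) + snd (fst y) = - e - 2"
    and z: "\<And>u v y. u @ v @ y = ls @ x # rs \<Longrightarrow> v \<noteq> [] \<Longrightarrow> joint (mu B) (beta N) v = 0"
    and zy: "\<And>a b c d. ls = a @ b \<Longrightarrow> rs = c @ d \<Longrightarrow> joint (mu B) (beta N) (d @ y # a) = 0"
  shows "(\<Sum>(a, b)\<in>split2 ls. \<Sum>(c, d)\<in>split2 rs.
      ksign (snd (wt a) * (snd (wt (b @ x # c)) + snd (wt d) + snd (fst y)))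
        (push g 0 G I (map toA b) (toM x) (map toA c) (sh_mod G (map toA d) (toM y) (map toA a)))) = 0"
proof -
  interpret ainf_module_pair B N using B N by unfold_locales
  have h: "map toA ls \<in> lists (homog B)" "toM x \<in> homog N" "map toA rs \<in> lists (homog B)"
    using w map_toA_homog[of B N ls] map_toA_homog[of B N rs] toM_homog[of x B N] by simp_all
  from ex obtain e' H where H: "mod_family B N (dual N) (e' - 1) H"
    and eq: "\<forall>as\<in>lists (homog B). \<forall>m\<in>homog N. \<forall>bs\<in>lists (homog B).
      pullback N g G e I as m bs - J as m bs = delta B N (dual N) (e' - 1) H as m bs"
    unfolding is_exact_inner_product_def by blast
  have "pullback N g G e I (map toA ls) (toM x) (map toA rs) (snd (snd y)) = 0"
    using eq[rule_format, OF h] J delta_dual_eq_0[OF H w y z zy] by simp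
  moreover have D: "- (snd (wt ls) + snd (fst x) + snd (wt rs) + e + 1) = snd (fst y) + 1"
    using deg by simp
  have "snd (snd y) \<in> gr N (snd (fst y) + 1)" using y by (auto simp: comb_def)
  then have "pullback N g G e I (map toA ls) (toM x) (map toA rs) (snd (snd y))
    = ksign (desusp (map sdeg (map toA ls) @ sdeg (toM x) # map sdeg (map toA rs)))
      (\<Sum>(a, b)\<in>split2 ls. \<Sum>(c, d)\<in>split2 rs.
      ksign (snd (wt a) * (snd (wt b) + snd (fst x) + snd (wt rs) + snd (fst y)))
        (push g 0 G I (map toA b) (toM x) (map toA c) (sh_mod G (map toA d) (toM y) (map toA a))))"
    unfolding pullback_def
    by (intro trans[OF fun_cong[OF sh_mod_def]]) (simp only: ksign_apply sdegs_map_toA sdeg_toM D Let_def if_True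
      sum_split2_conv take_map drop_map length_map toM_def[of y, symmetric])
  ultimately have "(\<Sum>(a, b)\<in>split2 ls. \<Sum>(c, d)\<in>split2 rs.
      ksign (snd (wt a) * (snd (wt b) + snd (fst x) + snd (wt rs) + snd (fst y)))
        (push g 0 G I (map toA b) (toM x) (map toA c) (sh_mod G (map toA d) (toM y) (map toA a)))) = 0"
    by simp
  moreover have "(\<Sum>(a, b)\<in>split2 ls. \<Sum>(c, d)\<in>split2 rs.
      ksign (snd (wt a) * (snd (wt (b @ x # c)) + snd (wt d) + snd (fst y)))
        (push g 0 G I (map toA b) (toM x) (map toA c) (sh_mod G (map toA d) (toM y) (map toA a))))
    = (\<Sum>(a, b)\<in>split2 ls. \<Sum>(c, d)\<in>split2 rs.
      ksign (snd (wt a) * (snd (wt b) + snd (fst x) + snd (wt rs) + snd (fst y)))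
        (push g 0 G I (map toA b) (toM x) (map toA c) (sh_mod G (map toA d) (toM y) (map toA a))))"
    by (rule sum2_cong, rule sum2_cong) (auto simp: split2_def add_ac)
  ultimately show ?thesis by simp
qed

lemma joint_binary_eq_0:
  assumes "has_only_binary_structure B N J" "adm_word B N v" "v \<noteq> []" "length v \<noteq> 2"
  shows "joint (mu B) (beta N) v = 0"
proof -
  consider "fst (wt v) = 0" | "fst (wt v) = 1" | "fst (wt v) \<ge> 2" by linarith
  then show ?thesis
  proof cases
    case 1
    then have "mu B (map toA v) = 0"
      using assms map_toA_homog[OF assms(2) 1] unfolding has_only_binary_structure_def by simp
    with 1 show ?thesis by (simp add: joint_alg sh_alg_def zero_prod_def)
  next
    case 2
    with assms(2) obtain ls x rs where w: "v = ls @ x # rs" "fst (wt ls) = 0" "fst (fst x) = 1" "fst (wt rs) = 0"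
      "map toA ls \<in> lists (homog B)" "toM x \<in> homog N" "map toA rs \<in> lists (homog B)" by (rule adm_wordE)
    then have "beta N (map toA ls) (toM x) (map toA rs) = 0"
      using assms(1,4) unfolding has_only_binary_structure_def by simp
    with w show ?thesis by (simp add: joint_mod sh_mod_def zero_prod_def)
  qed (simp add: joint_def)
qed

text \<open>The induced maps fix the class of \<open>v\<close>, and \<open>g (k, h (k, v))\<close>
  is a member of the class so obtained.\<close>

lemma inverse_on_cohomology_homologous:
  assumes inv: "inverse_on_cohomology V D W E h g"
    and 0: "\<And>k. 0 \<in> gr V k" "\<And>k. D (k, 0) = 0" "\<And>k. 0 \<in> gr W k" "\<And>k. E (k, 0) = 0"
    and v: "v \<in> cocycles V D k" "h (k, v) \<in> cocycles W E k" "g (k, h (k, v)) \<in> cocycles V D k"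
  obtains u where "u \<in> gr V (k - 1)" "v = g (k, h (k, v)) + D (k - 1, u)"
proof -
  let ?X = "cohomologous V D k `` {v}"
  have refl: "(x, x) \<in> cohomologous V D k" if "x \<in> cocycles V D k" for x
    using that 0 by (auto simp: cohomologous_def intro: bexI[of _ 0])
  have refl': "(x, x) \<in> cohomologous W E k" if "x \<in> cocycles W E k" for x
    using that 0 by (auto simp: cohomologous_def intro: bexI[of _ 0])
  have X: "?X \<in> cohomology V D k" using v by (auto simp: cohomology_def quotient_def)
  have "h (k, v) \<in> induced W E k h ?X" using refl[OF v(1)] refl'[OF v(2)] by (auto simp: induced_def)
  then have "g (k, h (k, v)) \<in> induced V D k g (induced W E k h ?X)"
    using refl[OF v(3)] by (auto simp: induced_def[of V])
  then have "g (k, h (k, v)) \<in> ?X" using inv X by (simp add: inverse_on_cohomology_def)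
  then obtain u where "u \<in> gr V (k - 1)" "v - g (k, h (k, v)) = D (k - 1, u)"
    by (auto simp: cohomologous_def)
  with that show thesis by (metis add.commute diff_eq_eq)
qed

section \<open>Transfer through a formal model\<close>

text \<open>The index intervals of a cyclic defining system, both families together: the intervals with \<open>n\<close>
  belong to the second one, and on those with neither \<open>z\<close> nor \<open>n\<close> the families agree.\<close>

definition cyc_factors :: "'p list \<Rightarrow> 'p \<Rightarrow> 'p list \<Rightarrow> 'p \<Rightarrow> 'p list set" where
  "cyc_factors ca z cb n = {b. b \<noteq> [] \<and> (\<exists>u v. u @ b @ v = ca @ z # cb \<or> u @ b @ v = cb @ n # ca)}"

lemma cyc_factors_factor:
  assumes "a @ b @ d \<in> cyc_factors ca z cb n" "b \<noteq> []"
  shows "b \<in> cyc_factors ca z cb n"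
proof -
  from assms(1) obtain u v where "u @ (a @ b @ d) @ v = ca @ z # cb \<or> u @ (a @ b @ d) @ v = cb @ n # ca"
    unfolding cyc_factors_def by blast
  then have "(u @ a) @ b @ (d @ v) = ca @ z # cb \<or> (u @ a) @ b @ (d @ v) = cb @ n # ca" by simp
  with assms(2) show ?thesis unfolding cyc_factors_def by blast
qed

lemma cyc_factors_distinct:
  assumes "distinct (ca @ z # cb @ [n])" "b \<in> cyc_factors ca z cb n"
  shows "distinct b"
proof -
  from assms(2) obtain u v where "u @ b @ v = ca @ z # cb \<or> u @ b @ v = cb @ n # ca"
    unfolding cyc_factors_def by blast
  moreover have "distinct (ca @ z # cb)" "distinct (cb @ n # ca)" using assms(1) by auto
  ultimately show ?thesis by (metis distinct_append)
qed

lemma cyc_factorsI: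
  "u @ b @ v = ca @ z # cb \<Longrightarrow> b \<noteq> [] \<Longrightarrow> b \<in> cyc_factors ca z cb n"
  "u @ b @ v = cb @ n # ca \<Longrightarrow> b \<noteq> [] \<Longrightarrow> b \<in> cyc_factors ca z cb n"
  unfolding cyc_factors_def by blast+

lemma cyc_factors_singleton:
  assumes "i \<in> set (ca @ z # cb @ [n])"
  shows "[i] \<in> cyc_factors ca z cb n"
proof -
  from assms consider "i \<in> set (ca @ z # cb)" | "i = n" by auto
  then show ?thesis
  proof cases
    case 1
    then obtain u v where "ca @ z # cb = u @ [i] @ v" by (metis append_Cons append_Nil split_list)
    then show ?thesis by (intro cyc_factorsI(1)[of u _ v]) auto
  next
    case 2
    then show ?thesis by (intro cyc_factorsI(2)[of cb _ ca]) auto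
  qed
qed

lemma cyc_factors_subset: "b \<in> cyc_factors ca z cb n \<Longrightarrow> set b \<subseteq> set (ca @ z # cb @ [n])"
proof -
  assume "b \<in> cyc_factors ca z cb n"
  then obtain u v where "u @ b @ v = ca @ z # cb \<or> u @ b @ v = cb @ n # ca"
    unfolding cyc_factors_def by blast
  then have "set (u @ b @ v) = set (ca @ z # cb) \<or> set (u @ b @ v) = set (cb @ n # ca)" by metis
  then show ?thesis by auto
qed

text \<open>A middle interval inside \<open>ca\<close> or \<open>cb\<close> carries no module entry
  and contributes nothing, so only middle intervals around \<open>z\<close> remain.\<close>

lemma (in ainf_triple) pairval_mid:
  fixes \<tau> :: "'p \<Rightarrow> tag"
  assumes "fst (sum_list (map \<tau> ca)) = 0" "fst (sum_list (map \<tau> cb)) = 0"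
  defines "s \<equiv> \<lambda>c. snd (sum_list (map \<tau> c))"
  shows "pairval pair_word \<tau> X (ca @ z # cb) n = (\<Sum>(a, b)\<in>split2 ca. \<Sum>(c, d)\<in>split2 cb.
    ksign (s a * (s (b @ z # c) + s d + snd (\<tau> n)))
      (ev (blk \<tau> X) (b @ z # c) (\<lambda>w. pair_word w (X (d @ n # a)))))"
proof -
  let ?F = "\<lambda>c1 c2 c3. ksign (s c1 * (s c2 + s c3 + snd (\<tau> n)))
    (ev (blk \<tau> X) c2 (\<lambda>w. pair_word w (X (c3 @ n # c1))))"
  have out: "ev (blk \<tau> X) b (\<lambda>w. pair_word w x) = 0" if "fst (sum_list (map \<tau> b)) = 0" for b x
  proof -
    have "ev (blk \<tau> X) b (\<lambda>w. pair_word w x) = ev (blk \<tau> X) b (\<lambda>w. 0)"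
      by (intro ev_cong refl) (simp add: pair_word_def wt_blk that)
    then show ?thesis by simp
  qed
  have "pairval pair_word \<tau> X (ca @ z # cb) n
    = (\<Sum>(a, b, d)\<in>split3 ca. ?F a b (d @ z # cb))
    + (\<Sum>(a, b)\<in>split2 ca. \<Sum>(c, d)\<in>split2 cb. ?F a (b @ z # c) d)
    + (\<Sum>(a, b, d)\<in>split3 cb. ?F (ca @ z # a) b d)"
    unfolding pairval_def s_def by (rule sum_split3_pivot)
  also have "(\<Sum>(a, b, d)\<in>split3 ca. ?F a b (d @ z # cb)) = 0"
    using assms(1) by (intro sum.neutral) (auto simp: split3_def intro!: out)
  also have "(\<Sum>(a, b, d)\<in>split3 cb. ?F (ca @ z # a) b d) = 0"
    using assms(2) by (intro sum.neutral) (auto simp: split3_def intro!: out)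
  finally show ?thesis by simp
qed

lemma map_eq_factorsE:
  assumes "map f c = u @ v @ x"
  obtains u' v' x' where "c = u' @ v' @ x'" "u = map f u'" "v = map f v'" "x = map f x'"
  using assms by (metis map_eq_append_conv)

locale formality = ainf_triple A M e I
  for A :: "('r::comm_ring_1, 'a::ab_group_add) ainf_algebra" and M :: "('r, 'a, 'm::ab_group_add) ainf_module"
    and e I +
  fixes B :: "('r, 'b::ab_group_add) ainf_algebra" and N :: "('r, 'b, 'n::ab_group_add) ainf_module"
    and J :: "('b, 'n, 'n \<Rightarrow> 'r) mod_maps"
    and f :: "('a, 'b) alg_maps" and F :: "('a, 'm, 'n) mod_maps"
    and g :: "('b, 'a) alg_maps" and G :: "('b, 'n, 'm) mod_maps"
  assumes algebra_B: "is_ainf_algebra B" and module_N: "is_ainf_module B N"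
    and binary: "has_only_binary_structure B N J"
    and f: "is_alg_morphism A B f" and F: "is_mod_morphism A M N f 0 F"
    and g: "is_alg_morphism B A g" and G: "is_mod_morphism B N M g 0 G"
    and exact: "is_exact_inner_product B N (\<lambda>as m bs. pullback N g G e I as m bs - J as m bs)"
    and inv_alg: "inverse_on_cohomology A (d_alg A) B (d_alg B) (\<lambda>x. f [x]) (\<lambda>x. g [x])"
    and inv_mod: "inverse_on_cohomology M (d_mod M) N (d_mod N) (\<lambda>x. F [] x []) (\<lambda>x. G [] x [])"
begin

sublocale BN: ainf_module_pair B N
  using algebra_B module_N by unfold_locales

abbreviation "\<phi> \<equiv> joint f F"
abbreviation "\<gamma> \<equiv> joint g G"

lemma families: "alg_family A B 1 f" "mod_family A M N 0 F" "alg_family B A 1 g" "mod_family B N M 0 G"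
  using f F g G by (simp_all add: is_alg_morphism_def is_mod_morphism_def)

lemma \<phi>_closed: "adm_word A M w \<Longrightarrow> w \<noteq> [] \<Longrightarrow> \<phi> w \<in> comb B N (wt w)"
  using joint_closed[OF BN.graded_A BN.graded_M _ families(2), of f w] families(1)
  by (simp flip: zero_prod_def)

lemma \<gamma>_closed: "adm_word B N w \<Longrightarrow> w \<noteq> [] \<Longrightarrow> \<gamma> w \<in> comb A M (wt w)"
  using joint_closed[OF graded_A graded_M _ families(4), of g w] families(3)
  by (simp flip: zero_prod_def)

text \<open>The linear part commutes with differentials, and the differential of the model is
  zero.\<close>

lemma \<phi>_d: assumes "adm_word A M [y]" shows "\<phi> [ell 1 op [y]] = 0"
proof -
  have "\<phi> [ell 1 op [y]] = ins op \<phi> [y]"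
    by (simp add: ins_def sum_split3_singleton ell_def)
  also have "\<dots> = BN.op [ell 0 \<phi> [y]]"
    using joint_morphism[OF f F assms] by (simp add: sum_cuts_singleton)
  also have "\<dots> = 0"
    using \<phi>_closed[OF assms] by (intro joint_binary_eq_0[OF binary]) (simp_all add: ell_def flip: zero_prod_def)
  finally show ?thesis .
qed

text \<open>The product of \<open>x\<close> and \<open>y\<close> is exact, and the differentials of the target vanish.\<close>

lemma product_eq_0:
  assumes xy: "adm_word A M [x, y]" "op [x] = 0" "op [y] = 0"
    and v: "v \<in> comb A M (fst x + fst y)" "op [x, y] + op [(fst x + fst y, v)] = 0"
  shows "BN.op [(fst x, \<phi> [x]), (fst y, \<phi> [y])] = 0"
proof -
  let ?t = "fst x + fst y + (0, 1)" and ?y = "(fst x + fst y, v)"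
  have "\<phi> [(?t, op [x, y])] = 0"
  proof -
    have "\<phi> [(?t, op [?y])] = 0" using \<phi>_d[of ?y] v(1) by (simp add: ell_def)
    moreover have "op [x, y] = - op [?y]" using v(2) by (simp add: eq_neg_iff_add_eq_0)
    moreover have "op [?y] \<in> comb A M ?t" using m_closed[of "[?y]"] v(1) by (simp add: adm_conv)
    ultimately show ?thesis
      using additive_on_minus[OF joint_additive[OF families(1,2), of "[]" "[]" ?t]] by simp
  qed
  \<comment> \<open>The morphism equation in arity two. The term with the product vanishes as just
    shown; the other two contain the differentials of \<open>x\<close> and \<open>y\<close>, which
    are zero.\<close>
  then have "ins op \<phi> [x, y] = \<phi> [(fst x + (0, 1), 0), y] + ksign (snd (fst x)) (\<phi> [x, (fst y + (0, 1), 0)])"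
    using xy by (simp add: ins_def sum_split3_pair add_ac)
  also have "\<dots> = 0"
    using additive_on_0[OF joint_additive[OF families(1,2), of "[]" "[y]"] G_0]
      additive_on_0[OF joint_additive[OF families(1,2), of "[x]" "[]"] G_0] xy(1) by simp
  finally have "BN.op [ell 0 \<phi> [x], ell 0 \<phi> [y]] + BN.op [ell 0 \<phi> [x, y]] = 0"
    using joint_morphism[OF f F xy(1)] by (simp add: sum_cuts_pair)
  moreover have "BN.op [ell 0 \<phi> [x, y]] = 0"
    using \<phi>_closed[OF xy(1)] by (intro joint_binary_eq_0[OF binary]) (simp_all add: ell_def flip: zero_prod_def)
  ultimately show ?thesis by (simp add: ell_def flip: zero_prod_def)
qed

text \<open>A letter with at most one module entry is an algebra or a module element, so one of the
  two statements on cohomology applies. The resulting \<open>h\<close> is the parameter for the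
  gauge transformation at this position.\<close>

lemma homologous_image:
  assumes x: "adm_word A M [x]" "op [x] = 0" and c: "fst (fst x) \<le> 1"
    and \<gamma>: "op [(fst x, \<gamma> [(fst x, \<phi> [x])])] = 0"
  obtains h where "h \<in> comb A M (fst (fst x), snd (fst x) - 1)"
    "snd x = \<gamma> [(fst x, \<phi> [x])] + op [((fst (fst x), snd (fst x) - 1), h)]"
proof -
  let ?k = "snd (fst x) + 1"
  have ad: "adm_word B N [(fst x, \<phi> [x])]" using \<phi>_closed[OF x(1)] by simp
  have d0: "BN.op [(fst x, \<phi> [x])] = 0" using ad by (rule joint_binary_eq_0[OF binary]) simp_all
  have \<gamma>_in: "\<gamma> [(fst x, \<phi> [x])] \<in> comb A M (fst x)" using \<gamma>_closed[OF ad] by simp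
  note \<phi>_in = \<phi>_closed[OF x(1)]
  have op0: "op [(t, 0)] = 0" "BN.op [(t, 0)] = 0" for t
    using multiadditive_0[OF m_multiadditive, of "[]" "[]" t]
      BN.multiadditive_0[OF BN.m_multiadditive, of "[]" "[]" t] by simp_all
  show thesis
  proof (cases "fst (fst x) = 0")
    case True
    obtain a d where x_eq: "x = ((0, d), (a, 0))" and a: "a \<in> gr A (d + 1)"
      using x True by (cases x) (auto simp: comb_def)
    have ev: "joint f' F' [((0, d'), (v, v'))] = (f' [(d' + 1, v)], 0)" for f' :: "('x, 'y::ab_group_add) alg_maps"
      and F' :: "('x, 'z, 'w::ab_group_add) mod_maps" and d' v v'
      by (simp add: joint_alg sh_alg_singleton toA_def)
    obtain u where u: "u \<in> gr A (d + 1 - 1)" "a = g [(d + 1, f [(d + 1, a)])] + d_alg A (d + 1 - 1, u)"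
    proof (rule inverse_on_cohomology_homologous[OF inv_alg, of a "d + 1"])
      show "d_alg A (k, 0) = 0" "d_alg B (k, 0) = 0" for k
        using op0[of "(0, k - 1)"] by (simp_all add: ev zero_prod_def d_alg_def)
    qed (use x \<gamma> d0 \<gamma>_in \<phi>_in a in \<open>simp_all add: gr_0[OF graded_A] gr_0[OF BN.graded_A] cocycles_def
        d_alg_def x_eq ev zero_prod_def comb_def\<close>)
    then show thesis
      by (intro that[of "(u, 0)"]) (simp_all add: x_eq comb_def ev d_alg_def)
  next
    case False
    with c have c1: "fst (fst x) = 1" by simp
    obtain a d where x_eq: "x = ((1, d), (0, a))" and a: "a \<in> gr M (d + 1)"
      using x c1 by (cases x) (auto simp: comb_def)
    have ev: "joint f' F' [((Suc 0, d'), (v, v'))] = (0, F' [] (d' + 1, v') [])" for f' :: "('x, 'y::ab_group_add) alg_maps"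
      and F' :: "('x, 'z, 'w::ab_group_add) mod_maps" and d' v v'
      using joint_mod[of "[]" "((Suc 0, d'), (v, v'))" "[]" f' F'] by (simp add: sh_mod_singleton toM_def)
    obtain u where u: "u \<in> gr M (d + 1 - 1)" "a = G [] (d + 1, F [] (d + 1, a) []) [] + d_mod M (d + 1 - 1, u)"
    proof (rule inverse_on_cohomology_homologous[OF inv_mod, of a "d + 1"])
      show "d_mod M (k, 0) = 0" "d_mod N (k, 0) = 0" for k
        using op0[of "(Suc 0, k - 1)"] by (simp_all add: ev zero_prod_def d_mod_def)
    qed (use x \<gamma> d0 \<gamma>_in \<phi>_in a in \<open>simp_all add: gr_0[OF graded_M] gr_0[OF BN.graded_M] cocycles_def
        d_mod_def x_eq ev zero_prod_def comb_def\<close>)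
    then show thesis
      by (intro that[of "(0, u)"]) (simp_all add: x_eq comb_def ev d_mod_def)
  qed
qed

end

text \<open>\<open>X0\<close> is the family of the given defining system, and \<open>xl\<close>
  lists the input elements as letters. \<open>total\<close> fixes the one total degree in which the
  pairing can be nonzero.\<close>

locale formality_cyclic = formality +
  fixes ca z cb n xl X0
  assumes distinct: "distinct (ca @ z # cb @ [n])" and nontrivial: "ca @ cb \<noteq> []"
    and count: "i \<in> set (ca @ z # cb @ [n]) \<Longrightarrow> fst (fst (xl i)) = (if i = z \<or> i = n then 1 else 0)"
    and total: "sum_list (map (\<lambda>i. snd (fst (xl i))) (ca @ z # cb @ [n])) = - e - 2"
    and X0: "mc_family (comb A M) op (\<lambda>i. fst (xl i)) X0 (cyc_factors ca z cb n)"
    and X0_singleton: "i \<in> set (ca @ z # cb @ [n]) \<Longrightarrow> X0 [i] = snd (xl i)"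
begin

abbreviation "S \<equiv> cyc_factors ca z cb n"
abbreviation "\<tau> \<equiv> \<lambda>i. fst (xl i)"
abbreviation "P \<equiv> set (ca @ z # cb @ [n])"
abbreviation "T c \<equiv> sum_list (map \<tau> c)"
abbreviation "mc X \<equiv> mc_family (comb A M) op \<tau> X S"
abbreviation "pv X \<equiv> pairval pair_word \<tau> X (ca @ z # cb) n"

interpretation X0: mc_family "comb A M" op \<tau> X0 S by (rule X0)

lemma xl_letter: "i \<in> P \<Longrightarrow> blk \<tau> X0 [i] = xl i"
  using X0_singleton by (cases "xl i") (simp add: blk_def)

lemma xl_adm: "i \<in> P \<Longrightarrow> snd (xl i) \<in> comb A M (fst (xl i))"
  using X0.X_closed[OF cyc_factors_singleton, of i] X0_singleton by simp

lemma xl_cocycle: "i \<in> P \<Longrightarrow> op [xl i] = 0"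
  using X0.mc[OF cyc_factors_singleton, of i] xl_letter by (simp add: ev_def sum_cuts_singleton)

definition "zl i = (\<tau> i, \<phi> [xl i])"

lemma fst_zl [simp]: "fst (zl i) = \<tau> i" by (simp add: zl_def)

lemma wt_zl [simp]: "wt (map zl b) = T b"
  by (simp add: wt_def comp_def)

lemma zl_adm: "i \<in> P \<Longrightarrow> snd (zl i) \<in> comb B N (fst (zl i))"
  using \<phi>_closed[of "[xl i]"] xl_adm[of i] by (simp add: zl_def)

lemma map_zl_adm: "set b \<subseteq> P \<Longrightarrow> adm_word B N (map zl b)"
  using zl_adm by (auto simp: adm_word_def)

text \<open>Products of two neighbours vanish because the entry of \<open>X0\<close> over them makes
  the product of the originals exact; in all other arities the model has no operation.\<close>

lemma op_zl_eq_0: assumes b: "b \<in> S" shows "BN.op (map zl b) = 0"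
proof (cases "length b = 2")
  case True
  then obtain i j where ij: "b = [i, j]" by (auto simp: numeral_2_eq_2 length_Suc_conv)
  have P: "i \<in> P" "j \<in> P" using cyc_factors_subset[OF b] ij by auto
  have "op [xl i, xl j] + op [(\<tau> i + \<tau> j, X0 b)] = 0"
    using X0.mc[OF b] xl_letter[OF P(1)] xl_letter[OF P(2)] unfolding ij ev_def
    by (simp add: sum_cuts_pair) (simp add: blk_def)
  moreover have "X0 b \<in> comb A M (\<tau> i + \<tau> j)" using X0.X_closed[OF b] ij by simp
  ultimately have "BN.op [(fst (xl i), \<phi> [xl i]), (fst (xl j), \<phi> [xl j])] = 0"
    using xl_adm P xl_cocycle by (intro product_eq_0) auto
  then show ?thesis by (simp add: ij zl_def)
next
  case False
  then show ?thesis
    using b cyc_factors_subset[OF b] X0.S_nonempty[OF b]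
    by (intro joint_binary_eq_0[OF binary] map_zl_adm) auto
qed

definition "X1 b = \<gamma> (map zl b)"

lemma ell_X1: "ell 0 \<gamma> (map zl b) = blk \<tau> X1 b"
  by (simp add: ell_def blk_def X1_def flip: zero_prod_def)

text \<open>The morphism equation of \<open>\<gamma>\<close> converts the Maurer-Cartan sum into
  insertions of operations of the model on consecutive images, all of which are zero.\<close>

lemma mc_family_X1: "mc X1"
proof
  fix c assume c: "c \<in> S"
  note cP = cyc_factors_subset[OF c] note c_ne = X0.S_nonempty[OF c]
  show "X1 c \<in> comb A M (T c)"
    using \<gamma>_closed[OF map_zl_adm[OF cP]] c_ne by (simp add: X1_def)
  have "ev (blk \<tau> X1) c op = (\<Sum>cs\<in>cuts (map zl c). op (map (ell 0 \<gamma>) cs))"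
    by (simp add: ev_def sum_cuts_map ell_X1 comp_def)
  also have "\<dots> = ins BN.op \<gamma> (map zl c)"
    using joint_morphism[OF g G map_zl_adm[OF cP]] c_ne by simp
  also have "\<dots> = 0"
  proof (rule BN.ins_eq_0_factors)
    fix u v x assume uvx: "u @ v @ x = map zl c" "v \<noteq> []"
    from uvx(1)[symmetric] obtain u' v' x' where "c = u' @ v' @ x'" "v = map zl v'"
      by (rule map_eq_factorsE)
    moreover from this uvx(2) have "v' \<noteq> []" by simp
    ultimately show "BN.op v = 0" using op_zl_eq_0 X0.S_factor c by blast
  qed (use joint_additive[OF families(3,4)] map_zl_adm[OF cP] in auto)
  finally show "ev (blk \<tau> X1) c op = 0" .
qed (use X0.S_nonempty X0.S_factor X0.S_distinct in auto)

text \<open>One module entry in \<open>c2\<close> means that \<open>z\<close> lies in it, so what is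
  left of both sides belongs to \<open>cb\<close> and \<open>ca\<close> and joins up through
  \<open>n\<close>.\<close>

lemma rest_in_S:
  assumes "c1 @ c2 @ c3 = ca @ z # cb" "fst (T c2) = 1"
  shows "c3 @ n # c1 \<in> S"
proof -
  have c2: "set c2 \<subseteq> P" using arg_cong[OF assms(1), of set] by auto
  have "z \<in> set c2"
  proof (rule ccontr)
    assume "z \<notin> set c2"
    moreover have "n \<notin> set c2" using arg_cong[OF assms(1), of set] distinct by auto
    ultimately have "\<forall>i\<in>set c2. fst (\<tau> i) = 0" using c2 count by auto
    then have "fst (T c2) = 0" by (induction c2) auto
    with assms(2) show False by simp
  qed
  then obtain d1 d2 where c2': "c2 = d1 @ z # d2" by (meson split_list)
  have "distinct (ca @ z # cb)" using distinct by auto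
  moreover have "(c1 @ d1) @ z # (d2 @ c3) = ca @ z # cb" using assms(1) c2' by simp
  \<comment> \<open>\<open>z\<close> occurs only once, so the two decompositions around it
    agree.\<close>
  ultimately have "c1 @ d1 = ca" "d2 @ c3 = cb"
    using append_Cons_eq_iff[of z "c1 @ d1" "d2 @ c3" ca cb] by (metis distinct_append not_distinct_conv_prefix append_eq_append_conv2 disjoint_iff list.set_intros(1) Un_iff set_append distinct.simps(2))+
  then have "d2 @ (c3 @ n # c1) @ d1 = cb @ n # ca" by auto
  then show ?thesis by (rule cyc_factorsI(2)) simp
qed

lemma fst_sum_eq_0: "set b \<subseteq> P \<Longrightarrow> z \<notin> set b \<Longrightarrow> n \<notin> set b \<Longrightarrow> fst (T b) = 0"
  by (induction b) (auto simp: count)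

text \<open>Cutting the interval around \<open>z\<close> gives \<open>push\<close> of
  \<open>I\<close> along the morphism back, and the interval through \<open>n\<close> gives its
  second argument. The total is the pullback at the images of the inputs, where
  \<open>pullback_eq_0\<close> applies since \<open>nontrivial\<close> makes \<open>J\<close>
  vanish.\<close>

lemma pairval_X1: "pv X1 = 0"
proof -
  have ca: "set ca \<subseteq> P" "z \<notin> set ca" "n \<notin> set ca" and cb: "set cb \<subseteq> P" "z \<notin> set cb" "n \<notin> set cb"
    and zn: "z \<in> P" "n \<in> P"
    using distinct by auto
  have "pv X1
    = (\<Sum>(a, b)\<in>split2 (map zl ca). \<Sum>(c, d)\<in>split2 (map zl cb).
      ksign (snd (wt a) * (snd (wt (b @ zl z # c)) + snd (wt d) + snd (fst (zl n))))
        (push g 0 G I (map toA b) (toM (zl z)) (map toA c) (sh_mod G (map toA d) (toM (zl n)) (map toA a))))"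
    unfolding sum_split2_map pairval_mid[OF fst_sum_eq_0[OF ca] fst_sum_eq_0[OF cb]]
  proof (rule sum2_cong, rule sum2_cong, goal_cases)
    case (1 a b c d)
    then have abcd: "ca = a @ b" "cb = c @ d" by (auto simp: split2_def)
    have 0: "fst (wt (map zl a)) = 0" "fst (wt (map zl b)) = 0" "fst (wt (map zl c)) = 0" "fst (wt (map zl d)) = 0"
    proof -
      have "set a \<subseteq> set ca" "set b \<subseteq> set ca" "set c \<subseteq> set cb" "set d \<subseteq> set cb" using abcd by auto
      with ca cb show "fst (wt (map zl a)) = 0" "fst (wt (map zl b)) = 0" "fst (wt (map zl c)) = 0" "fst (wt (map zl d)) = 0"
        unfolding wt_zl by (intro fst_sum_eq_0; blast)+
    qed
    have n1: "fst (fst (zl n)) = 1" "fst (fst (zl z)) = 1" using zn count by auto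
    have X1n: "snd (X1 (d @ n # a)) = sh_mod G (map toA (map zl d)) (toM (zl n)) (map toA (map zl a))"
      using joint_mod[OF 0(4) n1(1) 0(1), of g G] by (simp add: X1_def)
    have "ev (blk \<tau> X1) (b @ z # c) (\<lambda>w. pair_word w x)
      = push g 0 G I (map toA (map zl b)) (toM (zl z)) (map toA (map zl c)) (snd x)" for x
    proof -
      have "ev (blk \<tau> X1) (b @ z # c) (\<lambda>w. pair_word w x)
        = ev (blk \<tau> X1) (b @ z # c) (\<lambda>w. modw (sh_mod I) w (snd x))"
        using 0 n1 by (intro ev_cong refl) (simp add: pair_word_def wt_blk)
      also have "\<dots> = (\<Sum>cs\<in>cuts (map zl b @ zl z # map zl c). modw (sh_mod I) (map (ell 0 \<gamma>) cs)) (snd x)"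
        unfolding list.map(2)[symmetric] map_append[symmetric] sum_cuts_map
        by (simp add: ev_def hom_sum[of "\<lambda>\<psi>. \<psi> (snd x)"] ell_X1 comp_def)
      also have "\<dots> = push g 0 G I (map toA (map zl b)) (toM (zl z)) (map toA (map zl c)) (snd x)"
        by (subst sum_cuts_modw[OF 0(2) n1(2) 0(3)]) simp_all
      finally show ?thesis .
    qed
    then show ?case unfolding X1n[symmetric] by simp
  qed
  also have "\<dots> = 0"
  proof (rule pullback_eq_0[OF algebra_B module_N exact])
    have "fst (wt (map zl ca)) = 0" "fst (wt (map zl cb)) = 0"
      using ca cb by (auto intro!: fst_sum_eq_0)
    moreover from this show "fst (wt (map zl ca)) = 0" "fst (wt (map zl cb)) = 0" .
    ultimately show "J (map toA (map zl ca)) (toM (zl z)) (map toA (map zl cb)) = 0"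
      using binary nontrivial map_toA_homog[OF map_zl_adm[OF ca(1)]] map_toA_homog[OF map_zl_adm[OF cb(1)]]
        toM_homog[OF zl_adm[OF zn(1)]] count[OF zn(1)]
      unfolding has_only_binary_structure_def by auto
    show "adm_word B N (map zl ca @ zl z # map zl cb)"
      using map_zl_adm[OF ca(1)] map_zl_adm[OF cb(1)] zl_adm[OF zn(1)] by simp
    show "fst (fst (zl z)) = 1" "fst (fst (zl n)) = 1" using count zn by auto
    show "snd (zl n) \<in> comb B N (fst (zl n))" by (rule zl_adm[OF zn(2)])
    have "snd (T b) = sum_list (map (\<lambda>i. snd (\<tau> i)) b)" for b by (induction b) auto
    then show "snd (wt (map zl ca @ zl z # map zl cb)) + snd (fst (zl n)) = - e - 2"
      using total by simp
    fix u v y assume "u @ v @ y = map zl ca @ zl z # map zl cb" "v \<noteq> []"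
    then have "map zl (ca @ z # cb) = u @ v @ y" by simp
    then obtain u' v' y' where "ca @ z # cb = u' @ v' @ y'" "v = map zl v'"
      by (rule map_eq_factorsE)
    moreover from this \<open>v \<noteq> []\<close> have "v' \<noteq> []" by simp
    ultimately show "BN.op v = 0" using op_zl_eq_0[OF cyc_factorsI(1)[of u' v' y']] by simp
  next
    fix a b c d assume "map zl ca = a @ b" "map zl cb = c @ d"
    then obtain a' b' c' d' where *: "ca = a' @ b'" "a = map zl a'" "cb = c' @ d'" "d = map zl d'"
      by (auto simp: map_eq_append_conv)
    then have "d' @ n # a' \<in> S" by (intro cyc_factorsI(2)[of c' _ b']) auto
    from op_zl_eq_0[OF this] show "BN.op (d @ zl n # a) = 0" by (simp add: *)
  qed
  finally show ?thesis by simp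
qed

text \<open>Induction on the set \<open>Q\<close> of positions already carrying the prescribed
  element. A position outside \<open>Q\<close> still has its entry from \<open>X1\<close>, and
  \<open>homologous_image\<close> supplies the \<open>h\<close> whose differential makes up the
  difference.\<close>

theorem exists_family_pairval_0:
  "\<exists>X. mc X \<and> (\<forall>i\<in>P. X [i] = snd (xl i))
    \<and> pv X = 0"
proof -
  have "\<exists>X. mc X \<and> pv X = 0
      \<and> (\<forall>i\<in>P. X [i] = (if i \<in> Q then snd (xl i) else X1 [i]))" if "finite Q" "Q \<subseteq> P" for Q
    using that
  proof (induction Q rule: finite_induct)
    case empty
    then show ?case using mc_family_X1 pairval_X1 by (intro exI[of _ X1]) simp
  next
    case (insert j Q)
    then obtain X where X: "mc X" "pv X = 0"
      "\<forall>i\<in>P. X [i] = (if i \<in> Q then snd (xl i) else X1 [i])" by blast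
    have j: "j \<in> P" using insert.prems by simp
    interpret X1: mc_family "comb A M" op \<tau> X1 S by (rule mc_family_X1)
    have "adm_word A M [xl j]" "op [xl j] = 0" "fst (\<tau> j) \<le> 1"
      using xl_adm[OF j] xl_cocycle[OF j] count[OF j] by simp_all
    moreover have "op [(\<tau> j, \<gamma> [(\<tau> j, \<phi> [xl j])])] = 0"
      using X1.mc[OF cyc_factors_singleton[OF j]] by (simp add: ev_def sum_cuts_singleton blk_def X1_def zl_def)
    ultimately obtain h where h: "h \<in> comb A M (fst (\<tau> j), snd (\<tau> j) - 1)"
      "snd (xl j) = \<gamma> [(\<tau> j, \<phi> [xl j])] + op [((fst (\<tau> j), snd (\<tau> j) - 1), h)]"
      by (rule homologous_image)
    interpret X: mc_family "comb A M" op \<tau> X S by (rule X(1))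
    have "fst (T ca) = 0" "fst (T cb) = 0"
      using distinct by (auto intro!: fst_sum_eq_0)
    moreover have "snd (T b) = sum_list (map (\<lambda>i. snd (\<tau> i)) b)" for b by (induction b) auto
    ultimately interpret pairing_gauge "comb A M" op \<tau> X S j h pair_word "(2, - e - 2)" "ca @ z # cb" n
      using h distinct count[of z] count[of n] total
      by unfold_locales (auto simp: prod_eq_iff intro: cyc_factorsI(1)[of "[]" _ "[]"] rest_in_S)
    have "j \<in> set (ca @ z # cb) \<or> j = n" using j by auto
    from pairval_Y[OF this] X(2) have "pv Y = 0" by simp
    moreover have "\<forall>i\<in>P. Y [i] = (if i \<in> insert j Q then snd (xl i) else X1 [i])"
      using X(3) h(2) insert.hyps j by (auto simp: Y_singleton X1_def zl_def)
    ultimately show ?case using mc_family_Y by blast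
  qed
  from this[OF finite_set subset_refl] obtain X where "mc X"
    "pv X = 0" "\<forall>i\<in>P. X [i] = (if i \<in> P then snd (xl i) else X1 [i])"
    by blast
  then show ?thesis by (intro exI[of _ X]) simp
qed

end

section \<open>Cyclic defining systems\<close>

text \<open>As \<open>c\<close> is distinct, exactly one block of each cut contains
  \<open>z\<close>; marking it loses and adds nothing.\<close>

lemma sum_cuts_pcuts:
  assumes "distinct c" "z \<in> set c"
  shows "(\<Sum>cs\<in>cuts c. g cs) = (\<Sum>(ls, b, rs)\<in>pcuts z c. g (ls @ b # rs))"
proof (rule sum.reindex_bij_witness[where
      i = "\<lambda>(ls, b, rs). ls @ b # rs" and
      j = "\<lambda>cs. (takeWhile (\<lambda>b. z \<notin> set b) cs, hd (dropWhile (\<lambda>b. z \<notin> set b) cs), tl (dropWhile (\<lambda>b. z \<notin> set b) cs))"],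
    goal_cases)
  case (1 cs)
  then have ex: "\<exists>b\<in>set cs. z \<in> set b" using assms(2) by (auto simp: cuts_def)
  then have "dropWhile (\<lambda>b. z \<notin> set b) cs \<noteq> []" by (auto simp: dropWhile_eq_Nil_conv)
  then show ?case by simp
next
  case (2 cs)
  then have ex: "\<exists>b\<in>set cs. z \<in> set b" using assms(2) by (auto simp: cuts_def)
  then have ne: "dropWhile (\<lambda>b. z \<notin> set b) cs \<noteq> []" by (auto simp: dropWhile_eq_Nil_conv)
  from hd_dropWhile[OF this] ne 2 show ?case by (simp add: pcuts_def)
next
  case (3 t)
  then obtain ls b rs where t: "t = (ls, b, rs)" "ls @ b # rs \<in> cuts c" "z \<in> set b"
    by (auto simp: pcuts_def)
  then have "concat ls @ b @ concat rs = c" by (simp add: cuts_def)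
  with assms(1) t(3) have "z \<notin> set (concat ls)" by (metis disjoint_iff distinct_append set_append Un_iff)
  then have "\<forall>b\<in>set ls. z \<notin> set b" by simp
  with t show ?case by (simp add: takeWhile_append dropWhile_append)
next
  case (4 t)
  then show ?case by (auto simp: pcuts_def)
next
  case (5 cs)
  then have "\<exists>b\<in>set cs. z \<in> set b" using assms(2) by (auto simp: cuts_def)
  then have "dropWhile (\<lambda>b. z \<notin> set b) cs \<noteq> []" by (auto simp: dropWhile_eq_Nil_conv)
  then show ?case by simp
qed

lemma upt_split: "p \<le> q \<Longrightarrow> q \<le> r \<Longrightarrow> [p..<r] = [p..<q] @ [q..<r]"
  using upt_add_eq_append[of p q "r - q"] by simp

definition ofA :: "'a elem \<Rightarrow> ('a \<times> 'm::zero) letter" where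
  "ofA y = ((0, sdeg y), (snd y, 0))"

definition ofM :: "'m elem \<Rightarrow> ('a::zero \<times> 'm) letter" where
  "ofM y = ((1, sdeg y), (0, snd y))"

lemma comb_1: "fst t = 1 \<Longrightarrow> v \<in> comb A M t \<Longrightarrow> snd v \<in> gr M (snd t + 1)"
  by (auto simp: comb_def)

locale massey_input = ainf_triple A M e I
  for A :: "('r::comm_ring_1, 'a::ab_group_add) ainf_algebra" and M :: "('r, 'a, 'm::ab_group_add) ainf_module"
    and e I +
  fixes as :: "'a elem list" and m :: "'m elem" and bs :: "'a elem list" and m' :: "'m elem"
begin

declare upt_Suc [simp del]

abbreviation "k \<equiv> length as"
abbreviation "l \<equiv> length bs"
abbreviation "n \<equiv> k + l + 2"
abbreviation "z \<equiv> k + 1"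
abbreviation "ds \<equiv> xsdegs as m bs m'"
definition "ca = [1..<k + 1]"
definition "cb = [k + 2..<n]"
abbreviation "S \<equiv> cyc_factors ca z cb n"

definition "letters = map ofA as @ ofM m # map ofA bs @ [ofM m']"
definition xl :: "nat \<Rightarrow> ('a \<times> 'm) letter" where "xl i = letters ! (i - 1)"

abbreviation "\<tau> \<equiv> \<lambda>i. fst (xl i)"
abbreviation "T c \<equiv> sum_list (map \<tau> c)"
abbreviation "mc X \<equiv> mc_family (comb A M) op \<tau> X S"
abbreviation "pv X \<equiv> pairval pair_word \<tau> X (ca @ z # cb) n"
abbreviation "L \<equiv> blk \<tau>"

lemma length_ds: "length ds = n"
  by (simp add: xsdegs_def)

lemma ds_conv: "ds = map (\<lambda>x. snd (fst x)) letters"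
  by (simp add: xsdegs_def letters_def ofA_def ofM_def)

lemma length_letters: "length letters = n"
  by (simp add: letters_def)

lemma snd_\<tau>: "i \<in> {1..n} \<Longrightarrow> snd (\<tau> i) = ds ! (i - 1)"
  unfolding xl_def ds_conv by (subst nth_map) (auto simp: length_letters)

lemma fst_\<tau>: "i \<in> {1..n} \<Longrightarrow> fst (\<tau> i) = (if i = z \<or> i = n then 1 else 0)"
  by (auto simp: xl_def letters_def nth_append nth_Cons ofA_def ofM_def split: nat.split)

lemma xl_eq:
  "i \<in> {1..k} \<Longrightarrow> xl i = ofA (as ! (i - 1))" "xl z = ofM m"
  "i \<in> {k + 2..k + l + 1} \<Longrightarrow> xl i = ofA (bs ! (i - k - 2))" "xl n = ofM m'"
proof -
  assume "i \<in> {k + 2..k + l + 1}"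
  moreover from this have "i - 1 - k = Suc (i - k - 2)" by auto
  ultimately show "xl i = ofA (bs ! (i - k - 2))" by (auto simp: xl_def letters_def nth_append)
qed (auto simp: xl_def letters_def nth_append)

lemma cab: "ca @ z # cb = [1..<n]" and cba: "cb @ n # ca = [k + 2..<n + 1] @ [1..<k + 1]"
proof -
  show "ca @ z # cb = [1..<n]"
    using upt_split[of 1 "k + 1" n] by (simp add: ca_def cb_def upt_conv_Cons)
  show "cb @ n # ca = [k + 2..<n + 1] @ [1..<k + 1]"
    using upt_split[of "k + 2" n "n + 1"] by (simp add: ca_def cb_def upt_conv_Cons)
qed

lemma P: "set (ca @ z # cb @ [n]) = {1..n}"
proof -
  have "set (ca @ z # cb @ [n]) = set ((ca @ z # cb) @ [n])" by simp
  also have "\<dots> = {1..n}" unfolding cab by auto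
  finally show ?thesis .
qed

lemma distinct_positions: "distinct (ca @ z # cb @ [n])"
  by (auto simp: ca_def cb_def)

lemma ssum_eq: "set c \<subseteq> {1..n} \<Longrightarrow> ssum ds c = snd (T c)"
  by (induction c) (auto simp: ssum_def snd_\<tau>)

lemma fst_T: "distinct c \<Longrightarrow> set c \<subseteq> {1..n} \<Longrightarrow>
    fst (T c) = (if z \<in> set c then 1 else 0) + (if n \<in> set c then 1 else 0)"
  by (induction c) (auto simp: fst_\<tau>)

text \<open>A factor of \<open>[1..<n]\<close> or of \<open>[k + 2..<n + 1] @ [1..<k + 1]\<close> is
  an ordinary interval, possibly ending at \<open>n\<close>, or one that wraps around from
  \<open>n\<close> to \<open>1\<close>. In each case its endpoints determine it.\<close>

lemma S_interval:
  assumes "c \<in> S"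
  shows "seg n (hd c) (last c) = c" "n \<notin> set c \<Longrightarrow> (hd c, last c) \<in> pairs k l"
    "n \<in> set c \<Longrightarrow> (hd c, last c) \<in> pairs' k l" "z \<notin> set c \<or> n \<notin> set c"
proof -
  from assms obtain u v where ne: "c \<noteq> []" and uv: "u @ c @ v = [1..<n] \<or> u @ c @ v = [k + 2..<n + 1] @ [1..<k + 1]"
    unfolding cyc_factors_def cab cba by blast
  have c: "c = take (length c) (drop (length u) (u @ c @ v))" by simp
  have len: "length c \<ge> 1" using ne by (cases c) auto
  consider p q where "c = [p..<Suc q]" "1 \<le> p" "p \<le> q" "q < n"
    | p q where "c = [p..<Suc q]" "k + 2 \<le> p" "p \<le> q" "q \<le> n"
    | p q where "c = [p..<Suc n] @ [1..<Suc q]" "k + 2 \<le> p" "p \<le> n" "1 \<le> q" "q \<le> k"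
  proof -
    from uv show thesis
    proof
      assume eq: "u @ c @ v = [1..<n]"
      then have "length u + length c + length v = n - 1" by (metis length_append length_upt add.assoc)
      then have l: "1 + length u + length c \<le> n" by linarith
      have "c = [1 + length u..<1 + length u + length c]"
        by (subst c, subst eq) (use l in \<open>simp add: take_upt\<close>)
      with l len show thesis
        by (intro that(1)[of "1 + length u" "length u + length c"]) auto
    next
      assume eq: "u @ c @ v = [k + 2..<n + 1] @ [1..<k + 1]"
      then have "length u + length c + length v = l + 1 + k"
        by (metis (no_types, lifting) length_append length_upt add.assoc add_diff_cancel_left' add_diff_cancel_right'
            add.commute numeral_2_eq_2 plus_1_eq_Suc add_Suc_right add_Suc)
      then have l: "length u + length c \<le> l + 1 + k" by linarith
      have c': "c = take (length c) (drop (length u) [k + 2..<n + 1] @ drop (length u - (l + 1)) [1..<k + 1])"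
        by (subst c, subst eq) simp
      \<comment> \<open>The first stretch \<open>[k + 2..<n + 1]\<close> has length
        \<open>l + 1\<close>: the factor lies before its end, after it, or across it.\<close>
      consider "length u + length c \<le> l + 1" | "l + 1 \<le> length u" | "length u < l + 1" "l + 1 < length u + length c"
        by linarith
      then show thesis
      proof cases
        case 1
        then have "c = [k + 2 + length u..<k + 2 + length u + length c]"
          by (subst c') (simp add: take_upt)
        with 1 len show thesis by (intro that(2)[of "k + 2 + length u" "k + 1 + length u + length c"]) auto
      next
        case 2
        then have "c = [1 + (length u - (l + 1))..<1 + (length u - (l + 1)) + length c]"
          using l by (subst c') (simp add: take_upt)
        with 2 len l show thesis
          by (intro that(1)[of "1 + (length u - (l + 1))" "length u - (l + 1) + length c"]) auto
      next
        case 3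
        then have "c = [k + 2 + length u..<n + 1] @ [1..<1 + (length c - (l + 1 - length u))]"
          using l by (subst c') (simp add: take_upt)
        with 3 len l show thesis
          by (intro that(3)[of "k + 2 + length u" "length c - (l + 1 - length u)"]) auto
      qed
    qed
  qed
  note cs = this
  show "seg n (hd c) (last c) = c" using cs by cases (auto simp: seg_def)
  show "n \<notin> set c \<Longrightarrow> (hd c, last c) \<in> pairs k l" using cs by cases (auto simp: pairs_def)
  show "n \<in> set c \<Longrightarrow> (hd c, last c) \<in> pairs' k l" using cs by cases (auto simp: pairs'_def)
  show "z \<notin> set c \<or> n \<notin> set c" using cs by cases auto
qed

lemma seg_in_S:
  assumes "(i, j) \<in> pairs k l \<or> (i, j) \<in> pairs' k l"
  shows "seg n i j \<in> S" "hd (seg n i j) = i" "last (seg n i j) = j"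
proof -
  note split = upt_split
  consider "1 \<le> i" "i \<le> j" "j < n" | "k + 2 \<le> i" "i \<le> j" "j \<le> n" | "k + 2 \<le> i" "i \<le> n" "1 \<le> j" "j \<le> k"
    using assms by (auto simp: pairs_def pairs'_def)
  then have "seg n i j \<in> S \<and> hd (seg n i j) = i \<and> last (seg n i j) = j"
  proof cases
    case 1
    then have "[1..<i] @ [i..<Suc j] @ [Suc j..<n] = ca @ z # cb"
      unfolding cab using split[of 1 i n] split[of i "Suc j" n] by simp
    from cyc_factorsI(1)[OF this] 1 show ?thesis by (auto simp: seg_def)
  next
    case 2
    then have "[k + 2..<i] @ [i..<Suc j] @ ([Suc j..<n + 1] @ [1..<k + 1]) = cb @ n # ca"
      unfolding cba using split[of "k + 2" i "n + 1"] split[of i "Suc j" "n + 1"] by simp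
    from cyc_factorsI(2)[OF this] 2 show ?thesis by (auto simp: seg_def)
  next
    case 3
    then have "[k + 2..<i] @ ([i..<Suc n] @ [1..<Suc j]) @ [Suc j..<k + 1] = cb @ n # ca"
      unfolding cba using split[of "k + 2" i "n + 1"] split[of 1 "Suc j" "k + 1"] by simp
    from cyc_factorsI(2)[OF this] 3 show ?thesis by (auto simp: seg_def)
  qed
  then show "seg n i j \<in> S" "hd (seg n i j) = i" "last (seg n i j) = j" by blast+
qed

lemma S_subset: "c \<in> S \<Longrightarrow> set c \<subseteq> {1..n}"
  using cyc_factors_subset[of c ca z cb n] unfolding P .

lemma S_nonempty: "c \<in> S \<Longrightarrow> c \<noteq> []"
  by (simp add: cyc_factors_def)

lemma block_in_S: "c \<in> S \<Longrightarrow> cs \<in> cuts c \<Longrightarrow> b \<in> set cs \<Longrightarrow> b \<in> S \<and> set b \<subseteq> set c"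
proof -
  assume *: "c \<in> S" "cs \<in> cuts c" "b \<in> set cs"
  then obtain us vs where "cs = us @ b # vs" by (meson split_list)
  with * have "concat us @ b @ concat vs = c" "b \<noteq> []" by (auto simp: cuts_def)
  with *(1) cyc_factors_factor[of "concat us" b "concat vs" ca z cb n] show ?thesis by auto
qed

section \<open>The Maurer-Cartan equation as the defining equations of a system\<close>

lemma toA_blk: "b \<in> S \<Longrightarrow> fst (X b) = xa (hd b) (last b) \<Longrightarrow> toA (L X b) = entry ds xa b"
  by (simp add: toA_def entry_def ssum_eq[OF S_subset])

lemma toM_blk: "b \<in> S \<Longrightarrow> snd (X b) = xm (hd b) (last b) \<Longrightarrow> toM (L X b) = entry ds xm b"
  by (simp add: toM_def entry_def ssum_eq[OF S_subset])

lemma S_fst_T: "c \<in> S \<Longrightarrow> fst (T c) = (if z \<in> set c \<or> n \<in> set c then 1 else 0)"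
  using fst_T[OF cyc_factors_distinct[OF distinct_positions] S_subset] S_interval(4)[of c] by auto

lemma cuts_length_1: "cs \<in> cuts c \<Longrightarrow> c \<noteq> [] \<Longrightarrow> \<not> 2 \<le> length cs \<longleftrightarrow> cs = [c]"
  by (cases cs rule: remdups_adj.cases) (auto simp: cuts_def)

text \<open>The uncut interval contributes the differential and the proper cuts the staircase
  product, so the Maurer-Cartan equation says that the former is minus the latter.\<close>

lemma ev_alg:
  assumes c: "c \<in> S" "z \<notin> set c" "n \<notin> set c"
    and X: "\<And>b. b \<in> S \<Longrightarrow> set b \<subseteq> set c \<Longrightarrow> fst (X b) = xa (hd b) (last b)"
  shows "ev (L X) c op = (d_alg A (entry ds xa c) + stair_alg A ds xa c, 0)"
proof -
  let ?g = "\<lambda>cs. sh_alg (mu A) (map (entry ds xa) cs)"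
  have "ev (L X) c op = (\<Sum>cs\<in>cuts c. (?g cs, 0))"
    unfolding ev_def
  proof (intro sum.cong refl)
    fix cs assume cs: "cs \<in> cuts c"
    have "map (toA \<circ> L X) cs = map (entry ds xa) cs"
    proof (rule map_cong[OF refl])
      fix b assume "b \<in> set cs"
      note b = block_in_S[OF c(1) cs this]
      show "(toA \<circ> L X) b = entry ds xa b"
        using toA_blk[of b X xa, OF conjunct1[OF b] X[OF conjunct1[OF b] conjunct2[OF b]]] by simp
    qed
    moreover have "fst (wt (map (L X) cs)) = 0"
      using cs c S_fst_T[OF c(1)] by (simp add: wt_blk)
    ultimately show "op (map (L X) cs) = (?g cs, 0)"
      by (simp only: joint_alg map_map)
  qed
  also have "\<dots> = (\<Sum>cs\<in>cuts c. ?g cs, 0)"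
    by (simp add: prod_eq_iff fst_sum snd_sum)
  also have "(\<Sum>cs\<in>cuts c. ?g cs) = (\<Sum>cs\<in>insert [c] {cs \<in> cuts c. length cs \<ge> 2}. ?g cs)"
  proof (rule sum.cong)
    show "cuts c = insert [c] {cs \<in> cuts c. length cs \<ge> 2}"
      using cuts_length_1[of _ c] S_nonempty[OF c(1)] by (auto simp: cuts_def)
  qed simp
  also have "\<dots> = ?g [c] + stair_alg A ds xa c"
    by (subst sum.insert) (simp_all add: stair_alg_def)
  finally show ?thesis by (simp add: sh_alg_singleton d_alg_def)
qed

lemma modw_pcut:
  assumes c: "c \<in> S" "z0 \<in> {z, n}" "z0 \<in> set c" and t: "(ls, b, rs) \<in> pcuts z0 c"
    and X: "\<And>b. b \<in> S \<Longrightarrow> set b \<subseteq> set c \<Longrightarrow> z0 \<notin> set b \<Longrightarrow> fst (X b) = xa (hd b) (last b)"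
      "\<And>b. b \<in> S \<Longrightarrow> set b \<subseteq> set c \<Longrightarrow> z0 \<in> set b \<Longrightarrow> snd (X b) = xm (hd b) (last b)"
  defines "w \<equiv> map (L X) (ls @ b # rs)"
  shows "fst (wt w) = 1" "modw F w = F (map (entry ds xa) ls) (entry ds xm b) (map (entry ds xa) rs)"
proof -
  from t have cs: "ls @ b # rs \<in> cuts c" "z0 \<in> set b" by (auto simp: pcuts_def)
  then have cc: "concat ls @ b @ concat rs = c" by (simp add: cuts_def)
  have dist: "distinct c" by (rule cyc_factors_distinct[OF distinct_positions c(1)])
  have zc: "z \<notin> set c \<or> n \<notin> set c" by (rule S_interval(4)[OF c(1)])
  note bl = block_in_S[OF c(1) cs(1)]
  have z0: "z0 \<notin> set (concat ls)" "z0 \<notin> set (concat rs)" using dist cs(2) unfolding cc[symmetric] by auto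
  have nb: "z0 \<notin> set b'" if "b' \<in> set ls \<union> set rs" for b' using z0 that by auto
  have en: "toA (L X b') = entry ds xa b'" if "b' \<in> set ls \<union> set rs" for b'
  proof -
    have "b' \<in> set (ls @ b # rs)" using that by auto
    note b' = bl[OF this]
    show ?thesis by (rule toA_blk[of b' X xa, OF conjunct1[OF b'] X(1)[OF conjunct1[OF b'] conjunct2[OF b'] nb[OF that]]])
  qed
  have args: "map toA (map (L X) ls) = map (entry ds xa) ls" "map toA (map (L X) rs) = map (entry ds xa) rs"
    using en by simp_all
  have b: "b \<in> S \<and> set b \<subseteq> set c" by (rule bl) simp
  have argM: "toM (L X b) = entry ds xm b"
    by (rule toM_blk[of b X xm, OF conjunct1[OF b] X(2)[OF conjunct1[OF b] conjunct2[OF b] cs(2)]])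
  have sub: "set (concat ls) \<subseteq> set c" "set (concat rs) \<subseteq> set c" "distinct (concat ls)" "distinct (concat rs)"
    using cc dist by auto
  have no: "z \<notin> set (concat ls) \<and> n \<notin> set (concat ls)" "z \<notin> set (concat rs) \<and> n \<notin> set (concat rs)"
    using z0 c(2,3) zc sub by blast+
  have wtc: "wt (map (L X) us) = T (concat us)" for us by (induction us) auto
  have count: "fst (wt (map (L X) ls)) = 0" "fst (wt (map (L X) rs)) = 0"
    unfolding wtc using fst_T[of "concat ls"] fst_T[of "concat rs"] sub no S_subset[OF c(1)] by auto
  have count_b: "fst (fst (L X b)) = 1" using S_fst_T[of b] b cs(2) c(2) by auto
  show "fst (wt w) = 1"
    using count count_b by (simp add: w_def)
  show "modw F w = F (map (entry ds xa) ls) (entry ds xm b) (map (entry ds xa) rs)"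
    using modw_append[OF count(1) count_b] unfolding w_def map_append list.map(2) args[symmetric] argM[symmetric] .
qed

text \<open>As in \<open>ev_alg\<close>, with the block of the module index marked;
  \<open>z0\<close> is \<open>z\<close> for the first family and \<open>n\<close> for the
  second.\<close>

lemma ev_mod:
  assumes c: "c \<in> S" "z0 \<in> {z, n}" "z0 \<in> set c"
    and X: "\<And>b. b \<in> S \<Longrightarrow> set b \<subseteq> set c \<Longrightarrow> z0 \<notin> set b \<Longrightarrow> fst (X b) = xa (hd b) (last b)"
      "\<And>b. b \<in> S \<Longrightarrow> set b \<subseteq> set c \<Longrightarrow> z0 \<in> set b \<Longrightarrow> snd (X b) = xm (hd b) (last b)"
  shows "ev (L X) c op = (0, d_mod M (entry ds xm c) + stair_mod M ds z0 xa xm c)"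
proof -
  let ?g = "\<lambda>(ls, b, rs). sh_mod (beta M) (map (entry ds xa) ls) (entry ds xm b) (map (entry ds xa) rs)"
  have "ev (L X) c op = (\<Sum>(ls, b, rs)\<in>pcuts z0 c. op (map (L X) (ls @ b # rs)))"
    unfolding ev_def by (rule sum_cuts_pcuts[OF cyc_factors_distinct[OF distinct_positions c(1)] c(3)])
  also have "\<dots> = (\<Sum>t\<in>pcuts z0 c. (0, ?g t))"
  proof (intro sum.cong refl)
    fix t assume "t \<in> pcuts z0 c"
    moreover obtain ls b rs where t_eq: "t = (ls, b, rs)" by (metis prod.exhaust)
    ultimately have t: "(ls, b, rs) \<in> pcuts z0 c" by simp
    have "fst (wt (map (L X) (ls @ b # rs))) = 1" "modw (sh_mod (beta M)) (map (L X) (ls @ b # rs))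
        = sh_mod (beta M) (map (entry ds xa) ls) (entry ds xm b) (map (entry ds xa) rs)"
      by (rule modw_pcut[OF c t, of X xa xm], (rule X; assumption)+)+
    then show "(case t of (ls, b, rs) \<Rightarrow> op (map (L X) (ls @ b # rs))) = (0, ?g t)"
      by (simp only: t_eq prod.case joint_def) simp
  qed
  also have "\<dots> = (0, \<Sum>t\<in>pcuts z0 c. ?g t)"
    by (simp add: prod_eq_iff fst_sum snd_sum)
  also have "(\<Sum>t\<in>pcuts z0 c. ?g t)
    = (\<Sum>t\<in>insert ([], c, []) {(ls, b, rs) \<in> pcuts z0 c. length ls + 1 + length rs \<ge> 2}. ?g t)"
  proof (rule sum.cong)
    have "ls = [] \<and> rs = [] \<and> b = c" if "(ls, b, rs) \<in> pcuts z0 c" "\<not> length ls + 1 + length rs \<ge> 2" for ls b rs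
      using that by (cases ls; cases rs) (auto simp: pcuts_def cuts_def)
    moreover have "([], c, []) \<in> pcuts z0 c" using c S_nonempty[OF c(1)] by (auto simp: pcuts_def cuts_def)
    ultimately show "pcuts z0 c = insert ([], c, []) {(ls, b, rs) \<in> pcuts z0 c. length ls + 1 + length rs \<ge> 2}"
      by blast
  qed simp
  also have "\<dots> = ?g ([], c, []) + stair_mod M ds z0 xa xm c"
  proof (subst sum.insert)
    show "finite {(ls, b, rs) \<in> pcuts z0 c. length ls + 1 + length rs \<ge> 2}"
      by (rule finite_subset[OF _ finite_pcuts[of z0 c]]) auto
  qed (auto simp: stair_mod_def)
  finally show ?thesis by (simp add: sh_mod_singleton d_mod_def)
qed

text \<open>The middle interval of a cyclic cut is \<open>[p, q]\<close>, and its complement through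
  \<open>n\<close> runs from \<open>q + 1\<close> to \<open>p - 1\<close>, or to \<open>n\<close> if
  \<open>p = 1\<close>.\<close>

lemma staircase_eq_pairval:
  assumes X: "\<And>b. b \<in> S \<Longrightarrow> n \<notin> set b \<Longrightarrow> z \<notin> set b \<Longrightarrow> fst (X b) = xa (hd b) (last b)"
      "\<And>b. b \<in> S \<Longrightarrow> z \<in> set b \<Longrightarrow> snd (X b) = xm (hd b) (last b)"
      "\<And>b. b \<in> S \<Longrightarrow> n \<in> set b \<Longrightarrow> snd (X b) = xm' (hd b) (last b)"
  shows "staircase_inner_product I as m bs m' xa xm xm' = pv X"
proof -
  let ?G = "\<lambda>p q. \<Sum>(ls, c, rs)\<in>pcuts (k + 1) (seg n p q).
      ksign (ssum ds [1..<p] * ssum ds [p..<Suc n])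
        (sh_mod I (map (entry ds xa) ls) (entry ds xm c) (map (entry ds xa) rs)
               (xm' (q + 1) (if p = 1 then n else p - 1)))"
  let ?K = "\<lambda>a b c d. ksign (snd (T a) * (snd (T (b @ z # c)) + snd (T d) + snd (\<tau> n)))
      (ev (L X) (b @ z # c) (\<lambda>w. pair_word w (X (d @ n # a))))"
  \<comment> \<open>With \<open>p = Suc i\<close> and \<open>q = z + j\<close>, the first
    \<open>i\<close> members of \<open>ca\<close> and the last \<open>l - j\<close> members of
    \<open>cb\<close> go to the second argument.\<close>
  have eq: "?G (Suc i) (z + j) = ?K (take i ca) (drop i ca) (take j cb) (drop j cb)" if ij: "i \<le> k" "j \<le> l" for i j
  proof -
    have abcd: "take i ca = [1..<Suc i]" "drop i ca = [Suc i..<z]" "take j cb = [k + 2..<k + 2 + j]" "drop j cb = [k + 2 + j..<n]"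
      using ij by (simp_all add: take_upt ca_def cb_def)
    have c2: "drop i ca @ z # take j cb = [Suc i..<Suc (z + j)]"
      using ij upt_split[of "Suc i" z "Suc (z + j)"] upt_conv_Cons[of z "Suc (z + j)"] by (simp add: abcd)
    have seg: "seg n (Suc i) (z + j) = [Suc i..<Suc (z + j)]" using ij by (simp add: seg_def)
    have "(Suc i, z + j) \<in> pairs k l" using ij by (auto simp: pairs_def)
    then have inS: "[Suc i..<Suc (z + j)] \<in> S" using seg_in_S(1)[of "Suc i" "z + j"] seg by simp
    let ?j = "if Suc i = 1 then n else Suc i - 1"
    have rest: "drop j cb @ n # take i ca = seg n (z + j + 1) ?j"
    proof -
      have "drop j cb @ n # take i ca = [k + 2 + j..<Suc n] @ [1..<Suc i]"
        unfolding abcd using ij upt_split[of "k + 2 + j" n "Suc n"] by (simp add: upt_conv_Cons)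
      also have "\<dots> = seg n (z + j + 1) ?j" using ij by (auto simp: seg_def)
      finally show ?thesis .
    qed
    have prest: "(z + j + 1, ?j) \<in> pairs' k l" using ij by (auto simp: pairs'_def)
    have Xrest: "snd (X (drop j cb @ n # take i ca)) = xm' (z + j + 1) ?j"
    proof -
      note s = seg_in_S[OF disjI2[OF prest]]
      have "n \<in> set (drop j cb @ n # take i ca)" by simp
      from X(3)[OF s(1) this[unfolded rest]] show ?thesis by (simp only: rest s(2,3))
    qed
    have s1: "ssum ds [1..<Suc i] = snd (T (take i ca))" unfolding abcd using ij by (intro ssum_eq) auto
    have s2: "ssum ds [Suc i..<Suc n] = snd (T (drop i ca @ z # take j cb)) + snd (T (drop j cb)) + snd (\<tau> n)"
    proof -
      have "[Suc i..<Suc n] = [Suc i..<Suc (z + j)] @ [Suc (z + j)..<n] @ [n]"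
        using ij upt_split[of "Suc i" "Suc (z + j)" "Suc n"] upt_split[of "Suc (z + j)" n "Suc n"] by (simp add: upt_conv_Cons)
      then have "[Suc i..<Suc n] = (drop i ca @ z # take j cb) @ drop j cb @ [n]"
        unfolding c2 abcd(4) by simp
      moreover have "ssum ds [Suc i..<Suc n] = snd (T [Suc i..<Suc n])" using ij by (intro ssum_eq) auto
      ultimately show ?thesis by simp
    qed
    have "?G (Suc i) (z + j) = ksign (snd (T (take i ca)) * (snd (T (drop i ca @ z # take j cb)) + snd (T (drop j cb)) + snd (\<tau> n)))
      (\<Sum>(ls, c, rs)\<in>pcuts z (drop i ca @ z # take j cb).
        pair_word (map (L X) (ls @ c # rs)) (X (drop j cb @ n # take i ca)))"
      unfolding ksign_sum3 s1 s2 seg c2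
    proof (rule sum3_cong, goal_cases)
      case (1 ls b rs)
      have X1: "fst (X b) = xa (hd b) (last b)" if "b \<in> S" "set b \<subseteq> set [Suc i..<Suc (z + j)]" "z \<notin> set b" for b
        using that ij by (intro X(1)) auto
      have z: "z \<in> {z, n}" "z \<in> set [Suc i..<Suc (z + j)]" using ij by auto
      have "fst (wt (map (L X) (ls @ b # rs))) = 1" "modw (sh_mod I) (map (L X) (ls @ b # rs))
          = sh_mod I (map (entry ds xa) ls) (entry ds xm b) (map (entry ds xa) rs)"
        by (rule modw_pcut[OF inS z 1, of X xa xm], (rule X1 X(2); assumption)+)+
      then show ?case by (simp only: pair_word_def simp_thms if_True Xrest)
    qed
    also have "(\<Sum>(ls, c, rs)\<in>pcuts z (drop i ca @ z # take j cb).
        pair_word (map (L X) (ls @ c # rs)) (X (drop j cb @ n # take i ca)))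
      = ev (L X) (drop i ca @ z # take j cb) (\<lambda>w. pair_word w (X (drop j cb @ n # take i ca)))"
      unfolding ev_def using cyc_factors_distinct[OF distinct_positions inS] ij
      by (intro sum_cuts_pcuts[symmetric]) (simp_all only: c2, simp_all)
    finally show ?thesis .
  qed
  have "staircase_inner_product I as m bs m' xa xm xm' = (\<Sum>p\<in>{1..k + 1}. \<Sum>q\<in>{k + 1..k + l + 1}. ?G p q)"
    by (simp only: staircase_inner_product_def Let_def)
  also have "\<dots> = (\<Sum>i\<le>k. \<Sum>q\<in>{k + 1..k + l + 1}. ?G (Suc i) q)"
    by (rule sum.reindex_bij_witness[where i = Suc and j = "\<lambda>p. p - 1"]) auto
  also have "\<dots> = (\<Sum>i\<le>k. \<Sum>j\<le>l. ?G (Suc i) (z + j))"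
    by (rule sum.cong[OF refl], rule sum.reindex_bij_witness[where i = "\<lambda>j. z + j" and j = "\<lambda>q. q - z"]) auto
  also have "\<dots> = (\<Sum>i\<le>k. \<Sum>j\<le>l. ?K (take i ca) (drop i ca) (take j cb) (drop j cb))"
    by (intro sum.cong refl eq) auto
  also have "\<dots> = (\<Sum>(a, b)\<in>split2 ca. \<Sum>(c, d)\<in>split2 cb. ?K a b c d)"
    by (simp add: sum_split2_conv ca_def cb_def)
  also have "\<dots> = pv X"
    by (rule pairval_mid[symmetric]; subst fst_T) (auto simp: ca_def cb_def)
  finally show ?thesis .
qed

text \<open>No interval contains both \<open>z\<close> and \<open>n\<close>, so the two triangular
  families can be glued into one function on intervals; they agree where both are defined.\<close>

lemma mc_family_of_system:
  assumes sys: "cyclic_defining_system A M as m bs m' xa xm xa' xm'"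
  obtains X where "mc X" "\<And>i. i \<in> {1..n} \<Longrightarrow> X [i] = snd (xl i)"
    "staircase_inner_product I as m bs m' xa xm xm' = pv X"
proof -
  have diag: "\<And>i. i \<in> {1..k} \<Longrightarrow> xa i i = snd (as ! (i - 1))"
      "\<And>i. i \<in> {k + 2..k + l + 1} \<Longrightarrow> xa i i = snd (bs ! (i - k - 2))"
      "xm (k + 1) (k + 1) = snd m" "xm' n n = snd m'"
    and agree: "\<And>i j. 1 \<le> i \<and> i \<le> j \<and> j \<le> k \<or> k + 2 \<le> i \<and> i \<le> j \<and> j \<le> k + l + 1 \<Longrightarrow> xa i j = xa' i j"
    and fam: "defining_family A M ds z (pairs k l) xa xm" "defining_family A M ds n (pairs' k l) xa' xm'"
    using sys[unfolded cyclic_defining_system_def Let_def] by (elim conjE; simp only: Ball_def; blast)+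
  define X where "X c = (if n \<in> set c then (0, xm' (hd c) (last c))
    else if z \<in> set c then (0, xm (hd c) (last c)) else (xa (hd c) (last c), 0))" for c
  have *: "X c \<in> comb A M (T c) \<and> ev (L X) c op = 0" if c: "c \<in> S" for c
  proof -
    note i = S_interval[OF c] and simps = X_def entry_def homog_def comb_def ssum_eq[OF S_subset[OF c]] zero_prod_def
    consider "n \<notin> set c" "z \<notin> set c" | "n \<notin> set c" "z \<in> set c" | "n \<in> set c" by blast
    then show ?thesis
    proof cases
      case 1
      have "entry ds xa c \<in> homog A \<and> d_alg A (entry ds xa c) = - stair_alg A ds xa c"
        using bspec[OF fam(1)[unfolded defining_family_def length_ds Let_def] i(2)[OF 1(1)], unfolded prod.case i(1)] 1(2)
        by (simp only: if_False)
      moreover have "ev (L X) c op = (d_alg A (entry ds xa c) + stair_alg A ds xa c, 0)"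
        using 1 by (intro ev_alg[OF c]) (auto simp: X_def)
      ultimately show ?thesis using 1 S_fst_T[OF c] by (auto simp: simps)
    next
      case 2
      have "entry ds xm c \<in> homog M \<and> d_mod M (entry ds xm c) = - stair_mod M ds z xa xm c"
        using bspec[OF fam(1)[unfolded defining_family_def length_ds Let_def] i(2)[OF 2(1)], unfolded prod.case i(1)] 2(2)
        by (simp only: if_True)
      moreover have "ev (L X) c op = (0, d_mod M (entry ds xm c) + stair_mod M ds z xa xm c)"
        using 2 by (intro ev_mod[OF c]) (auto simp: X_def)
      ultimately show ?thesis using 2 S_fst_T[OF c] by (auto simp: simps)
    next
      case 3
      with i(4) have zc: "z \<notin> set c" by blast
      have "entry ds xm' c \<in> homog M \<and> d_mod M (entry ds xm' c) = - stair_mod M ds n xa' xm' c"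
        using bspec[OF fam(2)[unfolded defining_family_def length_ds Let_def] i(3)[OF 3], unfolded prod.case i(1)] 3
        by (simp only: if_True)
      moreover have "ev (L X) c op = (0, d_mod M (entry ds xm' c) + stair_mod M ds n xa' xm' c)"
      \<comment> \<open>The defining equation uses the second family, while \<open>X\<close> takes
        algebra entries from the first. A block avoiding \<open>n\<close> here also avoids
        \<open>z\<close>, so it lies within one of the two stretches of algebra positions, where the
        families agree.\<close>
      proof (rule ev_mod[OF c _ 3])
        fix b assume b: "b \<in> S" "set b \<subseteq> set c" "n \<notin> set b"
        then have zb: "z \<notin> set b" using zc by blast
        have bp: "(hd b, last b) \<in> pairs k l" "seg n (hd b) (last b) = b" using S_interval[OF b(1)] b(3) by auto
        then have "b = [hd b..<Suc (last b)]" by (simp add: pairs_def seg_def)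
        then have "z \<notin> set [hd b..<Suc (last b)]" using zb by simp
        then have "xa (hd b) (last b) = xa' (hd b) (last b)"
          using bp(1) by (intro agree) (auto simp: pairs_def)
        then show "fst (X b) = xa' (hd b) (last b)" using b(3) zb by (simp add: X_def)
      qed (auto simp: X_def)
      ultimately show ?thesis using 3 S_fst_T[OF c] by (auto simp: simps)
    qed
  qed
  have "mc X"
  proof
    show "b \<in> S" if "a @ b @ c \<in> S" "b \<noteq> []" for a b c
      using that by (rule cyc_factors_factor)
    show "distinct c" if "c \<in> S" for c
      using cyc_factors_distinct[OF distinct_positions that] .
  qed (use * S_nonempty in simp_all)
  moreover have "X [i] = snd (xl i)" if i: "i \<in> {1..n}" for i
  proof -
    have "i \<in> {1..k} \<or> i = z \<or> i \<in> {k + 2..k + l + 1} \<or> i = n"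
      using i unfolding atLeastAtMost_iff by linarith
    then consider "i \<in> {1..k}" | "i = z" | "i \<in> {k + 2..k + l + 1}" | "i = n" by blast
    then show ?thesis
      using diag xl_eq(2,4) by cases (simp_all add: X_def xl_eq(1,3) ofA_def ofM_def)
  qed
  moreover have "staircase_inner_product I as m bs m' xa xm xm' = pv X"
  proof (rule staircase_eq_pairval)
    fix b assume "b \<in> S" "z \<in> set b"
    then show "snd (X b) = xm (hd b) (last b)" using S_interval(4)[of b] by (auto simp: X_def)
  qed (auto simp: X_def)
  ultimately show thesis by (rule that)
qed

text \<open>Both triangular families are read off the same \<open>X\<close>, so their required
  agreement is automatic.\<close>

lemma system_of_mc_family:
  assumes mcX: "mc X" and sing: "\<And>i. i \<in> {1..n} \<Longrightarrow> X [i] = snd (xl i)"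
  shows "pv X \<in> massey_inner_product A M I as m bs m'"
proof -
  interpret X: mc_family "comb A M" op \<tau> X S by (rule mcX)
  define xa where "xa i j = fst (X (seg n i j))" for i j
  define xm where "xm i j = snd (X (seg n i j))" for i j
  have xa: "xa (hd b) (last b) = fst (X b)" and xm: "xm (hd b) (last b) = snd (X b)" if "b \<in> S" for b
    using S_interval(1)[OF that] by (simp_all add: xa_def xm_def)
  have alg: "entry ds xa c \<in> homog A \<and> d_alg A (entry ds xa c) = - stair_alg A ds xa c"
    if c: "c \<in> S" "z \<notin> set c" "n \<notin> set c" for c
  proof
    show "entry ds xa c \<in> homog A"
      using X.X_closed[OF c(1)] S_fst_T[OF c(1)] c xa[OF c(1)]
      by (auto simp: entry_def homog_def comb_def ssum_eq[OF S_subset[OF c(1)]])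
    have "ev (L X) c op = (d_alg A (entry ds xa c) + stair_alg A ds xa c, 0)"
      using c xa by (intro ev_alg) auto
    then show "d_alg A (entry ds xa c) = - stair_alg A ds xa c"
      using X.mc[OF c(1)] by (simp add: zero_prod_def eq_neg_iff_add_eq_0)
  qed
  have mod: "entry ds xm c \<in> homog M \<and> d_mod M (entry ds xm c) = - stair_mod M ds z0 xa xm c"
    if c: "c \<in> S" "z0 \<in> {z, n}" "z0 \<in> set c" for c z0
  proof
    show "entry ds xm c \<in> homog M"
      using X.X_closed[OF c(1)] S_fst_T[OF c(1)] c xm[OF c(1)]
      by (auto simp: entry_def homog_def comb_def ssum_eq[OF S_subset[OF c(1)]])
    have "ev (L X) c op = (0, d_mod M (entry ds xm c) + stair_mod M ds z0 xa xm c)"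
      using c xa xm by (intro ev_mod) auto
    then show "d_mod M (entry ds xm c) = - stair_mod M ds z0 xa xm c"
      using X.mc[OF c(1)] by (simp add: zero_prod_def eq_neg_iff_add_eq_0)
  qed
  have fam1: "defining_family A M ds z (pairs k l) xa xm"
    unfolding defining_family_def length_ds Let_def
  proof clarify
    fix i j assume ij: "(i, j) \<in> pairs k l"
    then have "n \<notin> set (seg n i j)" by (auto simp: pairs_def seg_def)
    with ij show "if z \<in> set (seg n i j) then entry ds xm (seg n i j) \<in> homog M \<and>
        d_mod M (entry ds xm (seg n i j)) = - stair_mod M ds z xa xm (seg n i j)
      else entry ds xa (seg n i j) \<in> homog A \<and> d_alg A (entry ds xa (seg n i j)) = - stair_alg A ds xa (seg n i j)"
      using alg[of "seg n i j"] mod[of "seg n i j" z] seg_in_S(1)[of i j] by auto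
  qed
  have fam2: "defining_family A M ds n (pairs' k l) xa xm"
    unfolding defining_family_def length_ds Let_def
  proof clarify
    fix i j assume ij: "(i, j) \<in> pairs' k l"
    then have "z \<notin> set (seg n i j)" by (auto simp: pairs'_def seg_def)
    with ij show "if n \<in> set (seg n i j) then entry ds xm (seg n i j) \<in> homog M \<and>
        d_mod M (entry ds xm (seg n i j)) = - stair_mod M ds n xa xm (seg n i j)
      else entry ds xa (seg n i j) \<in> homog A \<and> d_alg A (entry ds xa (seg n i j)) = - stair_alg A ds xa (seg n i j)"
      using alg[of "seg n i j"] mod[of "seg n i j" n] seg_in_S(1)[of i j] by auto
  qed
  have diag: "seg p i i = [i]" for p i by (simp add: seg_def upt_conv_Cons)
  have "xa i i = snd (as ! (i - 1))" if "i \<in> {1..k}" for i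
    using sing[of i] that by (simp add: xa_def diag xl_eq(1) ofA_def)
  moreover have "xa i i = snd (bs ! (i - k - 2))" if "i \<in> {k + 2..k + l + 1}" for i
    using sing[of i] that by (simp add: xa_def diag xl_eq(3) ofA_def)
  moreover have "xm (k + 1) (k + 1) = snd m" "xm n n = snd m'"
    using sing[of z] sing[of n] xl_eq(2,4) by (simp_all add: xm_def diag ofM_def)
  ultimately have "cyclic_defining_system A M as m bs m' xa xm xa xm"
    using fam1 fam2 unfolding cyclic_defining_system_def Let_def by blast
  moreover have "staircase_inner_product I as m bs m' xa xm xm = pv X"
    by (rule staircase_eq_pairval) (simp_all add: xa xm)
  ultimately show ?thesis unfolding massey_inner_product_def by force
qed

text \<open>In every term a functional is evaluated at a vector of a degree in which it is zero.
  This covers the inputs excluded by \<open>total\<close>.\<close>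

lemma pairval_eq_0_degree:
  assumes mcX: "mc X"
    and deg: "sum_list (map (\<lambda>i. snd (\<tau> i)) (ca @ z # cb @ [n])) \<noteq> - e - 2"
  shows "pv X = 0"
proof -
  interpret X: mc_family "comb A M" op \<tau> X S by (rule mcX)
  have snd_T: "snd (T b) = sum_list (map (\<lambda>i. snd (\<tau> i)) b)" for b by (induction b) auto
  have 0: "fst (T ca) = 0" "fst (T cb) = 0" by (subst fst_T; auto simp: ca_def cb_def)+
  have "ev (L X) (b @ z # c) (\<lambda>w. pair_word w (X (d @ n # a))) = 0"
    if ab: "ca = a @ b" and cd: "cb = c @ d" for a b c d
  proof -
    have S1: "b @ z # c \<in> S" using ab cd by (intro cyc_factorsI(1)[of a _ d]) auto
    have S2: "d @ n # a \<in> S" using ab cd by (intro cyc_factorsI(2)[of c _ b]) auto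
    have x: "snd (X (d @ n # a)) \<in> gr M (snd (T (d @ n # a)) + 1)"
      by (rule comb_1[OF _ X.X_closed[OF S2]]) (use S_fst_T[OF S2] in simp)
    have "pair_word (map (L X) cs) (X (d @ n # a)) = 0" if cs: "cs \<in> cuts (b @ z # c)" for cs
    proof -
      have "b @ z # c \<in> X.S0" using S1 unfolding X.S0_def by blast
      from X.adm_L[OF this cs] have "adm_word A M (map (L X) cs)" by (simp add: adm_conv)
      moreover have "fst (wt (map (L X) cs)) = 1" using S_fst_T[OF S1] by (simp add: wt_blk[OF cs])
      ultimately obtain \<phi> where \<phi>: "\<phi> \<in> gr (dual M) (snd (wt (map (L X) cs)) + e + 1)"
        "\<And>y. pair_word (map (L X) cs) y = \<phi> (snd y)" by (rule pair_word_gr) blast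
      have "snd (T (d @ n # a)) + 1 \<noteq> - (snd (wt (map (L X) cs)) + e + 1)"
        using deg unfolding wt_blk[OF cs] snd_T by (simp add: ab cd)
      from dual_gr_eq_0_degree[OF graded_M \<phi>(1) x this] show ?thesis by (simp add: \<phi>(2))
    qed
    then show ?thesis unfolding ev_def by (intro sum.neutral) auto
  qed
  then show ?thesis
    unfolding pairval_mid[OF 0] by (intro sum.neutral) (auto simp: split2_def intro!: sum.neutral)
qed

end

theorem corollary4p14:
  fixes A :: "('r::comm_ring_1, 'a::ab_group_add) ainf_algebra"
    and M :: "('r, 'a, 'm::ab_group_add) ainf_module"
    and I :: "('a, 'm, 'm \<Rightarrow> 'r) mod_maps"
    and e :: int
    and k l :: nat
    and as bs :: "'a elem list"
    and m m' :: "'m elem"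
  assumes "is_triple A M e I"
    and "formal TYPE('b::ab_group_add) TYPE('n::ab_group_add) A M e I"
    and "k + l \<ge> 1"
    and "as \<in> lists (homog A)" "length as = k"
    and "m \<in> homog M"
    and "bs \<in> lists (homog A)" "length bs = l"
    and "m' \<in> homog M"
  shows "massey_inner_product A M I as m bs m' = {} \<or> 0 \<in> massey_inner_product A M I as m bs m'"
proof (rule disjCI)
  assume "0 \<notin> massey_inner_product A M I as m bs m'"
  interpret massey_input A M e I as m bs m'
    using assms(1) by unfold_locales (simp_all add: is_triple_def)
  show "massey_inner_product A M I as m bs m' = {}"
  proof (rule ccontr)
    assume "massey_inner_product A M I as m bs m' \<noteq> {}"
    then obtain xa xm xa' xm' where "cyclic_defining_system A M as m bs m' xa xm xa' xm'"
      by (auto simp: massey_inner_product_def)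
    then obtain X where X: "mc X" "\<forall>i\<in>{1..n}. X [i] = snd (xl i)"
      by (rule mc_family_of_system) blast
    have "\<exists>X. mc X \<and> (\<forall>i\<in>{1..n}. X [i] = snd (xl i))
      \<and> pv X = 0"
    \<comment> \<open>In the right total degree the formal model provides the new family. Otherwise
      the pairing is zero on every family, and the given \<open>X\<close> will do.\<close>
    proof (cases "sum_list (map (\<lambda>i. snd (\<tau> i)) (ca @ z # cb @ [n])) = - e - 2")
      case True
      from assms(2) obtain B :: "('r, 'b) ainf_algebra" and N :: "('r, 'b, 'n) ainf_module" and e' J f F g G where
        "is_triple B N e' J" "has_only_binary_structure B N J"
        "is_triple_morphism A M I B N e' J f F" "is_triple_morphism B N J A M e I g G"
        "inverse_on_cohomology A (d_alg A) B (d_alg B) (\<lambda>x. f [x]) (\<lambda>x. g [x])"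
        "inverse_on_cohomology M (d_mod M) N (d_mod N) (\<lambda>x. F [] x []) (\<lambda>x. G [] x [])"
        unfolding formal_def equivalent_triples_def by blast
      note F = this
      have tr: "is_ainf_algebra B" "is_ainf_module B N" "is_alg_morphism A B f" "is_mod_morphism A M N f 0 F"
        "is_alg_morphism B A g" "is_mod_morphism B N M g 0 G"
        "is_exact_inner_product B N (\<lambda>as m bs. pullback N g G e I as m bs - J as m bs)"
        using F(1,3,4) unfolding is_triple_def is_triple_morphism_def by blast+
      have ne: "ca @ cb \<noteq> []" using assms(3,5,8) by (auto simp: ca_def cb_def)
      have count: "fst (fst (xl i)) = (if i = z \<or> i = n then 1 else 0)"
        and single: "X [i] = snd (xl i)" if "i \<in> set (ca @ z # cb @ [n])" for i
        using that X(2) unfolding P by (simp_all add: fst_\<tau>)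
      interpret fm: formality A M e I B N J f F g G
        by unfold_locales (fact tr F(2,5,6))+
      interpret fc: formality_cyclic A M e I B N J f F g G ca z cb n xl X
        by (rule formality_cyclic.intro[OF fm.formality_axioms], rule formality_cyclic_axioms.intro)
          (fact distinct_positions ne count True X(1) single)+
      from fc.exists_family_pairval_0 show ?thesis unfolding P .
    next
      case False
      from pairval_eq_0_degree[OF X(1) this] X show ?thesis by (intro exI[of _ X] conjI)
    qed
    then obtain Y where Y: "mc Y" "\<forall>i\<in>{1..n}. Y [i] = snd (xl i)"
      "pv Y = 0" by blast
    from system_of_mc_family[OF Y(1)] Y(2,3) \<open>0 \<notin> massey_inner_product A M I as m bs m'\<close> show False by simp
  qed
qed

end
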